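(* Let $\Gamma$ be a finite undirected simple graph with vertex set $X$ and let $G=G(\Gamma)$ be the corresponding partially commutative group. A subgroup $H$ of $G$ is a centraliser (i.e. $H=C_G(S)$ for some subset $S\subseteq G$) if and only if the following two conditions hold. (1) $H$ is conjugate in $G$ to some canonical quasiparabolic subgroup $Q$. (2) If $Q$ is written in standard form $Q=\langle w_1\rangle\times\cdots\times\langle w_k\rangle\times G(Y)$, where $w=w_1\cdots w_k$ is the block decomposition of a cyclically minimal element $w$, each $w_i$ is a root element and $|\alpha(w_i)|\ge 2$ for $i=1,\dots,k$ (with $k=0$ if $w=1$), then $Y\in \mathrm{CS}(\Gamma)$ and $Y\in \mathrm{CS}(\Gamma_w)$, where $\Gamma_w$ is the full subgraph of $\Gamma$ with vertex set $\alpha(w)^\perp\setminus\alpha(w)$.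
   Context: $G(\Gamma)$ is the group generated by $X$ subject to the relations $[x,y]=1$ for every pair $x,y\in X$ joined by an edge of $\Gamma$. For $Y\subseteq X$, $G(Y)$ is the subgroup of $G$ generated by $Y$. $C_G(S)=\{g\in G: gs=sg \text{ for all } s\in S\}$. Closed sets: for a graph $\Lambda$ with vertex set $V$ and graph distance $d$, and $U\subseteq V$, the orthogonal complement of $U$ in $\Lambda$ is $\{v\in V: d(v,u)\le 1 \text{ for all } u\in U\}$ (equal to $V$ if $U=\emptyset$). $\mathrm{CS}(\Lambda)$ is the set of all subsets of $V$ which are the orthogonal complement in $\Lambda$ of some $U\subseteq V$. For $U\subseteq X$, $U^\perp$ denotes the orthogonal complement of $U$ in $\Gamma$. Lengths and blocks: $l(g)$ is the length of a shortest word in $X\cup X^{-1}$ representing $g\in G$; such a shortest word is minimal. $\alpha(g)$ is the set of $x\in X$ such that $x^{\pm1}$ occurs in a minimal word for $g$ (well defined). $w\in G$ is cyclically minimal if $l(g^{-1}wg)\ge l(w)$ for all $g\in G$. The non-commutation graph $\Delta$ has vertex set $X$ and an edge joining $x\neq y$ iff $[x,y]\ne 1$. If $w$ is cyclically minimal and the full subgraph of $\Delta$ on $\alpha(w)$ has connected components with vertex sets $I_1,\dots,I_k$, then $w=w_1\cdots w_k$ uniquely with $\alpha(w_j)=I_j$; this is the block decomposition of $w$ and the $w_j$ are its blocks. An element is a root element if it is not a proper power of any element of $G$. Quasiparabolic subgroups: let $w$ be cyclically minimal with block decomposition $w=w_1\cdots w_k$, where each block $w_i$ is a root element ($w=1$,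 $k=0$ is allowed), and let $Z\subseteq X$ with $Z\subseteq\alpha(w)^\perp$. The subgroup $Q(w,Z)=\langle w_1\rangle\times\cdots\times\langle w_k\rangle\times G(Z)$, i.e. the subgroup generated by $w_1,\dots,w_k$ and $Z$, is called a canonical quasiparabolic subgroup. It is written in standard form if $|\alpha(w_i)|\ge 2$ for all $i$, or $w=1$. Every canonical quasiparabolic subgroup can be written in standard form. *)

theory Defs
  imports "HOL-Algebra.Generated_Groups" "Graph_Theory.Graph_Theory"
begin

section \<open>Groups given by generators and relators\<close>

text \<open>A word over \<open>X\<close> and its formal inverses is a list of signed letters:
  \<open>(x, True)\<close> stands for \<open>x\<close> and \<open>(x, False)\<close> for the inverse of \<open>x\<close>.\<close>

type_synonym 'a word = "('a \<times> bool) list"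

abbreviation words :: "'a set \<Rightarrow> 'a word set" where
  "words X \<equiv> lists (X \<times> UNIV)"

inductive_set pres_cong :: "'a set \<Rightarrow> 'a word set \<Rightarrow> 'a word rel"
  for X :: "'a set" and R :: "'a word set" where
  refl: "u \<in> words X \<Longrightarrow> (u, u) \<in> pres_cong X R"
| sym: "(u, v) \<in> pres_cong X R \<Longrightarrow> (v, u) \<in> pres_cong X R"
| trans: "\<lbrakk>(u, v) \<in> pres_cong X R; (v, w) \<in> pres_cong X R\<rbrakk> \<Longrightarrow> (u, w) \<in> pres_cong X R"
| cancel: "\<lbrakk>u \<in> words X; v \<in> words X; x \<in> X\<rbrakk> \<Longrightarrow>
    (u @ [(x, b), (x, \<not> b)] @ v, u @ v) \<in> pres_cong X R"
| relator: "\<lbrakk>u \<in> words X; v \<in> words X; r \<in> R; r \<in> words X\<rbrakk> \<Longrightarrow>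
    (u @ r @ v, u @ v) \<in> pres_cong X R"

definition presented_group :: "'a set \<Rightarrow> 'a word set \<Rightarrow> 'a word set monoid" where
  "presented_group X R = \<lparr>
     carrier = words X // pres_cong X R,
     monoid.mult = (\<lambda>A B. \<Union>a\<in>A. \<Union>b\<in>B. pres_cong X R `` {a @ b}),
     one = pres_cong X R `` {[]}\<rparr>"

lemma pres_cong_words:
  "(u, v) \<in> pres_cong X R \<Longrightarrow> u \<in> words X \<and> v \<in> words X"
  by (induction rule: pres_cong.induct) auto

lemma equiv_pres_cong: "equiv (words X) (pres_cong X R)"
  by (rule equivI)
    (auto intro!: refl_onI symI transI dest: pres_cong_words
      intro: pres_cong.refl pres_cong.sym pres_cong.trans)

lemma pres_cong_context:
  assumes "(u, v) \<in> pres_cong X R" "p \<in> words X" "q \<in> words X"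
  shows "(p @ u @ q, p @ v @ q) \<in> pres_cong X R"
  using assms
proof (induction rule: pres_cong.induct)
  case (refl u)
  then show ?case by (intro pres_cong.refl) auto
next
  case (sym u v)
  then show ?case by (blast intro: pres_cong.sym)
next
  case (trans u v w)
  then show ?case by (blast intro: pres_cong.trans)
next
  case (cancel u v x b)
  then show ?case
    using pres_cong.cancel[of "p @ u" X "v @ q" x b R] by auto
next
  case (relator u v r)
  then show ?case
    using pres_cong.relator[of "p @ u" X "v @ q" r R] by auto
qed

lemma pres_cong_append:
  assumes "(u, u') \<in> pres_cong X R" "(v, v') \<in> pres_cong X R"
  shows "(u @ v, u' @ v') \<in> pres_cong X R"
proof -
  have "(u @ v, u' @ v) \<in> pres_cong X R"
    using pres_cong_context[OF assms(1), of "[]" v] assms(2) by (auto dest: pres_cong_words)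
  moreover have "(u' @ v, u' @ v') \<in> pres_cong X R"
    using pres_cong_context[OF assms(2), of u' "[]"] assms(1) by (auto dest: pres_cong_words)
  ultimately show ?thesis by (rule pres_cong.trans)
qed

lemma presented_group_mult:
  assumes "u \<in> words X" "v \<in> words X"
  shows "pres_cong X R `` {u} \<otimes>\<^bsub>presented_group X R\<^esub> pres_cong X R `` {v}
    = pres_cong X R `` {u @ v}"
  unfolding presented_group_def
  using assms
  by (auto intro: pres_cong_append pres_cong.refl pres_cong.sym pres_cong.trans)

definition inverse_word :: "'a word \<Rightarrow> 'a word" where
  "inverse_word u = rev (map (\<lambda>(x, b). (x, \<not> b)) u)"

lemma inverse_word_in_words: "u \<in> words X \<Longrightarrow> inverse_word u \<in> words X"
  by (auto simp: inverse_word_def)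

lemma inverse_word_cancels:
  "u \<in> words X \<Longrightarrow> (inverse_word u @ u, []) \<in> pres_cong X R"
proof (induction u)
  case Nil
  then show ?case by (simp add: inverse_word_def pres_cong.refl)
next
  case (Cons a u)
  obtain x b where a: "a = (x, b)" by force
  have "(inverse_word u @ [(x, \<not> b), (x, \<not> \<not> b)] @ u, inverse_word u @ u) \<in> pres_cong X R"
    using Cons.prems a by (intro pres_cong.cancel) (auto simp: inverse_word_in_words)
  then have "(inverse_word (a # u) @ a # u, inverse_word u @ u) \<in> pres_cong X R"
    by (simp add: a inverse_word_def)
  then show ?case
    using Cons by (auto intro: pres_cong.trans)
qed

lemma group_presented_group: "group (presented_group X R)"
proof (rule groupI)
  let ?G = "presented_group X R" and ?c = "\<lambda>u. pres_cong X R `` {u}"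
  have rep: "\<exists>u\<in>words X. A = ?c u" if "A \<in> carrier ?G" for A
    using that by (auto simp: presented_group_def quotient_def)
  have cls: "?c u \<in> carrier ?G" if "u \<in> words X" for u
    using that by (auto simp: presented_group_def intro: quotientI)
  have one: "\<one>\<^bsub>?G\<^esub> = ?c []" by (simp add: presented_group_def)
  show "A \<otimes>\<^bsub>?G\<^esub> B \<in> carrier ?G" if AB: "A \<in> carrier ?G" "B \<in> carrier ?G" for A B
  proof -
    obtain u v where "u \<in> words X" "v \<in> words X" "A = ?c u" "B = ?c v"
      using rep AB by blast
    then show ?thesis using cls[of "u @ v"] by (simp add: presented_group_mult)
  qed
  show "\<one>\<^bsub>?G\<^esub> \<in> carrier ?G" using cls[of "[]"] one by simp
  show "A \<otimes>\<^bsub>?G\<^esub> B \<otimes>\<^bsub>?G\<^esub> C = A \<otimes>\<^bsub>?G\<^esub> (B \<otimes>\<^bsub>?G\<^esub> C)"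
    if ABC: "A \<in> carrier ?G" "B \<in> carrier ?G" "C \<in> carrier ?G" for A B C
  proof -
    obtain u v w where "u \<in> words X" "v \<in> words X" "w \<in> words X"
      "A = ?c u" "B = ?c v" "C = ?c w"
      using rep ABC by meson
    then show ?thesis
      using append_in_lists_conv by (simp add: presented_group_mult)
  qed
  show "\<one>\<^bsub>?G\<^esub> \<otimes>\<^bsub>?G\<^esub> A = A" if A: "A \<in> carrier ?G" for A
  proof -
    obtain u where "u \<in> words X" "A = ?c u" using rep A by blast
    then show ?thesis by (simp add: one presented_group_mult)
  qed
  show "\<exists>B\<in>carrier ?G. B \<otimes>\<^bsub>?G\<^esub> A = \<one>\<^bsub>?G\<^esub>" if A: "A \<in> carrier ?G" for A
  proof -
    obtain u where u: "u \<in> words X" "A = ?c u" using rep A by blast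
    have "?c (inverse_word u) \<otimes>\<^bsub>?G\<^esub> A = ?c (inverse_word u @ u)"
      using u by (simp add: presented_group_mult inverse_word_in_words)
    also have "\<dots> = ?c []"
      using inverse_word_cancels[OF u(1)] by (rule equiv_class_eq[OF equiv_pres_cong])
    finally show ?thesis
      using cls[OF inverse_word_in_words[OF u(1)]] one by auto
  qed
qed


section \<open>Partially commutative groups\<close>

text \<open>Undirected simple graphs are the symmetric, loop-free digraphs without parallel arcs
  of the locale \<^locale>\<open>graph\<close>.\<close>

definition pc_relators :: "('a, 'b) pre_digraph \<Rightarrow> 'a word set" where
  "pc_relators \<Gamma> =
     {[(x, False), (y, False), (x, True), (y, True)] | x y. x \<rightarrow>\<^bsub>\<Gamma>\<^esub> y}"

definition pc_group :: "('a, 'b) pre_digraph \<Rightarrow> 'a word set monoid" where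
  "pc_group \<Gamma> = presented_group (verts \<Gamma>) (pc_relators \<Gamma>)"

definition gen :: "('a, 'b) pre_digraph \<Rightarrow> 'a \<Rightarrow> 'a word set" where
  "gen \<Gamma> x = pres_cong (verts \<Gamma>) (pc_relators \<Gamma>) `` {[(x, True)]}"

lemma group_pc_group: "group (pc_group \<Gamma>)"
  by (simp add: pc_group_def group_presented_group)

definition centraliser :: "('g, 'm) monoid_scheme \<Rightarrow> 'g set \<Rightarrow> 'g set" where
  "centraliser G S = {g \<in> carrier G. \<forall>s\<in>S. g \<otimes>\<^bsub>G\<^esub> s = s \<otimes>\<^bsub>G\<^esub> g}"

definition commutator :: "('g, 'm) monoid_scheme \<Rightarrow> 'g \<Rightarrow> 'g \<Rightarrow> 'g" where
  "commutator G g h = inv\<^bsub>G\<^esub> g \<otimes>\<^bsub>G\<^esub> inv\<^bsub>G\<^esub> h \<otimes>\<^bsub>G\<^esub> g \<otimes>\<^bsub>G\<^esub> h"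

definition conjugate_subgroups :: "('g, 'm) monoid_scheme \<Rightarrow> 'g set \<Rightarrow> 'g set \<Rightarrow> bool" where
  "conjugate_subgroups G H K \<longleftrightarrow>
     (\<exists>g\<in>carrier G. H = (\<lambda>k. inv\<^bsub>G\<^esub> g \<otimes>\<^bsub>G\<^esub> k \<otimes>\<^bsub>G\<^esub> g) ` K)"

definition root_element :: "('g, 'm) monoid_scheme \<Rightarrow> 'g \<Rightarrow> bool" where
  "root_element G g \<longleftrightarrow> g \<in> carrier G \<and>
     \<not> (\<exists>h\<in>carrier G. \<exists>n::nat. 2 \<le> n \<and> g = h [^]\<^bsub>G\<^esub> n)"


section \<open>Closed sets\<close>

definition graph_dist :: "('a, 'b) pre_digraph \<Rightarrow> 'a \<Rightarrow> 'a \<Rightarrow> ereal" where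
  "graph_dist \<Lambda> u v = wf_digraph.\<mu> \<Lambda> (\<lambda>_. 1) u v"

definition orth :: "('a, 'b) pre_digraph \<Rightarrow> 'a set \<Rightarrow> 'a set" where
  "orth \<Lambda> U = {v \<in> verts \<Lambda>. \<forall>u\<in>U. graph_dist \<Lambda> v u \<le> 1}"

definition closed_sets :: "('a, 'b) pre_digraph \<Rightarrow> 'a set set" where
  "closed_sets \<Lambda> = {orth \<Lambda> U | U. U \<subseteq> verts \<Lambda>}"


section \<open>Lengths and blocks\<close>

text \<open>The elements of \<open>pc_group \<Gamma>\<close> are classes of words, so a word \<open>u\<close> represents \<open>g\<close>
  iff \<open>u \<in> g\<close>.\<close>

definition len :: "'a word set \<Rightarrow> nat" where
  "len g = (LEAST n. \<exists>u\<in>g. length u = n)"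

definition minimal_word :: "'a word \<Rightarrow> 'a word set \<Rightarrow> bool" where
  "minimal_word u g \<longleftrightarrow> u \<in> g \<and> length u = len g"

definition supp :: "'a word set \<Rightarrow> 'a set" where
  "supp g = {x. \<exists>u b. minimal_word u g \<and> (x, b) \<in> set u}"

definition cyclically_minimal :: "('a, 'b) pre_digraph \<Rightarrow> 'a word set \<Rightarrow> bool" where
  "cyclically_minimal \<Gamma> w \<longleftrightarrow> w \<in> carrier (pc_group \<Gamma>) \<and>
     (\<forall>g\<in>carrier (pc_group \<Gamma>).
        len w \<le> len (inv\<^bsub>pc_group \<Gamma>\<^esub> g \<otimes>\<^bsub>pc_group \<Gamma>\<^esub> w \<otimes>\<^bsub>pc_group \<Gamma>\<^esub> g))"

definition noncomm_graph :: "('a, 'b) pre_digraph \<Rightarrow> 'a pair_pre_digraph" where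
  "noncomm_graph \<Gamma> = \<lparr> pverts = verts \<Gamma>,
     parcs = {(x, y). x \<in> verts \<Gamma> \<and> y \<in> verts \<Gamma> \<and> x \<noteq> y \<and>
       commutator (pc_group \<Gamma>) (gen \<Gamma> x) (gen \<Gamma> y) \<noteq> \<one>\<^bsub>pc_group \<Gamma>\<^esub>} \<rparr>"

text \<open>The non-commutation graph is symmetric, so its strongly connected components are its
  connected components. The blocks \<open>ws\<close> of \<open>w\<close> are listed in an arbitrary order.\<close>

definition block_decomposition ::
    "('a, 'b) pre_digraph \<Rightarrow> 'a word set \<Rightarrow> 'a word set list \<Rightarrow> bool" where
  "block_decomposition \<Gamma> w ws \<longleftrightarrow>
     cyclically_minimal \<Gamma> w \<and>
     set ws \<subseteq> carrier (pc_group \<Gamma>) \<and>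
     w = foldr (monoid.mult (pc_group \<Gamma>)) ws \<one>\<^bsub>pc_group \<Gamma>\<^esub> \<and>
     distinct (map supp ws) \<and>
     set (map supp ws) = pre_digraph.sccs_verts (with_proj (noncomm_graph \<Gamma>) \<restriction> supp w)"


section \<open>Quasiparabolic subgroups\<close>

definition qp_data ::
    "('a, 'b) pre_digraph \<Rightarrow> 'a word set \<Rightarrow> 'a word set list \<Rightarrow> 'a set \<Rightarrow> bool" where
  "qp_data \<Gamma> w ws Z \<longleftrightarrow>
     block_decomposition \<Gamma> w ws \<and>
     (\<forall>v\<in>set ws. root_element (pc_group \<Gamma>) v) \<and>
     Z \<subseteq> orth \<Gamma> (supp w)"

definition qp_subgroup ::
    "('a, 'b) pre_digraph \<Rightarrow> 'a word set list \<Rightarrow> 'a set \<Rightarrow> 'a word set set" where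
  "qp_subgroup \<Gamma> ws Z = generate (pc_group \<Gamma>) (set ws \<union> gen \<Gamma> ` Z)"

definition canonical_quasiparabolic ::
    "('a, 'b) pre_digraph \<Rightarrow> 'a word set set \<Rightarrow> bool" where
  "canonical_quasiparabolic \<Gamma> Q \<longleftrightarrow>
     (\<exists>w ws Z. qp_data \<Gamma> w ws Z \<and> Q = qp_subgroup \<Gamma> ws Z)"

text \<open>For \<open>w = 1\<close> there are no blocks, and the condition on supports holds vacuously.\<close>

definition standard_form ::
    "('a, 'b) pre_digraph \<Rightarrow> 'a word set set \<Rightarrow> 'a word set \<Rightarrow> 'a word set list \<Rightarrow> 'a set \<Rightarrow> bool"
  where
  "standard_form \<Gamma> Q w ws Y \<longleftrightarrow>
     qp_data \<Gamma> w ws Y \<and> Q = qp_subgroup \<Gamma> ws Y \<and> (\<forall>v\<in>set ws. 2 \<le> card (supp v))"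

end

theory Submission
  imports Defs
begin

text \<open>
  Write \<open>G\<close> for the partially commutative group of \<open>\<Gamma>\<close> with generating set \<open>X\<close>. The argument
  rests on the normal form theorem: two reduced words represent the same element iff they
  differ by swaps of adjacent commuting letters (\<open>reduced_unique\<close>). Words up to swaps are
  traces, and equality of traces is tested on the projections to pairs of generators that
  are equal or not adjacent, so that questions about traces become questions about ordinary
  lists. In particular all traces that commute with a given trace \<open>u\<close> and live on its
  support are powers of one trace, if this support is connected in the non-commutation
  graph (\<open>trace_root\<close>).

  If \<open>w\<close> is cyclically minimal and \<open>c\<close> commutes with \<open>w\<close>, then multiplication of
  \<open>c\<close> by a high power of \<open>w\<close> exhausts all cancellation, and the commutation of \<open>c w^N\<close>
  with \<open>w\<close> is a statement about traces. Hence the centraliser of \<open>w\<close> lies in the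
  parabolic subgroup on the support of \<open>w\<close> and the generators that commute with it
  (\<open>centraliser_supp\<close>), it meets the parabolic subgroup of a connected support in the cyclic
  group of a root element (\<open>centraliser_connected\<close>), and it is generated by the blocks of
  \<open>w\<close> and the generators commuting with \<open>w\<close> if the blocks are root elements
  (\<open>centraliser_blocks\<close>). The retractions that delete all generators outside of a set reduce
  statements about several blocks to single blocks.

  Let \<open>Q\<close> be written in standard form with blocks \<open>ws\<close> of \<open>w\<close> and parabolic factor \<open>Y\<close>,
  and let \<open>A\<close> be the vertex set of \<open>\<Gamma>\<^sub>w\<close>. If \<open>Y\<close> is the orthogonal complement in \<open>\<Gamma>\<^sub>w\<close> of
  \<open>U \<subseteq> A\<close>, then \<open>Q\<close> is the centraliser of \<open>w\<close> together with \<open>U\<close> (\<open>qp_eq_centraliser\<close>).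
  If conversely \<open>Q\<close> is the centraliser of \<open>S\<close>, then every \<open>s\<close> in \<open>S\<close> commutes with \<open>w\<close>
  and \<open>Y\<close>, and hence with each generator in the double complement of \<open>Y\<close> in \<open>\<Gamma>\<^sub>w\<close>; so this
  double complement is \<open>Y\<close> (\<open>closed_of_centraliser\<close>). In standard form no letter of \<open>w\<close>
  commutes with all of \<open>w\<close>, so closed sets of \<open>\<Gamma>\<^sub>w\<close> are closed in \<open>\<Gamma>\<close>.

  It remains to see that the centraliser of any \<open>S\<close> is conjugate to a canonical
  quasiparabolic subgroup (\<open>centraliser_canonical\<close>). After conjugation \<open>S\<close> lies in the
  parabolic subgroup of a set \<open>Z\<close> with as few elements as possible. A double coset argument
  (\<open>centraliser_minimal_parabolic\<close>) shows that the centraliser lies in the direct product of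
  the parabolic subgroups of \<open>Z\<close> and of the set \<open>D\<close> of generators commuting with \<open>Z\<close>.
  Choose \<open>c\<close> in the part of the centraliser inside the first factor, cyclically minimal
  after a further conjugation and of largest possible support. The roots of the blocks of
  \<open>c\<close> and the generators in \<open>D\<close> then generate the centraliser: minimality of \<open>Z\<close> and
  maximality of the support of \<open>c\<close> exclude everything else.
\<close>

section \<open>Traces\<close>

lemma commuting_lists_roots:
  assumes "c @ u = u @ c" "u \<noteq> []"
  obtains zs m n where "c = concat (replicate m zs)" "u = concat (replicate n zs)" "0 < n" "zs \<noteq> []"
proof -
  obtain m n zs where *: "concat (replicate m zs) = c" "concat (replicate n zs) = u"
    using comm_append_are_replicate[OF assms(1)] by blast
  then have "0 < n" "zs \<noteq> []" using assms(2) by (auto intro: gr0I)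
  then show ?thesis using * that by blast
qed

text \<open>Both lists are prefixes of a high power of \<open>u\<close>.\<close>

lemma commuting_lists_prefix:
  assumes "c @ u = u @ c" "v @ u = u @ v" "u \<noteq> []" "length v \<le> length c"
  shows "\<exists>q. c = v @ q"
proof -
  have shift: "x @ concat (replicate n u) = concat (replicate n u) @ x" if "x @ u = u @ x" for x n
  proof (induction n)
    case (Suc n)
    have "x @ u @ concat (replicate n u) = u @ x @ concat (replicate n u)"
      using that by (metis append.assoc)
    then show ?case using Suc by simp
  qed simp
  define p where "p = concat (replicate (length c) u)"
  have "length c \<le> length p"
    using assms(3) unfolding p_def by (induction "length c") (auto simp: length_concat sum_list_replicate Suc_le_eq)
  moreover have "c @ p = p @ c" "v @ p = p @ v"
    using shift assms(1,2) unfolding p_def by blast+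
  ultimately have "c = take (length c) p" "v = take (length v) p"
    using assms(4) by (metis append_eq_append_conv_if append_take_drop_id le_trans nat_le_linear take_all)+
  then show ?thesis using assms(4)
    by (metis append_take_drop_id min.absorb1 take_take)
qed

text \<open>The formal inverse of a signed letter.\<close>

definition flip :: "'a \<times> bool \<Rightarrow> 'a \<times> bool" where
  "flip a = (fst a, \<not> snd a)"

lemma flip_simps [simp]: "fst (flip a) = fst a" "flip (flip a) = a" "flip a \<noteq> a" "a \<noteq> flip a"
  "flip a = flip b \<longleftrightarrow> a = b"
  by (auto simp: flip_def prod_eq_iff)

text \<open>The projection of a word to the generators \<open>x\<close> and \<open>y\<close>; for \<open>x = y\<close> to one generator.\<close>

definition proj :: "'a \<Rightarrow> 'a \<Rightarrow> 'a word \<Rightarrow> 'a word" where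
  "proj x y u = filter (\<lambda>a. fst a = x \<or> fst a = y) u"

lemma proj_append [simp]: "proj x y (u @ v) = proj x y u @ proj x y v"
  by (simp add: proj_def)

lemma proj_Nil [simp]: "proj x y [] = []"
  by (simp add: proj_def)

lemma proj_Cons: "proj x y (a # u) = (if fst a = x \<or> fst a = y then a # proj x y u else proj x y u)"
  by (simp add: proj_def)

text \<open>The word obtained by deleting all letters outside of \<open>Z\<close>.\<close>

definition restr :: "'a set \<Rightarrow> 'a word \<Rightarrow> 'a word" where
  "restr Z u = filter (\<lambda>a. fst a \<in> Z) u"

lemma restr_append [simp]: "restr Z (u @ v) = restr Z u @ restr Z v"
  by (simp add: restr_def)

lemma restr_Nil [simp]: "restr Z [] = []"
  by (simp add: restr_def)

lemma restr_Cons: "restr Z (a # u) = (if fst a \<in> Z then a # restr Z u else restr Z u)"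
  by (simp add: restr_def)

lemma restr_restr [simp]: "restr Z (restr Y u) = restr (Z \<inter> Y) u"
  by (simp add: restr_def conj_commute)

lemma restr_id: "fst ` set u \<subseteq> Z \<Longrightarrow> restr Z u = u"
  unfolding restr_def by (rule filter_True) auto

lemma restr_empty: "fst ` set u \<inter> Z = {} \<Longrightarrow> restr Z u = []"
  unfolding restr_def by (rule filter_False) auto

lemma set_restr: "set (restr Z u) = {a \<in> set u. fst a \<in> Z}"
  by (auto simp: restr_def)

lemma fst_set_restr: "fst ` set (restr Z u) = fst ` set u \<inter> Z"
  by (auto simp: restr_def)

lemma restr_words: "u \<in> words X \<Longrightarrow> restr Z u \<in> words X"
  by (auto simp: restr_def)

text \<open>Powers in the free monoid of words.\<close>

definition wpow :: "'a word \<Rightarrow> nat \<Rightarrow> 'a word" where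
  "wpow u n = concat (replicate n u)"

lemma wpow_simps [simp]: "wpow u 0 = []" "wpow u (Suc n) = u @ wpow u n"
  by (auto simp: wpow_def)

lemma wpow_add: "wpow u (m + n) = wpow u m @ wpow u n"
  by (simp add: wpow_def replicate_add)

lemma wpow_Suc_right: "wpow u (Suc n) = wpow u n @ u"
  using wpow_add[of u n 1] by simp

lemma length_wpow: "length (wpow u n) = n * length u"
  by (induction n) auto

lemma set_wpow: "set (wpow u n) = (if n = 0 then {} else set u)"
  by (induction n) auto

text \<open>A commutation relation on the generators. Two signed letters commute iff their generators
  are related, so a letter does not commute with its inverse.\<close>

locale commutation =
  fixes adj :: "'a \<Rightarrow> 'a \<Rightarrow> bool"
  assumes adj_sym: "adj x y \<Longrightarrow> adj y x"
    and adj_irrefl: "\<not> adj x x"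
begin

text \<open>Equality of traces, defined through the projections to pairs of generators that do not
  commute. This is the congruence generated by swaps of adjacent commuting letters;
  the definition by projections makes cancellation immediate.\<close>

definition teq :: "'a word \<Rightarrow> 'a word \<Rightarrow> bool" (infix \<open>\<sim>\<close> 50) where
  "u \<sim> v \<longleftrightarrow> (\<forall>x y. \<not> adj x y \<longrightarrow> proj x y u = proj x y v)"

lemma teq_refl [simp]: "u \<sim> u"
  by (simp add: teq_def)

lemma teq_sym: "u \<sim> v \<Longrightarrow> v \<sim> u"
  by (simp add: teq_def)

lemma teq_trans [trans]: "u \<sim> v \<Longrightarrow> v \<sim> w \<Longrightarrow> u \<sim> w"
  by (simp add: teq_def)

lemma teq_append: "u \<sim> u' \<Longrightarrow> v \<sim> v' \<Longrightarrow> u @ v \<sim> u' @ v'"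
  by (simp add: teq_def)

lemma teq_Cons: "u \<sim> v \<Longrightarrow> a # u \<sim> a # v"
  using teq_append[of "[a]" "[a]" u v] by simp

lemma teq_cancel_left: "p @ u \<sim> p @ v \<longleftrightarrow> u \<sim> v"
  by (simp add: teq_def)

lemma teq_Cons_cancel: "a # u \<sim> a # v \<longleftrightarrow> u \<sim> v"
  using teq_cancel_left[of "[a]"] by simp

lemma teq_mset: assumes "u \<sim> v" shows "mset u = mset v"
proof (rule multiset_eqI)
  fix a
  have *: "count (mset w) a = count (mset (proj (fst a) (fst a) w)) a" for w :: "'a word"
    by (simp add: proj_def)
  show "count (mset u) a = count (mset v) a"
    using assms adj_irrefl[of "fst a"] *[of u] *[of v] by (simp add: teq_def)
qed

lemma teq_set: "u \<sim> v \<Longrightarrow> set u = set v"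
  by (drule teq_mset) (rule mset_eq_setD)

lemma teq_length: "u \<sim> v \<Longrightarrow> length u = length v"
  by (drule teq_mset) (rule mset_eq_length)

lemma teq_rev: "u \<sim> v \<Longrightarrow> rev u \<sim> rev v"
  by (simp add: teq_def proj_def rev_filter[symmetric])

lemma teq_Nil_iff [simp]: "[] \<sim> u \<longleftrightarrow> u = []" "u \<sim> [] \<longleftrightarrow> u = []"
  by (auto dest: teq_length)

lemma teq_commute:
  assumes "\<forall>a\<in>set u. \<forall>b\<in>set v. adj (fst a) (fst b)"
  shows "u @ v \<sim> v @ u"
  unfolding teq_def
proof (intro allI impI)
  fix x y assume n: "\<not> adj x y"
  have "proj x y u = [] \<or> proj x y v = []"
  proof (rule ccontr)
    assume "\<not> ?thesis"
    then obtain a b where "a \<in> set (proj x y u)" "b \<in> set (proj x y v)"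
      by (metis list.set_sel(1))
    then have ab: "adj (fst a) (fst b)" "fst a = x \<or> fst a = y" "fst b = x \<or> fst b = y"
      using assms by (auto simp: proj_def)
    then show False using n adj_sym[OF ab(1)] adj_irrefl by metis
  qed
  then show "proj x y (u @ v) = proj x y (v @ u)" by auto
qed

text \<open>\<open>ldiv a u\<close>: the trace of \<open>u\<close> has a representative with first letter \<open>a\<close>.\<close>

primrec ldiv :: "'a \<times> bool \<Rightarrow> 'a word \<Rightarrow> bool" where
  "ldiv a [] \<longleftrightarrow> False"
| "ldiv a (b # u) \<longleftrightarrow> a = b \<or> adj (fst a) (fst b) \<and> ldiv a u"

lemma ldiv_set: "ldiv a u \<Longrightarrow> a \<in> set u"
  by (induction u) auto

lemma ldiv_append:
  "ldiv a (u @ v) \<longleftrightarrow> ldiv a u \<or> (\<forall>b\<in>set u. adj (fst a) (fst b)) \<and> ldiv a v"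
  by (induction u) auto

lemma ldiv_iff:
  "ldiv a u \<longleftrightarrow> a \<in> set u \<and> (\<forall>y. \<not> adj (fst a) y \<longrightarrow> hd (proj (fst a) y u) = a)"
proof (induction u)
  case (Cons b u)
  consider "a = b" | "a \<noteq> b" "adj (fst a) (fst b)" | "a \<noteq> b" "\<not> adj (fst a) (fst b)" by blast
  then show ?case
  proof cases
    case 1 then show ?thesis by (simp add: proj_Cons)
  next
    case 2
    then have "fst a \<noteq> fst b" using adj_irrefl by metis
    then show ?thesis using 2 Cons by (auto simp: proj_Cons)
  next
    case 3
    then have "hd (proj (fst a) (fst b) (b # u)) \<noteq> a" by (simp add: proj_Cons)
    then show ?thesis using 3 by auto
  qed
qed simp

lemma ldiv_teq: "u \<sim> v \<Longrightarrow> ldiv a u \<longleftrightarrow> ldiv a v"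
  by (auto simp: ldiv_iff teq_def dest: teq_set[unfolded teq_def])

lemma teq_remove1: "ldiv a u \<Longrightarrow> u \<sim> a # remove1 a u"
proof (induction u)
  case (Cons b u)
  show ?case
  proof (cases "a = b")
    case False
    then have *: "adj (fst a) (fst b)" "ldiv a u" using Cons.prems by auto
    have "b # u \<sim> b # a # remove1 a u" using Cons.IH * by (intro teq_Cons)
    also have "\<dots> \<sim> a # b # remove1 a u"
      using teq_append[OF teq_commute[of "[b]" "[a]"] teq_refl] * adj_sym by auto
    finally show ?thesis using False by simp
  qed simp
qed simp

lemma teq_remove1_cong:
  assumes "u \<sim> v" "ldiv a u" shows "remove1 a u \<sim> remove1 a v"
proof -
  have "a # remove1 a u \<sim> a # remove1 a v"
    using teq_remove1 assms ldiv_teq teq_trans teq_sym by metis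
  then show ?thesis by (simp add: teq_Cons_cancel)
qed

text \<open>Left divisibility of traces is tested on projections too.\<close>

lemma prefix_projections:
  assumes "\<And>x y. \<not> adj x y \<Longrightarrow> \<exists>q. proj x y c = proj x y v @ q"
  shows "\<exists>q. c \<sim> v @ q"
  using assms
proof (induction v arbitrary: c)
  case Nil
  show ?case by (rule exI[of _ c]) simp
next
  case (Cons a v)
  have hd: "hd (proj (fst a) y c) = a \<and> a \<in> set c" if na: "\<not> adj (fst a) y" for y
  proof -
    obtain q where "proj (fst a) y c = proj (fst a) y (a # v) @ q" using Cons.prems[OF na] by blast
    then have "proj (fst a) y c = a # proj (fst a) y v @ q" by (simp add: proj_Cons)
    then have "hd (proj (fst a) y c) = a" "a \<in> set (proj (fst a) y c)" by auto
    then show ?thesis by (auto simp: proj_def)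
  qed
  then have "ldiv a c" unfolding ldiv_iff using adj_irrefl by blast
  then have c: "c \<sim> a # remove1 a c" by (rule teq_remove1)
  have "\<exists>q. remove1 a c \<sim> v @ q"
  proof (rule Cons.IH)
    fix x y assume na: "\<not> adj x y"
    obtain q where q: "proj x y c = proj x y (a # v) @ q" using Cons.prems[OF na] by blast
    have "proj x y c = proj x y (a # remove1 a c)" using c na by (simp add: teq_def)
    then have "proj x y (a # remove1 a c) = proj x y (a # v) @ q" using q by simp
    then show "\<exists>q. proj x y (remove1 a c) = proj x y v @ q"
      by (auto simp: proj_Cons split: if_splits)
  qed
  then show ?case using c teq_trans teq_Cons by (metis append_Cons)
qed

text \<open>A special case of Levi's lemma for traces: if no letter of \<open>u\<close> is a first letter of \<open>v\<close>
  and \<open>u v = v u'\<close>, then \<open>u\<close> commutes with \<open>v\<close> letter by letter.\<close>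

lemma levi_disjoint:
  assumes "u @ v \<sim> v @ u'" "\<And>a. a \<in> set u \<Longrightarrow> \<not> ldiv a v"
  shows "u \<sim> u' \<and> (\<forall>a\<in>set u. \<forall>b\<in>set v. adj (fst a) (fst b))"
  using assms
proof (induction u arbitrary: u')
  case Nil
  then have "v @ [] \<sim> v @ u'" by simp
  then show ?case unfolding teq_cancel_left by simp
next
  case (Cons a u)
  have "ldiv a (v @ u')" using ldiv_teq[OF Cons.prems(1), of a] by simp
  then have a: "\<forall>b\<in>set v. adj (fst a) (fst b)" "ldiv a u'"
    using Cons.prems(2) by (auto simp: ldiv_append)
  have "a # (u @ v) \<sim> v @ u'" using Cons.prems by simp
  also have "\<dots> \<sim> v @ a # remove1 a u'" using teq_remove1[OF a(2)] by (intro teq_append) auto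
  also have "\<dots> \<sim> a # v @ remove1 a u'"
    using teq_append[OF teq_commute[of v "[a]"] teq_refl] a(1) adj_sym by auto
  finally have "u @ v \<sim> v @ remove1 a u'" by (simp add: teq_Cons_cancel)
  then have IH: "u \<sim> remove1 a u' \<and> (\<forall>a\<in>set u. \<forall>b\<in>set v. adj (fst a) (fst b))"
    using Cons.prems(2) by (intro Cons.IH) auto
  then have "a # u \<sim> u'" using teq_remove1[OF a(2)] teq_Cons teq_trans teq_sym by metis
  then show ?case using IH a by auto
qed

lemma commuting_trace_letters:
  assumes c: "c @ u \<sim> u @ c" and a: "a \<in> set c" "fst a \<notin> fst ` set u" and x: "x \<in> fst ` set u"
  shows "adj (fst a) x"
proof (rule ccontr)
  assume na: "\<not> adj (fst a) x"
  define P where "P = proj (fst a) x"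
  have eq: "P c @ P u = P u @ P c" using c na by (simp add: teq_def P_def)
  have "P u \<noteq> []" using x by (auto simp: P_def proj_def filter_empty_conv)
  then obtain zs m n where zs: "P c = concat (replicate m zs)" "P u = concat (replicate n zs)" "0 < n"
    using commuting_lists_roots[OF eq] by metis
  have "a \<in> set (P c)" using a by (auto simp: P_def proj_def)
  then have "a \<in> set (P u)" using zs by auto
  then show False using a(2) by (auto simp: P_def proj_def)
qed

text \<open>Connectedness of a set of vertices in the complement of the commutation graph.\<close>

definition conn :: "'a set \<Rightarrow> bool" where
  "conn I \<longleftrightarrow> (\<forall>x\<in>I. \<forall>y\<in>I. (x, y) \<in> {(a, b). a \<in> I \<and> b \<in> I \<and> \<not> adj a b}\<^sup>*)"

text \<open>The number of occurrences of \<open>x\<close> and its inverse in a word.\<close>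

definition occ :: "'a word \<Rightarrow> 'a \<Rightarrow> nat" where
  "occ u x = length (proj x x u)"

lemma length_occ: "fst ` set u \<subseteq> I \<Longrightarrow> finite I \<Longrightarrow> length u = (\<Sum>x\<in>I. occ u x)"
proof (induction u)
  case (Cons a u)
  have "(\<Sum>x\<in>I. occ (a # u) x) = (\<Sum>x\<in>I. occ u x + (if x = fst a then 1 else 0))"
    by (rule sum.cong) (auto simp: occ_def proj_Cons)
  also have "\<dots> = (\<Sum>x\<in>I. occ u x) + 1" using Cons.prems by (simp add: sum.distrib)
  finally show ?case using Cons by simp
qed (simp add: occ_def)

lemma occ_ratio_step:
  assumes "c @ u \<sim> u @ c" "x \<in> fst ` set u" "\<not> adj x y"
  shows "occ c x * occ u y = occ c y * occ u x"
proof -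
  define P where "P = proj x y"
  have eq: "P c @ P u = P u @ P c" using assms(1,3) by (simp add: teq_def P_def)
  have "P u \<noteq> []" using assms(2) by (auto simp: P_def proj_def filter_empty_conv)
  then obtain zs m n where zs: "P c = concat (replicate m zs)" "P u = concat (replicate n zs)"
    using commuting_lists_roots[OF eq] by metis
  have occ: "occ w z = occ (P w) z" if "z = x \<or> z = y" for w z
    using that by (auto simp: occ_def proj_def P_def intro!: arg_cong[of _ _ length] filter_cong)
  have rep: "occ (concat (replicate k zs)) z = k * occ zs z" for k z
    by (induction k) (auto simp: occ_def)
  show ?thesis
    using occ[of x c] occ[of y c] occ[of x u] occ[of y u] unfolding zs rep by simp
qed

text \<open>On a connected support, the letters of a trace that commutes with \<open>u\<close> occur in the same
  proportions as in \<open>u\<close>: the proportions agree along each edge of the non-commutation graph,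
  where both projections are powers of a common word.\<close>

lemma occ_ratio:
  assumes c: "c @ u \<sim> u @ c" and I: "fst ` set u = I" "conn I" "fst ` set c \<subseteq> I" and x: "x \<in> I"
  shows "occ c x * length u = length c * occ u x"
proof -
  have pos: "occ u z > 0" if "z \<in> I" for z
    using that I(1) by (auto simp: occ_def proj_def filter_empty_conv)
  have ratio: "occ c x * occ u y = occ c y * occ u x" if "y \<in> I" for y
  proof -
    have "(x, y) \<in> {(a, b). a \<in> I \<and> b \<in> I \<and> \<not> adj a b}\<^sup>*"
      using I(2) x that by (auto simp: conn_def)
    then show ?thesis
    proof (induction rule: rtrancl_induct)
      case (step y z)
      then have "occ c y * occ u z = occ c z * occ u y"
        using occ_ratio_step[OF c, of y z] I(1) by auto
      then have "(occ c x * occ u z) * occ u y = (occ c z * occ u x) * occ u y"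
        using step.IH by (metis mult.assoc mult.commute)
      then show ?case using pos[of y] step by simp
    qed simp
  qed
  have fin: "finite I" using I(1) by auto
  have "occ c x * length u = (\<Sum>y\<in>I. occ c x * occ u y)"
    using length_occ[of u I] I(1) fin by (simp add: sum_distrib_left)
  also have "\<dots> = (\<Sum>y\<in>I. occ c y * occ u x)" using ratio by (intro sum.cong) auto
  also have "\<dots> = length c * occ u x"
    using length_occ[of c I] I(3) fin by (simp add: sum_distrib_right)
  finally show ?thesis .
qed

lemma length_proj: "x \<noteq> y \<Longrightarrow> length (proj x y u) = occ u x + occ u y"
  by (induction u) (auto simp: occ_def proj_Cons)

text \<open>Two traces on a connected support that commute with the same trace are comparable.\<close>

lemma commuting_traces_prefix:
  assumes c: "c @ u \<sim> u @ c" and v: "v @ u \<sim> u @ v"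
    and I: "fst ` set u = I" "conn I" "fst ` set c \<subseteq> I" "fst ` set v \<subseteq> I"
    and le: "length v \<le> length c"
  shows "\<exists>q. c \<sim> v @ q"
proof (rule prefix_projections)
  fix x y assume na: "\<not> adj x y"
  have empty: "occ w z = 0" if "fst ` set w \<subseteq> I" "z \<notin> I" for w z
    using that by (auto simp: occ_def proj_def filter_empty_conv)
  have occ_le: "occ v z \<le> occ c z" for z
  proof (cases "z \<in> I")
    case True
    then have u: "length u > 0" using I(1) by auto
    have "occ v z * length u \<le> occ c z * length u"
      using occ_ratio[OF c I(1-3) True] occ_ratio[OF v I(1,2,4) True] le by simp
    then show ?thesis using u by simp
  qed (use empty I in auto)
  have len: "length (proj x y v) \<le> length (proj x y c)"
  proof (cases "x = y")
    case True then show ?thesis using occ_le[of x] by (simp add: occ_def)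
  next
    case False
    then show ?thesis using occ_le[of x] occ_le[of y] by (simp add: length_proj)
  qed
  show "\<exists>q. proj x y c = proj x y v @ q"
  proof (cases "proj x y u = []")
    case True
    then have "x \<notin> I" "y \<notin> I" using I(1) by (auto simp: proj_def filter_empty_conv)
    then have "proj x y v = []" using I(4) by (auto simp: proj_def filter_empty_conv)
    then show ?thesis by simp
  next
    case False
    show ?thesis
      by (rule commuting_lists_prefix[OF _ _ False len]) (use c v na in \<open>auto simp: teq_def\<close>)
  qed
qed

text \<open>The shortest nonempty trace on the support that commutes with \<open>u\<close> divides every other
  such trace from the left.\<close>

theorem trace_root:
  assumes "u \<noteq> []" "fst ` set u = I" "conn I"
  obtains v k where "u \<sim> wpow v k"
    "\<And>c. fst ` set c \<subseteq> I \<Longrightarrow> c @ u \<sim> u @ c \<Longrightarrow> \<exists>j. c \<sim> wpow v j"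
proof -
  define M where "M c \<longleftrightarrow> fst ` set c \<subseteq> I \<and> c @ u \<sim> u @ c" for c
  have "\<exists>c. M c \<and> c \<noteq> []" using assms by (auto simp: M_def)
  then obtain v where v: "M v" "v \<noteq> []" and min: "\<And>c. M c \<Longrightarrow> c \<noteq> [] \<Longrightarrow> length v \<le> length c"
    using ex_has_least_nat[of "\<lambda>c. M c \<and> c \<noteq> []" _ length] by blast
  have pow: "\<exists>j. c \<sim> wpow v j" if "M c" for c
    using that
  proof (induction "length c" arbitrary: c rule: less_induct)
    case less
    show ?case
    proof (cases "c = []")
      case True then show ?thesis by (auto intro: exI[of _ 0])
    next
      case False
      then have "length v \<le> length c" using min less.prems by simp
      then obtain q where q: "c \<sim> v @ q"
        using commuting_traces_prefix[of c u v I] v less.prems assms(2,3) by (auto simp: M_def)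
      have "v @ q @ u \<sim> c @ u" using teq_append[OF teq_sym[OF q] teq_refl[of u]] by simp
      also have "\<dots> \<sim> u @ c" using less.prems by (simp add: M_def)
      also have "\<dots> \<sim> (u @ v) @ q" using q teq_append by fastforce
      also have "\<dots> \<sim> (v @ u) @ q" using teq_append[OF teq_sym teq_refl] v(1) unfolding M_def by blast
      finally have "q @ u \<sim> u @ q" by (simp add: teq_cancel_left)
      moreover have "fst ` set q \<subseteq> I" using teq_set[OF q] less.prems by (auto simp: M_def)
      moreover have "length q < length c" using teq_length[OF q] v(2) by simp
      ultimately obtain j where "q \<sim> wpow v j" using less.hyps[of q] by (auto simp: M_def)
      then have "c \<sim> wpow v (Suc j)" using q teq_trans teq_append[OF teq_refl] by fastforce
      then show ?thesis by blast
    qed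
  qed
  have "M u" using assms(2) by (simp add: M_def)
  then obtain k where "u \<sim> wpow v k" using pow by blast
  then show ?thesis using pow that unfolding M_def by blast
qed

section \<open>Reduced words\<close>

text \<open>No trace equivalent word contains a letter next to its inverse.\<close>

definition reduced :: "'a word \<Rightarrow> bool" where
  "reduced u \<longleftrightarrow> (\<nexists>p a q. u \<sim> p @ [a, flip a] @ q)"

lemma reduced_teq: "u \<sim> v \<Longrightarrow> reduced u \<longleftrightarrow> reduced v"
  unfolding reduced_def by (meson teq_sym teq_trans)

lemma reduced_Nil [simp]: "reduced []"
  by (simp add: reduced_def)

lemma reduced_append_left: assumes "reduced (u @ v)" shows "reduced u"
  unfolding reduced_def
proof clarify
  fix p a q assume u: "u \<sim> p @ [a, flip a] @ q"
  have "u @ v \<sim> p @ [a, flip a] @ (q @ v)" using teq_append[OF u teq_refl[of v]] by simp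
  then show False using assms unfolding reduced_def by blast
qed

lemma reduced_append_right: assumes "reduced (u @ v)" shows "reduced v"
  unfolding reduced_def
proof clarify
  fix p a q assume v: "v \<sim> p @ [a, flip a] @ q"
  have "u @ v \<sim> (u @ p) @ [a, flip a] @ q" using teq_append[OF teq_refl[of u] v] by simp
  then show False using assms unfolding reduced_def by blast
qed

text \<open>Reducedness can be tested letter by letter.\<close>

lemma reduced_Cons_iff: "reduced (a # u) \<longleftrightarrow> reduced u \<and> \<not> ldiv (flip a) u"
proof
  assume r: "reduced (a # u)"
  then have "reduced u" using reduced_append_right[of "[a]" u] by simp
  moreover have "\<not> ldiv (flip a) u"
  proof
    assume "ldiv (flip a) u"
    then have "a # u \<sim> [] @ [a, flip a] @ remove1 (flip a) u"
      using teq_Cons[OF teq_remove1] by simp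
    then show False using r unfolding reduced_def by blast
  qed
  ultimately show "reduced u \<and> \<not> ldiv (flip a) u" by simp
next
  assume u: "reduced u \<and> \<not> ldiv (flip a) u"
  show "reduced (a # u)" unfolding reduced_def
  proof clarify
    fix p b q assume eq: "a # u \<sim> p @ [b, flip b] @ q"
    have "ldiv a (p @ [b, flip b] @ q)" using ldiv_teq[OF eq, of a] by simp
    then consider "ldiv a p" | "\<forall>c\<in>set p. adj (fst a) (fst c)" "a = b"
      | "\<forall>c\<in>set p. adj (fst a) (fst c)" "adj (fst a) (fst b)" "ldiv a q"
      using adj_irrefl by (fastforce simp: ldiv_append)
    then show False
    proof cases
      case 1
      have "a # u \<sim> (a # remove1 a p) @ [b, flip b] @ q"
        using eq teq_append[OF teq_remove1[OF 1] teq_refl] teq_trans by blast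
      then have "u \<sim> remove1 a p @ [b, flip b] @ q" by (simp add: teq_Cons_cancel)
      then show False using u unfolding reduced_def by blast
    next
      case 2
      have "p @ [a] \<sim> [a] @ p" using 2 adj_sym by (intro teq_commute) auto
      then have "p @ [a, flip a] @ q \<sim> ([a] @ p) @ flip a # q"
        using teq_append[OF _ teq_refl[of "flip a # q"]] by fastforce
      then have "a # u \<sim> a # p @ flip a # q" using eq 2(2) teq_trans by auto
      then have "u \<sim> p @ flip a # q" by (simp add: teq_Cons_cancel)
      moreover have "ldiv (flip a) (p @ flip a # q)" using 2 by (auto simp: ldiv_append)
      ultimately show False using u ldiv_teq by blast
    next
      case 3
      have "p @ [b, flip b] @ q \<sim> (p @ [b, flip b] @ [a]) @ remove1 a q"
        using teq_append[OF teq_refl teq_remove1[OF 3(3)], of "p @ [b, flip b]"] by simp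
      also have "\<dots> \<sim> ([a] @ p @ [b, flip b]) @ remove1 a q"
        using 3 adj_sym teq_append[OF teq_commute[of "p @ [b, flip b]" "[a]"] teq_refl] by auto
      finally have "a # u \<sim> a # p @ [b, flip b] @ remove1 a q" using eq teq_trans by force
      then have "u \<sim> p @ [b, flip b] @ remove1 a q" by (simp add: teq_Cons_cancel)
      then show False using u unfolding reduced_def by blast
    qed
  qed
qed

lemma reduced_remove1: "reduced u \<Longrightarrow> ldiv a u \<Longrightarrow> reduced (remove1 a u) \<and> \<not> ldiv (flip a) (remove1 a u)"
  using reduced_teq[OF teq_remove1] reduced_Cons_iff by blast

text \<open>If a product of reduced words is not reduced, a last letter of the first factor
  cancels a first letter of the second one.\<close>

lemma not_reduced_append:
  assumes "reduced u" "reduced v" "\<not> reduced (u @ v)"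
  shows "\<exists>a. ldiv a v \<and> ldiv (flip a) (rev u)"
  using assms
proof (induction u)
  case (Cons b u)
  then have u: "reduced u" "\<not> ldiv (flip b) u" by (auto simp: reduced_Cons_iff)
  show ?case
  proof (cases "reduced (u @ v)")
    case True
    then have "ldiv (flip b) (u @ v)" using Cons.prems by (auto simp: reduced_Cons_iff)
    then have "ldiv (flip b) v" "\<forall>c\<in>set u. adj (fst b) (fst c)" using u by (auto simp: ldiv_append)
    then have "ldiv (flip b) v \<and> ldiv (flip (flip b)) (rev (b # u))" by (auto simp: ldiv_append)
    then show ?thesis by blast
  next
    case False
    then obtain a where "ldiv a v \<and> ldiv (flip a) (rev (b # u))" using Cons u by (auto simp: ldiv_append)
    then show ?thesis by blast
  qed
qed simp

lemma reduced_append_disjoint: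
  assumes "reduced u" "reduced v" "\<And>a. ldiv a v \<Longrightarrow> fst a \<notin> fst ` set u"
  shows "reduced (u @ v)"
proof (rule ccontr)
  assume "\<not> ?thesis"
  then obtain a where "ldiv a v" "ldiv (flip a) (rev u)" using not_reduced_append assms by blast
  then have "flip a \<in> set u" "ldiv a v" using ldiv_set by fastforce+
  then show False using assms(3) flip_simps(1) by (metis imageI)
qed

text \<open>Any first letter of a power of \<open>u\<close> is a first letter of \<open>u\<close> itself, so cancellation
  in a power is already visible in the square.\<close>

lemma reduced_wpow:
  assumes "reduced (u @ u)" shows "reduced (wpow u n)"
proof (induction n)
  case (Suc n)
  have u: "reduced u" using assms reduced_append_left by blast
  have div: "ldiv a (wpow u m) \<Longrightarrow> ldiv a u" for a m
  proof (induction m)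
    case (Suc m)
    then show ?case using ldiv_set[of a "wpow u m"] adj_irrefl
      by (auto simp: ldiv_append set_wpow split: if_splits)
  qed simp
  show ?case
  proof (rule ccontr)
    assume "\<not> ?case"
    then obtain a where "ldiv a (wpow u n)" "ldiv (flip a) (rev u)"
      using not_reduced_append[OF u Suc] by auto
    then have a: "ldiv a u" "ldiv (flip a) (rev u)" using div by auto
    then have 1: "u \<sim> a # remove1 a u" using teq_remove1 by blast
    have "rev u \<sim> flip a # remove1 (flip a) (rev u)" using a teq_remove1 by blast
    then have "u \<sim> rev (remove1 (flip a) (rev u)) @ [flip a]" using teq_rev by force
    then have "u @ u \<sim> (rev (remove1 (flip a) (rev u)) @ [flip a]) @ (a # remove1 a u)"
      using 1 teq_append by blast
    then have "u @ u \<sim> rev (remove1 (flip a) (rev u)) @ [flip a, flip (flip a)] @ remove1 a u" by simp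
    then show False using assms unfolding reduced_def by blast
  qed
qed simp

text \<open>Left multiplication by a letter on reduced traces.\<close>

definition push :: "'a \<times> bool \<Rightarrow> 'a word \<Rightarrow> 'a word" where
  "push a u = (if ldiv (flip a) u then remove1 (flip a) u else a # u)"

lemma push_teq: "u \<sim> v \<Longrightarrow> push a u \<sim> push a v"
  unfolding push_def using ldiv_teq teq_remove1_cong teq_Cons by auto

lemma push_reduced: "reduced u \<Longrightarrow> reduced (push a u)"
  unfolding push_def using reduced_remove1 by (auto simp: reduced_Cons_iff)

lemma push_flip: "reduced u \<Longrightarrow> push a (push (flip a) u) \<sim> u"
proof (cases "ldiv a u")
  case True
  assume "reduced u"
  then have "\<not> ldiv (flip a) (remove1 a u)" using True reduced_remove1 by blast
  then show ?thesis using True teq_sym[OF teq_remove1[OF True]] by (simp add: push_def)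
qed (simp add: push_def)

lemma ldiv_remove1: "adj (fst a) (fst b) \<Longrightarrow> ldiv a (remove1 b u) \<longleftrightarrow> ldiv a u"
proof (induction u)
  case (Cons c u)
  then show ?case using adj_irrefl by (cases "b = c") auto
qed simp

lemma push_commute:
  assumes ab: "adj (fst a) (fst b)" shows "push a (push b u) \<sim> push b (push a u)"
proof -
  have ba: "adj (fst b) (fst a)" using ab adj_sym by blast
  have ne: "fst a \<noteq> fst b" using ab adj_irrefl by metis
  then have ne': "a \<noteq> b" "a \<noteq> flip b" "b \<noteq> flip a" by auto
  have sw: "a # b # u \<sim> b # a # u"
    using teq_append[OF teq_commute[of "[a]" "[b]"] teq_refl] ab by auto
  show ?thesis
    using ab ba ne ne' sw remove1_commute[of "flip a" "flip b" u]
    by (auto simp: push_def ldiv_remove1)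
qed

end

section \<open>Normal forms in partially commutative groups\<close>

text \<open>The group is a parameter of the locale, so that the structure notation for group
  operations is available.\<close>

locale pc =
  fixes \<Gamma> :: "('a, 'b) pre_digraph" and G :: "'a word set monoid" (structure)
  assumes graph: "graph \<Gamma>" and G_eq: "G = pc_group \<Gamma>"
begin

abbreviation X :: "'a set" where "X \<equiv> verts \<Gamma>"

abbreviation adj :: "'a \<Rightarrow> 'a \<Rightarrow> bool" where "adj x y \<equiv> x \<rightarrow>\<^bsub>\<Gamma>\<^esub> y"

lemma finite_X: "finite X"
proof -
  interpret graph \<Gamma> by (rule graph)
  show ?thesis by simp
qed

lemma adj_verts: "adj x y \<Longrightarrow> x \<in> X \<and> y \<in> X"
proof -
  interpret graph \<Gamma> by (rule graph)
  show "adj x y \<Longrightarrow> x \<in> X \<and> y \<in> X" by auto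
qed

end

sublocale pc \<subseteq> commutation "\<lambda>x y. x \<rightarrow>\<^bsub>\<Gamma>\<^esub> y"
proof -
  interpret graph \<Gamma> by (rule graph)
  show "commutation (\<lambda>x y. x \<rightarrow>\<^bsub>\<Gamma>\<^esub> y)"
  proof
    show "x \<rightarrow>\<^bsub>\<Gamma>\<^esub> y \<Longrightarrow> y \<rightarrow>\<^bsub>\<Gamma>\<^esub> x" for x y
      using sym_arcs by (auto simp: symmetric_def sym_def)
    show "\<not> x \<rightarrow>\<^bsub>\<Gamma>\<^esub> x" for x
      using no_loops by (auto simp: arcs_ends_conv)
  qed
qed

sublocale pc \<subseteq> group G
  unfolding G_eq by (rule group_pc_group)

context pc
begin

notation teq (infix \<open>\<sim>\<close> 50)

(* The classical rules for lists would turn membership in words X into a statement about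
   each letter; without them it stays folded and matches the lemmas below. *)
declare in_listsI [rule del] in_listsD [rule del]

lemma letter_iff [simp]: "a \<in> Z \<times> UNIV \<longleftrightarrow> fst a \<in> Z"
  by (simp add: mem_Times_iff)

text \<open>The element of the group represented by a word.\<close>

definition ev :: "'a word \<Rightarrow> 'a word set" where
  "ev u = pres_cong X (pc_relators \<Gamma>) `` {u}"

lemma gen_ev: "gen \<Gamma> x = ev [(x, True)]"
  by (simp add: gen_def ev_def)

lemma ev_carrier [simp]: "u \<in> words X \<Longrightarrow> ev u \<in> carrier G"
  by (auto simp: G_eq pc_group_def presented_group_def ev_def intro: quotientI)

lemma ev_mult: "u \<in> words X \<Longrightarrow> v \<in> words X \<Longrightarrow> ev u \<otimes> ev v = ev (u @ v)"
  by (simp add: G_eq pc_group_def ev_def presented_group_mult)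

lemma ev_Nil: "ev [] = \<one>"
  by (simp add: G_eq pc_group_def presented_group_def ev_def)

lemma ev_eq_iff: "u \<in> words X \<Longrightarrow> v \<in> words X \<Longrightarrow>
    ev u = ev v \<longleftrightarrow> (u, v) \<in> pres_cong X (pc_relators \<Gamma>)"
  unfolding ev_def by (rule eq_equiv_class_iff[OF equiv_pres_cong])

lemma mem_ev_iff: "v \<in> words X \<Longrightarrow> u \<in> ev v \<longleftrightarrow> u \<in> words X \<and> ev u = ev v"
  using ev_eq_iff[of v u] by (auto simp: ev_def dest: pres_cong_words)

lemma ev_Cons: "a # u \<in> words X \<Longrightarrow> ev (a # u) = ev [a] \<otimes> ev u"
  using ev_mult[of "[a]" u] by simp

lemma words_iff: "u \<in> words X \<longleftrightarrow> fst ` set u \<subseteq> X"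
  by (auto simp: in_lists_conv_set)

lemma teq_words: "u \<sim> v \<Longrightarrow> u \<in> words X \<longleftrightarrow> v \<in> words X"
  unfolding words_iff by (simp add: teq_set)

lemma ev_flip: assumes "fst a \<in> X" shows "ev [a] \<otimes> ev [flip a] = \<one>"
proof -
  obtain x b where a: "a = (x, b)" by force
  have "([] @ [(x, b), (x, \<not> b)] @ [], [] @ []) \<in> pres_cong X (pc_relators \<Gamma>)"
    using assms a by (intro pres_cong.cancel) auto
  then have "ev [a, flip a] = ev []"
    using assms a by (subst ev_eq_iff) (auto simp: flip_def)
  then show ?thesis using assms ev_mult[of "[a]" "[flip a]"] by (simp add: ev_Nil)
qed

lemma inv_ev_letter: "fst a \<in> X \<Longrightarrow> inv (ev [a]) = ev [flip a]"
  using ev_flip[of "flip a"] by (intro inv_equality) auto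

lemma commute_inv:
  assumes [simp]: "g \<in> carrier G" "h \<in> carrier G" and c: "g \<otimes> h = h \<otimes> g"
  shows "inv g \<otimes> h = h \<otimes> inv g"
proof -
  have "inv g \<otimes> h = inv g \<otimes> (h \<otimes> g) \<otimes> inv g" by (simp add: m_assoc)
  also have "\<dots> = h \<otimes> inv g" unfolding c[symmetric] by (simp add: m_assoc[symmetric])
  finally show ?thesis .
qed

lemma gens_commute:
  assumes "adj x y" shows "ev [(x, True)] \<otimes> ev [(y, True)] = ev [(y, True)] \<otimes> ev [(x, True)]"
proof -
  have xy: "x \<in> X" "y \<in> X" using adj_verts assms by auto
  let ?x = "ev [(x, True)]" and ?y = "ev [(y, True)]"
  have [simp]: "?x \<in> carrier G" "?y \<in> carrier G" using xy by auto
  have "([] @ [(x, False), (y, False), (x, True), (y, True)] @ [], [] @ [])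
      \<in> pres_cong X (pc_relators \<Gamma>)"
    using assms xy by (intro pres_cong.relator) (auto simp: pc_relators_def)
  then have "ev [(x, False), (y, False), (x, True), (y, True)] = ev []"
    using xy by (subst ev_eq_iff) auto
  moreover have "ev [(x, False), (y, False), (x, True), (y, True)]
      = ev [(x, False)] \<otimes> (ev [(y, False)] \<otimes> (?x \<otimes> ?y))"
    using xy by (simp add: ev_mult)
  moreover have "ev [(x, False)] = inv ?x" "ev [(y, False)] = inv ?y"
    using inv_ev_letter[of "(x, True)"] inv_ev_letter[of "(y, True)"] xy by (auto simp: flip_def)
  ultimately have "inv ?x \<otimes> (inv ?y \<otimes> (?x \<otimes> ?y)) = \<one>" by (simp add: ev_Nil)
  then have "?y \<otimes> (?x \<otimes> (inv ?x \<otimes> (inv ?y \<otimes> (?x \<otimes> ?y)))) = ?y \<otimes> ?x" by simp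
  then show ?thesis by (simp add: m_assoc[symmetric])
qed

lemma letters_commute:
  assumes "adj (fst a) (fst b)" shows "ev [a] \<otimes> ev [b] = ev [b] \<otimes> ev [a]"
proof -
  obtain x s where a: "a = (x, s)" by force
  obtain y t where b: "b = (y, t)" by force
  have xy: "x \<in> X" "y \<in> X" using adj_verts assms a b by auto
  let ?x = "ev [(x, True)]" and ?y = "ev [(y, True)]"
  have [simp]: "?x \<in> carrier G" "?y \<in> carrier G" using xy by auto
  have F: "ev [(x, False)] = inv ?x" "ev [(y, False)] = inv ?y"
    using inv_ev_letter[of "(x, True)"] inv_ev_letter[of "(y, True)"] xy by (auto simp: flip_def)
  have c: "?x \<otimes> ?y = ?y \<otimes> ?x" using gens_commute assms a b by simp
  have c1: "inv ?x \<otimes> ?y = ?y \<otimes> inv ?x" using c by (simp add: commute_inv)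
  have c2: "inv ?y \<otimes> ?x = ?x \<otimes> inv ?y" using c by (simp add: commute_inv)
  have c3: "inv ?y \<otimes> inv ?x = inv ?x \<otimes> inv ?y" using c1 by (simp add: commute_inv)
  show ?thesis using a b F c c1 c2 c3 by (cases s; cases t) simp_all
qed

lemma ev_remove1:
  assumes "u \<in> words X" "ldiv a u" shows "ev u = ev [a] \<otimes> ev (remove1 a u)"
  using assms
proof (induction u rule: list.induct)
  case (Cons b u)
  show ?case
  proof (cases "a = b")
    case True then show ?thesis using ev_Cons[OF Cons.prems(1)] by simp
  next
    case False
    then have a: "adj (fst a) (fst b)" "ldiv a u" using Cons.prems by auto
    have u: "u \<in> words X" "fst b \<in> X" using Cons.prems(1) by auto
    have aX: "fst a \<in> X" using a adj_verts by blast
    have r: "remove1 a u \<in> words X" using u(1) set_remove1_subset[of a u] unfolding words_iff by auto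
    have [simp]: "ev [a] \<in> carrier G" "ev [b] \<in> carrier G" "ev (remove1 a u) \<in> carrier G"
      using u aX r by auto
    have "ev (b # u) = ev [b] \<otimes> (ev [a] \<otimes> ev (remove1 a u))"
      using Cons.IH a u ev_Cons[of b u] Cons.prems by simp
    also have "\<dots> = ev [a] \<otimes> (ev [b] \<otimes> ev (remove1 a u))"
      using letters_commute[OF a(1)] by (simp flip: m_assoc)
    also have "\<dots> = ev [a] \<otimes> ev (b # remove1 a u)"
      using u r ev_Cons[of b "remove1 a u"] by simp
    finally show ?thesis using False by simp
  qed
qed simp

lemma remove1_words: "u \<in> words X \<Longrightarrow> remove1 a u \<in> words X"
  using set_remove1_subset[of a u] unfolding words_iff by auto

lemma ev_teq: "u \<sim> v \<Longrightarrow> u \<in> words X \<Longrightarrow> ev u = ev v"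
proof (induction u arbitrary: v)
  case (Cons a u)
  have v: "v \<in> words X" using Cons.prems teq_words by blast
  have "ldiv a v" using ldiv_teq[OF Cons.prems(1), of a] by simp
  moreover have "u \<sim> remove1 a v" using teq_remove1_cong[OF Cons.prems(1), of a] by simp
  ultimately show ?case
    using Cons.IH[of "remove1 a v"] Cons.prems(2) ev_remove1[OF v] ev_Cons[of a u]
    by simp
qed simp

lemma push_words: "u \<in> words X \<Longrightarrow> fst a \<in> X \<Longrightarrow> push a u \<in> words X"
  unfolding push_def using remove1_words by simp

lemma ev_push: assumes "u \<in> words X" "fst a \<in> X" shows "ev (push a u) = ev [a] \<otimes> ev u"
proof (cases "ldiv (flip a) u")
  case True
  have [simp]: "ev [a] \<in> carrier G" "ev [flip a] \<in> carrier G" "ev (remove1 (flip a) u) \<in> carrier G"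
    using assms by (auto simp: remove1_words)
  have "ev [a] \<otimes> ev u = ev [a] \<otimes> (ev [flip a] \<otimes> ev (remove1 (flip a) u))"
    using ev_remove1[OF assms(1) True] by simp
  also have "\<dots> = ev (remove1 (flip a) u)" using ev_flip[OF assms(2)] by (simp flip: m_assoc)
  finally show ?thesis using True by (simp add: push_def)
next
  case False
  then show ?thesis using assms ev_Cons[of a u] by (simp add: push_def)
qed

lemma foldr_push_teq: "z \<sim> z' \<Longrightarrow> foldr push u z \<sim> foldr push u z'"
  by (induction u) (auto intro: push_teq)

lemma foldr_push_reduced: "reduced z \<Longrightarrow> reduced (foldr push u z)"
  by (induction u) (auto intro: push_reduced)

lemma foldr_push_words: "u \<in> words X \<Longrightarrow> z \<in> words X \<Longrightarrow> foldr push u z \<in> words X"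
  by (induction u) (auto intro!: push_words)

lemma ev_foldr_push: "u \<in> words X \<Longrightarrow> ev (foldr push u []) = ev u"
proof (induction u)
  case (Cons a u)
  then show ?case using ev_Cons[of a u] by (simp add: ev_push foldr_push_words)
qed simp

lemma foldr_push_self: "reduced u \<Longrightarrow> foldr push u [] = u"
  by (induction u) (auto simp: reduced_Cons_iff push_def)

text \<open>The action by \<open>push\<close> respects the defining relations of the group, up to equality of traces.\<close>

lemma foldr_push_cong:
  "(u, v) \<in> pres_cong X (pc_relators \<Gamma>) \<Longrightarrow> reduced z \<Longrightarrow> foldr push u z \<sim> foldr push v z"
proof (induction arbitrary: z rule: pres_cong.induct)
  case (sym u v)
  then show ?case using teq_sym by blast
next
  case (trans u v w)
  then show ?case using teq_trans by blast
next
  case (cancel u v x b)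
  define z' where "z' = foldr push v z"
  have "push (x, b) (push (flip (x, b)) z') \<sim> z'"
    using cancel.prems by (intro push_flip) (auto simp: z'_def foldr_push_reduced)
  then show ?case by (auto simp: z'_def flip_def intro: foldr_push_teq)
next
  case (relator u v r)
  define z' where "z' = foldr push v z"
  obtain x y where r: "r = [(x, False), (y, False), (x, True), (y, True)]" "adj x y"
    using relator.hyps by (auto simp: pc_relators_def)
  have red: "reduced z'" using relator.prems by (auto simp: z'_def foldr_push_reduced)
  have "push (x, False) (push (y, False) (push (x, True) (push (y, True) z')))
      \<sim> push (x, False) (push (x, True) (push (y, False) (push (y, True) z')))"
    using r(2) adj_sym by (intro push_teq push_commute) auto
  also have "\<dots> \<sim> push (y, False) (push (y, True) z')"
    using push_flip[of _ "(x, False)"] red by (simp add: flip_def push_reduced)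
  also have "\<dots> \<sim> z'"
    using push_flip[of _ "(y, False)"] red by (simp add: flip_def)
  finally show ?case by (auto simp: r(1) z'_def intro: foldr_push_teq)
qed simp

text \<open>The normal form theorem: both words act alike on the empty trace, and a reduced word
  turns it into itself.\<close>

theorem reduced_unique:
  assumes "u \<in> words X" "v \<in> words X" "reduced u" "reduced v" "ev u = ev v"
  shows "u \<sim> v"
proof -
  have "foldr push u [] \<sim> foldr push v []"
    using assms ev_eq_iff by (intro foldr_push_cong) auto
  then show ?thesis using assms foldr_push_self by simp
qed

lemma ev_reduced_ex:
  assumes "u \<in> words X"
  obtains v where "v \<in> words X" "reduced v" "ev v = ev u" "length v \<le> length u"
proof -
  have "length (foldr push w []) \<le> length w" for w
  proof (induction w)
    case (Cons a w)
    have "length (push a z) \<le> Suc (length z)" for z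
      by (auto simp: push_def length_remove1)
    then show ?case using Cons le_trans by fastforce
  qed simp
  then show ?thesis
    using that[of "foldr push u []"] assms foldr_push_words ev_foldr_push foldr_push_reduced by simp
qed

lemma nf_ex:
  assumes "g \<in> carrier G"
  obtains u where "u \<in> words X" "reduced u" "g = ev u"
proof -
  obtain w where w: "w \<in> words X" "g = ev w"
    using assms by (auto simp: G_eq pc_group_def presented_group_def quotient_def ev_def)
  obtain v where "v \<in> words X" "reduced v" "ev v = ev w" "length v \<le> length w"
    by (rule ev_reduced_ex[OF w(1)])
  then show ?thesis using that w by simp
qed

lemma len_ev: assumes "u \<in> words X" "reduced u" shows "len (ev u) = length u"
  unfolding len_def
proof (rule Least_equality)
  show "\<exists>v\<in>ev u. length v = length u" using assms mem_ev_iff by blast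
  fix n assume "\<exists>v\<in>ev u. length v = n"
  then obtain v where v: "v \<in> words X" "ev v = ev u" "length v = n"
    using assms mem_ev_iff by blast
  then obtain v' where v': "v' \<in> words X" "reduced v'" "ev v' = ev v" "length v' \<le> length v"
    using ev_reduced_ex by blast
  then have "v' \<sim> u" using assms v by (intro reduced_unique) auto
  then show "length u \<le> n" using v' v teq_length by fastforce
qed

lemma len_ev_le: assumes "u \<in> words X" shows "len (ev u) \<le> length u"
proof -
  obtain v where "v \<in> words X" "reduced v" "ev v = ev u" "length v \<le> length u"
    using ev_reduced_ex[OF assms] by blast
  then show ?thesis using len_ev[of v] by simp
qed

lemma reduced_iff_len: assumes "u \<in> words X" shows "reduced u \<longleftrightarrow> len (ev u) = length u"
proof
  assume l: "len (ev u) = length u"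
  show "reduced u"
  proof (rule ccontr)
    assume "\<not> reduced u"
    then obtain p a q where eq: "u \<sim> p @ [a, flip a] @ q" by (auto simp: reduced_def)
    have w: "p \<in> words X" "q \<in> words X" "fst a \<in> X"
      using assms eq teq_words by (auto simp: words_iff)
    have [simp]: "ev p \<in> carrier G" "ev q \<in> carrier G" using w by auto
    have "ev u = ev (p @ [a, flip a] @ q)" using eq ev_teq assms by blast
    also have "\<dots> = ev p \<otimes> ((ev [a] \<otimes> ev [flip a]) \<otimes> ev q)"
      using w by (simp add: ev_mult m_assoc)
    also have "\<dots> = ev (p @ q)" using w ev_flip by (simp add: ev_mult)
    finally have "len (ev u) \<le> length (p @ q)" using len_ev_le[of "p @ q"] w by simp
    then show False using l teq_length[OF eq] by simp
  qed
qed (use assms len_ev in auto)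

lemma minimal_word_iff:
  assumes "u \<in> words X"
  shows "minimal_word v (ev u) \<longleftrightarrow> v \<in> words X \<and> reduced v \<and> ev v = ev u"
proof (cases "v \<in> words X \<and> ev v = ev u")
  case True
  then have "reduced v \<longleftrightarrow> len (ev u) = length v" using reduced_iff_len[of v] by simp
  then show ?thesis using True mem_ev_iff[OF assms, of v] unfolding minimal_word_def by auto
next
  case False
  then show ?thesis using mem_ev_iff[OF assms, of v] unfolding minimal_word_def by blast
qed

lemma supp_ev: assumes "u \<in> words X" "reduced u" shows "supp (ev u) = fst ` set u"
proof -
  have same: "set v = set u" if "minimal_word v (ev u)" for v
  proof -
    have "v \<in> words X \<and> reduced v \<and> ev v = ev u" using that minimal_word_iff[OF assms(1)] by blast
    then have "v \<sim> u" using assms by (intro reduced_unique) auto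
    then show ?thesis by (rule teq_set)
  qed
  have min: "minimal_word u (ev u)" using assms minimal_word_iff by simp
  show ?thesis
  proof (intro subset_antisym subsetI)
    fix x assume "x \<in> supp (ev u)"
    then obtain v b where "minimal_word v (ev u)" "(x, b) \<in> set v" by (auto simp: supp_def)
    then show "x \<in> fst ` set u" using same by (metis fst_conv imageI)
  next
    fix x assume "x \<in> fst ` set u"
    then obtain b where "(x, b) \<in> set u" by auto
    then show "x \<in> supp (ev u)" using min by (auto simp: supp_def)
  qed
qed

section \<open>Parabolic subgroups and retractions\<close>

text \<open>The parabolic subgroup of \<open>Z\<close>, described by supports. It is the subgroup generated
  by the generators in \<open>Z\<close> (see \<open>par_subset_subgroup\<close>).\<close>

definition par :: "'a set \<Rightarrow> 'a word set set" where
  "par Z = {g \<in> carrier G. supp g \<subseteq> Z}"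

lemma par_carrier: "g \<in> par Z \<Longrightarrow> g \<in> carrier G"
  by (simp add: par_def)

lemma par_mono: "g \<in> par Y \<Longrightarrow> Y \<subseteq> Z \<Longrightarrow> g \<in> par Z"
  by (auto simp: par_def)

lemma supp_subset: assumes "g \<in> carrier G" shows "supp g \<subseteq> X"
proof -
  obtain u where "u \<in> words X" "reduced u" "g = ev u" using nf_ex[OF assms] by blast
  then show ?thesis by (simp add: supp_ev flip: words_iff)
qed

lemma finite_supp: "g \<in> carrier G \<Longrightarrow> finite (supp g)"
  using supp_subset finite_X finite_subset by blast

lemma restr_pres_cong:
  "(u, v) \<in> pres_cong X (pc_relators \<Gamma>) \<Longrightarrow> (restr Z u, restr Z v) \<in> pres_cong X (pc_relators \<Gamma>)"
proof (induction rule: pres_cong.induct)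
  case (refl u)
  then show ?case by (intro pres_cong.refl restr_words)
next
  case (cancel u v x b)
  then have "restr Z u \<in> words X" "restr Z v \<in> words X" by (auto intro: restr_words)
  then show ?case
    using pres_cong.cancel[of "restr Z u" X "restr Z v" x b] cancel.hyps
    by (auto simp: restr_Cons intro!: pres_cong.refl)
next
  case (relator u v r)
  obtain x y where r: "r = [(x, False), (y, False), (x, True), (y, True)]" "adj x y"
    using relator.hyps by (auto simp: pc_relators_def)
  have w: "restr Z u \<in> words X" "restr Z v \<in> words X" using relator by (auto intro: restr_words)
  have xy: "x \<in> X" "y \<in> X" using adj_verts r by auto
  show ?case
    using pres_cong.cancel[OF w xy(1), of False "pc_relators \<Gamma>"]
      pres_cong.cancel[OF w xy(2), of False "pc_relators \<Gamma>"]
      pres_cong.relator[OF w relator.hyps(3,4)] w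
    by (cases "x \<in> Z"; cases "y \<in> Z") (auto simp: r(1) restr_Cons intro!: pres_cong.refl)
qed (blast intro: pres_cong.sym pres_cong.trans)+

text \<open>The retraction of the group onto a parabolic subgroup which kills the generators outside
  of \<open>Z\<close>. By \<open>ret_ev\<close> it does not depend on the chosen word.\<close>

definition ret :: "'a set \<Rightarrow> 'a word set \<Rightarrow> 'a word set" where
  "ret Z g = ev (restr Z (SOME u. u \<in> words X \<and> ev u = g))"

lemma ret_ev: assumes "u \<in> words X" shows "ret Z (ev u) = ev (restr Z u)"
proof -
  define v where "v = (SOME v. v \<in> words X \<and> ev v = ev u)"
  have "v \<in> words X \<and> ev v = ev u" unfolding v_def by (rule someI[of _ u]) (use assms in simp)
  then have "ev (restr Z v) = ev (restr Z u)"
    using assms restr_pres_cong[of v u Z] by (auto simp: ev_eq_iff restr_words)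
  then show ?thesis by (simp add: ret_def v_def)
qed

text \<open>Deleting the letters outside of \<open>Z\<close> from a shortest word gives another word for the same
  element, so nothing is deleted.\<close>

lemma par_ev: assumes "u \<in> words X" "fst ` set u \<subseteq> Z" shows "ev u \<in> par Z"
proof -
  obtain v where v: "v \<in> words X" "reduced v" "ev v = ev u" using ev_reduced_ex[OF assms(1)] by blast
  have "ev (restr Z v) = ev v"
    using ret_ev[OF v(1), of Z] ret_ev[OF assms(1), of Z] restr_id[OF assms(2)] v(3) by simp
  then have "length v \<le> length (restr Z v)"
    using len_ev_le[of "restr Z v"] len_ev[OF v(1,2)] restr_words[OF v(1)] by metis
  then have "restr Z v = v"
    unfolding restr_def by (metis filter_id_conv length_filter_less linorder_not_less)
  then have "fst ` set v \<subseteq> Z" using fst_set_restr[of Z v] by auto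
  then show ?thesis using supp_ev[OF v(1,2)] v(3) assms(1) by (simp add: par_def)
qed

lemma par_ex:
  assumes "g \<in> par Z"
  obtains u where "u \<in> words X" "reduced u" "fst ` set u \<subseteq> Z" "g = ev u"
proof -
  have "g \<in> carrier G" using assms by (rule par_carrier)
  then obtain u where "u \<in> words X" "reduced u" "g = ev u" using nf_ex by blast
  then show ?thesis using assms that supp_ev by (auto simp: par_def)
qed

lemma ev_inverse_word: "u \<in> words X \<Longrightarrow> inv (ev u) = ev (inverse_word u)"
  using inverse_word_cancels[of u X "pc_relators \<Gamma>"] inverse_word_in_words[of u X]
  by (intro inv_equality) (auto simp: ev_mult ev_eq_iff simp flip: ev_Nil)

lemma subgroup_par: "subgroup (par Z) G"
proof (rule subgroupI)
  show "par Z \<subseteq> carrier G" by (auto simp: par_def)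
  have "\<one> \<in> par Z" using par_ev[of "[]"] by (simp add: ev_Nil)
  then show "par Z \<noteq> {}" by auto
  show "inv g \<in> par Z" if g: "g \<in> par Z" for g
  proof -
    obtain u where u: "u \<in> words X" "fst ` set u \<subseteq> Z" "g = ev u" using par_ex[OF g] by blast
    have "fst ` set (inverse_word u) \<subseteq> Z" using u(2) by (auto simp: inverse_word_def)
    then show ?thesis using u par_ev by (simp add: ev_inverse_word inverse_word_in_words)
  qed
  show "g \<otimes> h \<in> par Z" if g: "g \<in> par Z" and h: "h \<in> par Z" for g h
  proof -
    obtain u where u: "u \<in> words X" "fst ` set u \<subseteq> Z" "g = ev u" using par_ex[OF g] by blast
    obtain v where v: "v \<in> words X" "fst ` set v \<subseteq> Z" "h = ev v" using par_ex[OF h] by blast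
    have "fst ` set (u @ v) \<subseteq> Z" using u v by auto
    then show ?thesis using par_ev[of "u @ v"] u v by (simp add: ev_mult)
  qed
qed

lemmas par_mult = subgroup.m_closed[OF subgroup_par]
lemmas par_inv = subgroup.m_inv_closed[OF subgroup_par]
lemmas par_one = subgroup.one_closed[OF subgroup_par]

lemma gen_carrier: "x \<in> X \<Longrightarrow> gen \<Gamma> x \<in> carrier G"
  by (simp add: gen_ev)

lemma gen_supp: assumes "x \<in> X" shows "supp (gen \<Gamma> x) = {x}"
  using assms supp_ev[of "[(x, True)]"] by (simp add: gen_ev reduced_Cons_iff)

lemma gen_par: "x \<in> X \<Longrightarrow> x \<in> Z \<Longrightarrow> gen \<Gamma> x \<in> par Z"
  by (simp add: par_def gen_supp gen_carrier)

lemma par_subset_subgroup: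
  assumes "subgroup K G" "\<And>x. x \<in> Z \<Longrightarrow> x \<in> X \<Longrightarrow> gen \<Gamma> x \<in> K"
  shows "par Z \<subseteq> K"
proof
  have letter: "ev [a] \<in> K" if "fst a \<in> Z" "fst a \<in> X" for a
  proof (cases "snd a")
    case True
    then show ?thesis using assms(2)[OF that] by (cases a) (auto simp: gen_ev)
  next
    case False
    then have "ev [a] = inv (gen \<Gamma> (fst a))"
      using inv_ev_letter[of "(fst a, True)"] that by (cases a) (auto simp: flip_def gen_ev)
    then show ?thesis using subgroup.m_inv_closed[OF assms(1) assms(2)[OF that]] by simp
  qed
  have "ev u \<in> K" if "u \<in> words X" "fst ` set u \<subseteq> Z" for u
    using that
  proof (induction u rule: list.induct)
    case Nil
    then show ?case using subgroup.one_closed[OF assms(1)] by (simp add: ev_Nil)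
  next
    case (Cons a u)
    then have "ev [a] \<in> K" "ev u \<in> K" using letter by auto
    then show ?case using subgroup.m_closed[OF assms(1)] Cons.prems ev_Cons[of a u] by simp
  qed
  then show "g \<in> K" if "g \<in> par Z" for g using par_ex[OF that] by blast
qed

lemma ret_par: assumes "g \<in> par Y" shows "ret Z g \<in> par (Z \<inter> Y)"
proof -
  obtain u where u: "u \<in> words X" "fst ` set u \<subseteq> Y" "g = ev u" using par_ex[OF assms] by blast
  then show ?thesis using par_ev[of "restr Z u" "Z \<inter> Y"]
    by (auto simp: ret_ev restr_words fst_set_restr)
qed

lemma carrier_par: "carrier G = par X"
  using supp_subset by (auto simp: par_def)

lemma ret_par': "g \<in> carrier G \<Longrightarrow> ret Z g \<in> par Z"
  using ret_par[of g X Z] par_mono[of "ret Z g" "Z \<inter> X" Z] carrier_par by auto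

lemma ret_carrier [simp]: "g \<in> carrier G \<Longrightarrow> ret Z g \<in> carrier G"
  using ret_par' par_carrier by blast

lemma ret_mult:
  assumes "g \<in> carrier G" "h \<in> carrier G" shows "ret Z (g \<otimes> h) = ret Z g \<otimes> ret Z h"
proof -
  obtain u where u: "u \<in> words X" "g = ev u" using nf_ex[OF assms(1)] by blast
  obtain v where v: "v \<in> words X" "h = ev v" using nf_ex[OF assms(2)] by blast
  show ?thesis using u v by (simp add: ev_mult ret_ev restr_words)
qed

lemma ret_one [simp]: "ret Z \<one> = \<one>"
  using ret_ev[of "[]"] by (simp add: ev_Nil)

lemma ret_hom: "ret Z \<in> hom G G"
  by (auto simp: hom_def ret_mult)

lemma ret_nat_pow: "g \<in> carrier G \<Longrightarrow> ret Z (g [^] (n::nat)) = ret Z g [^] n"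
  by (induction n) (auto simp: ret_mult)

lemma ret_ret: assumes "g \<in> carrier G" shows "ret Z (ret Y g) = ret (Z \<inter> Y) g"
proof -
  obtain u where u: "u \<in> words X" "g = ev u" using nf_ex[OF assms] by blast
  then show ?thesis by (simp add: ret_ev restr_words)
qed

lemma ret_id: assumes "g \<in> par Z" shows "ret Z g = g"
proof -
  obtain u where u: "u \<in> words X" "fst ` set u \<subseteq> Z" "g = ev u" using par_ex[OF assms] by blast
  then show ?thesis by (simp add: ret_ev restr_id)
qed

lemma ret_trivial: assumes "g \<in> par Y" "Z \<inter> Y = {}" shows "ret Z g = \<one>"
proof -
  obtain u where u: "u \<in> words X" "fst ` set u \<subseteq> Y" "g = ev u" using par_ex[OF assms(1)] by blast
  then have "restr Z u = []" using assms(2) by (intro restr_empty) auto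
  then show ?thesis using u by (simp add: ret_ev ev_Nil)
qed

lemma supp_one [simp]: "supp \<one> = {}"
  using supp_ev[of "[]"] by (simp add: ev_Nil)

lemma supp_empty_iff: assumes "g \<in> carrier G" shows "supp g = {} \<longleftrightarrow> g = \<one>"
proof -
  obtain u where u: "u \<in> words X" "reduced u" "g = ev u" using nf_ex[OF assms] by blast
  have "u = []" if "supp g = {}" using that supp_ev[OF u(1,2)] u(3) by simp
  then show ?thesis using u(3) ev_Nil supp_one by blast
qed

lemma par_empty: "par {} = {\<one>}"
  using supp_empty_iff by (auto simp: par_def)

lemma supp_par: "g \<in> carrier G \<Longrightarrow> g \<in> par (supp g)"
  by (simp add: par_def)

text \<open>Every generator in \<open>P\<close> is adjacent to every generator in \<open>Q\<close>; in particular the two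
  sets are disjoint.\<close>

definition perp :: "'a set \<Rightarrow> 'a set \<Rightarrow> bool" where
  "perp P Q \<longleftrightarrow> (\<forall>x\<in>P. \<forall>y\<in>Q. adj x y)"

lemma perp_sym: "perp P Q \<Longrightarrow> perp Q P"
  using adj_sym by (auto simp: perp_def)

lemma perp_disjoint: "perp P Q \<Longrightarrow> P \<inter> Q = {}"
  using adj_irrefl by (auto simp: perp_def)

lemma perp_commute:
  assumes "perp P Q" "g \<in> par P" "h \<in> par Q" shows "g \<otimes> h = h \<otimes> g"
proof -
  obtain u where u: "u \<in> words X" "fst ` set u \<subseteq> P" "g = ev u" using par_ex[OF assms(2)] by blast
  obtain v where v: "v \<in> words X" "fst ` set v \<subseteq> Q" "h = ev v" using par_ex[OF assms(3)] by blast
  have "u @ v \<sim> v @ u" using assms(1) u v by (intro teq_commute) (fastforce simp: perp_def)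
  then show ?thesis using u v ev_teq[of "u @ v" "v @ u"] by (simp add: ev_mult)
qed

lemma restr_split:
  assumes "perp P Q" "fst ` set u \<subseteq> P \<union> Q" shows "u \<sim> restr P u @ restr Q u"
  using assms(2)
proof (induction u)
  case (Cons a u)
  then have IH: "a # u \<sim> a # restr P u @ restr Q u" by (intro teq_Cons) auto
  show ?case
  proof (cases "fst a \<in> P")
    case True
    then have "fst a \<notin> Q" using perp_disjoint[OF assms(1)] by auto
    then show ?thesis using IH True by (simp add: restr_Cons)
  next
    case False
    then have Q: "fst a \<in> Q" using Cons.prems by auto
    have "[a] @ restr P u \<sim> restr P u @ [a]"
      using assms(1) Q adj_sym by (intro teq_commute) (auto simp: perp_def set_restr)
    then have "a # restr P u @ restr Q u \<sim> restr P u @ a # restr Q u"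
      using teq_append[OF _ teq_refl[of "restr Q u"]] by fastforce
    then show ?thesis using IH teq_trans False Q by (auto simp: restr_Cons)
  qed
qed simp

lemma ret_split:
  assumes "perp P Q" "g \<in> par (P \<union> Q)" shows "g = ret P g \<otimes> ret Q g"
proof -
  obtain u where u: "u \<in> words X" "fst ` set u \<subseteq> P \<union> Q" "g = ev u" using par_ex[OF assms(2)] by blast
  have "ret P g \<otimes> ret Q g = ev (restr P u @ restr Q u)"
    using u(1) by (simp only: u(3) ret_ev ev_mult restr_words)
  then show ?thesis using ev_teq[OF restr_split[OF assms(1) u(2)] u(1)] u(3) by simp
qed

lemma perp_len_supp:
  assumes "perp P Q" "g \<in> par P" "h \<in> par Q"
  shows "len (g \<otimes> h) = len g + len h" "supp (g \<otimes> h) = supp g \<union> supp h"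
proof -
  obtain u where u: "u \<in> words X" "reduced u" "fst ` set u \<subseteq> P" "g = ev u" using par_ex[OF assms(2)] by blast
  obtain v where v: "v \<in> words X" "reduced v" "fst ` set v \<subseteq> Q" "h = ev v" using par_ex[OF assms(3)] by blast
  have "reduced (u @ v)"
    using u v perp_disjoint[OF assms(1)] by (intro reduced_append_disjoint) (auto dest!: ldiv_set)
  then show "len (g \<otimes> h) = len g + len h" "supp (g \<otimes> h) = supp g \<union> supp h"
    using u v len_ev[of "u @ v"] supp_ev[of "u @ v"] by (auto simp: ev_mult len_ev supp_ev)
qed

text \<open>An element of a direct product of parabolic subgroups lies in a subgroup as soon as its
  components do.\<close>

lemma mem_subgroup_components:
  assumes "finite F" "\<And>I J. I \<in> F \<Longrightarrow> J \<in> F \<Longrightarrow> I \<noteq> J \<Longrightarrow> perp I J"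
    and "g \<in> par (\<Union>F)" "subgroup K G" "\<And>I. I \<in> F \<Longrightarrow> ret I g \<in> K"
  shows "g \<in> K"
  using assms(1,2,3,5)
proof (induction F arbitrary: g rule: finite_induct)
  case empty
  then show ?case using par_empty subgroup.one_closed[OF assms(4)] by auto
next
  case (insert I F)
  have g: "g \<in> carrier G" using insert.prems par_carrier by blast
  have p: "perp I (\<Union>F)"
    using insert.prems(1) insert.hyps(2) unfolding perp_def by (metis Union_iff insertCI)
  have "ret (\<Union>F) g \<in> K"
  proof (rule insert.IH)
    show "ret J (ret (\<Union>F) g) \<in> K" if "J \<in> F" for J
      using that insert.prems(3)[of J] g by (simp add: ret_ret Int_absorb2 Sup_upper)
  qed (use insert.prems g ret_par' in auto)
  moreover have "ret I g \<in> K" using insert.prems by simp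
  moreover have "g = ret I g \<otimes> ret (\<Union>F) g" using insert.prems p by (intro ret_split) auto
  ultimately show ?case using subgroup.m_closed[OF assms(4)] by metis
qed


section \<open>Cyclically minimal elements\<close>

lemma len_one [simp]: "len \<one> = 0"
  using len_ev[of "[]"] by (simp add: ev_Nil)

lemma len_zero_iff: assumes "g \<in> carrier G" shows "len g = 0 \<longleftrightarrow> g = \<one>"
proof -
  obtain u where u: "u \<in> words X" "reduced u" "g = ev u" using nf_ex[OF assms] by blast
  have "u = []" if "len g = 0" using that len_ev[OF u(1,2)] u(3) by simp
  then show ?thesis using u(3) ev_Nil len_one by blast
qed

lemma len_mult_le:
  assumes "g \<in> carrier G" "h \<in> carrier G" shows "len (g \<otimes> h) \<le> len g + len h"
proof -
  obtain u where u: "u \<in> words X" "reduced u" "g = ev u" using nf_ex[OF assms(1)] by blast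
  obtain v where v: "v \<in> words X" "reduced v" "h = ev v" using nf_ex[OF assms(2)] by blast
  show ?thesis using len_ev_le[of "u @ v"] u v by (simp add: ev_mult len_ev)
qed

lemma len_inv: assumes "g \<in> carrier G" shows "len (inv g) = len g"
proof -
  have le: "len (inv h) \<le> len h" if h: "h \<in> carrier G" for h
  proof -
    obtain u where u: "u \<in> words X" "reduced u" "h = ev u" using nf_ex[OF h] by blast
    have "length (inverse_word u) = length u" by (simp add: inverse_word_def)
    then show ?thesis using len_ev_le[OF inverse_word_in_words[OF u(1)]] u
      by (simp add: ev_inverse_word len_ev)
  qed
  show ?thesis using le[OF assms] le[of "inv g"] assms by simp
qed

text \<open>Cyclic minimality in a form that is easy to check: there is no cancellation in the square.
  See \<open>cyclically_minimal_iff\<close>.\<close>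

definition cyc :: "'a word set \<Rightarrow> bool" where
  "cyc w \<longleftrightarrow> w \<in> carrier G \<and> len (w \<otimes> w) = 2 * len w"

lemma cyc_carrier [simp]: "cyc w \<Longrightarrow> w \<in> carrier G"
  by (simp add: cyc_def)

lemma cyc_ev: "u \<in> words X \<Longrightarrow> reduced u \<Longrightarrow> cyc (ev u) \<longleftrightarrow> reduced (u @ u)"
  using reduced_iff_len[of "u @ u"] by (simp add: cyc_def ev_mult len_ev mult_2)

lemma wpow_words: "u \<in> words X \<Longrightarrow> wpow u n \<in> words X"
  by (induction n) auto

lemma ev_wpow: assumes "u \<in> words X" shows "ev (wpow u n) = ev u [^] n"
proof (induction n)
  case (Suc n)
  have "ev (wpow u (Suc n)) = ev (wpow u n) \<otimes> ev u"
    using assms by (subst wpow_Suc_right) (simp add: ev_mult wpow_words)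
  then show ?case using Suc by simp
qed (simp add: ev_Nil)

lemma cyc_pow:
  assumes "cyc w"
  shows len_cyc_pow: "len (w [^] (n::nat)) = n * len w"
    and supp_cyc_pow: "0 < n \<Longrightarrow> supp (w [^] n) = supp w"
    and cyc_nat_pow: "cyc (w [^] n)"
proof -
  have "w \<in> carrier G" using assms by simp
  then obtain u where u: "u \<in> words X" "reduced u" "w = ev u" using nf_ex by blast
  then have red: "reduced (wpow u m)" for m
    using assms cyc_ev by (intro reduced_wpow) auto
  have pow: "w [^] m = ev (wpow u m)" for m :: nat using u ev_wpow by simp
  have l: "len (w [^] m) = m * len w" for m :: nat
  proof -
    have "len (w [^] m) = length (wpow u m)"
      unfolding pow using red u(1) by (intro len_ev wpow_words)
    then show ?thesis using len_ev[OF u(1,2)] u(3) by (simp add: length_wpow)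
  qed
  then show "len (w [^] n) = n * len w" .
  show "supp (w [^] n) = supp w" if "0 < n"
  proof -
    have "supp (w [^] n) = fst ` set (wpow u n)"
      unfolding pow using red u(1) by (intro supp_ev wpow_words)
    then show ?thesis using that supp_ev[OF u(1,2)] u(3) by (simp add: set_wpow)
  qed
  show "cyc (w [^] n)" using l[of n] l[of "n + n"] assms by (simp add: cyc_def nat_pow_mult)
qed

lemma cyc_one: "cyc \<one>"
  by (simp add: cyc_def)

lemma cyc_int_pow_eq_one:
  assumes "cyc v" "v \<noteq> \<one>" "v [^] (m::int) = \<one>" shows "m = 0"
proof -
  have v: "v \<in> carrier G" using assms by simp
  obtain n where n: "m = int n \<or> m = - int n" by (cases m rule: int_cases2) auto
  then have "v [^] n = \<one>"
  proof
    assume "m = int n"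
    then show ?thesis using assms(3) by (simp add: int_pow_int)
  next
    assume "m = - int n"
    then have "inv (v [^] n) = \<one>" using assms(3) int_pow_neg[OF v, of "int n"] by (simp add: int_pow_int)
    then show ?thesis using v inv_eq_1_iff[of "v [^] n"] by simp
  qed
  then have "n * len v = 0" using len_cyc_pow[OF assms(1), of n] by simp
  then show ?thesis using n assms(2) len_zero_iff v by auto
qed

text \<open>If the square of \<open>w\<close> is not reduced, some letter of \<open>w\<close> conjugates \<open>w\<close> to a shorter
  element.\<close>

lemma not_cyc_shorten:
  assumes "w \<in> carrier G" "\<not> cyc w"
  shows "\<exists>g\<in>par (supp w). len (inv g \<otimes> w \<otimes> g) < len w"
proof -
  obtain u where u: "u \<in> words X" "reduced u" "w = ev u" using nf_ex[OF assms(1)] by blast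
  then have "\<not> reduced (u @ u)" using assms(2) cyc_ev by blast
  then obtain a where a: "ldiv a u" "ldiv (flip a) (rev u)" using not_reduced_append u by blast
  define r where "r = remove1 a u"
  have ur: "u \<sim> a # r" using a(1) unfolding r_def by (rule teq_remove1)
  have "rev u \<sim> rev r @ [a]" using teq_rev[OF ur] by simp
  then have "ldiv (flip a) (rev r @ [a])" using ldiv_teq a(2) by blast
  then have d: "ldiv (flip a) (rev r)" using adj_irrefl by (auto simp: ldiv_append)
  define t where "t = rev (remove1 (flip a) (rev r))"
  have "r \<sim> t @ [flip a]" using teq_rev[OF teq_remove1[OF d]] by (simp add: t_def)
  then have ut: "u \<sim> a # t @ [flip a]" using ur teq_trans teq_Cons by blast
  then have tw: "t \<in> words X" "fst a \<in> X" using teq_words[OF ut] u(1) by auto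
  have [simp]: "ev [a] \<in> carrier G" "ev t \<in> carrier G" using tw by auto
  have "w = ev ([a] @ t @ [flip a])" using ev_teq[OF ut u(1)] u(3) by simp
  also have "\<dots> = ev [a] \<otimes> (ev t \<otimes> inv (ev [a]))"
    using tw inv_ev_letter[of a] ev_mult[of "[a]" "t @ [flip a]"] ev_mult[of t "[flip a]"] by simp
  finally have w: "w = ev [a] \<otimes> (ev t \<otimes> inv (ev [a]))" .
  have "inv (ev [a]) \<otimes> w \<otimes> ev [a] = ev t"
    unfolding w by (simp add: m_assoc) (simp add: m_assoc[symmetric])
  moreover have "len (ev t) < len w"
    using len_ev_le[OF tw(1)] len_ev[OF u(1,2)] u(3) teq_length[OF ut] by simp
  moreover have "ev [a] \<in> par (supp w)"
    using tw a(1) ldiv_set u supp_ev by (intro par_ev) auto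
  ultimately show ?thesis by (intro bexI[of _ "ev [a]"]) simp_all
qed

lemma conj_cyc:
  assumes "w \<in> par Z" shows "\<exists>g\<in>par Z. cyc (inv g \<otimes> w \<otimes> g)"
  using assms
proof (induction "len w" arbitrary: w rule: less_induct)
  case less
  have w: "w \<in> carrier G" using less.prems par_carrier by blast
  show ?case
  proof (cases "cyc w")
    case True
    then show ?thesis using w par_one by (intro bexI[of _ \<one>]) auto
  next
    case False
    obtain g where g: "g \<in> par (supp w)" "len (inv g \<otimes> w \<otimes> g) < len w"
      using not_cyc_shorten[OF w False] by blast
    have gZ: "g \<in> par Z" using g(1) less.prems by (auto simp: par_def)
    then have "inv g \<otimes> w \<otimes> g \<in> par Z" using less.prems by (intro par_mult par_inv)
    then obtain h where h: "h \<in> par Z" "cyc (inv h \<otimes> (inv g \<otimes> w \<otimes> g) \<otimes> h)"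
      using less.hyps[OF g(2)] by blast
    have "inv h \<otimes> (inv g \<otimes> w \<otimes> g) \<otimes> h = inv (g \<otimes> h) \<otimes> w \<otimes> (g \<otimes> h)"
      using par_carrier[OF gZ] par_carrier[OF h(1)] w by (simp add: inv_mult_group m_assoc)
    then show ?thesis using h gZ par_mult[of g Z h] by metis
  qed
qed

lemma conj_nat_pow:
  assumes [simp]: "g \<in> carrier G" "w \<in> carrier G"
  shows "(inv g \<otimes> w \<otimes> g) [^] (n::nat) = inv g \<otimes> w [^] n \<otimes> g"
proof (induction n)
  case (Suc n)
  have "g \<otimes> (inv g \<otimes> (w \<otimes> g)) = w \<otimes> g" by (simp add: m_assoc[symmetric])
  then show ?case using Suc by (simp add: m_assoc)
qed simp

text \<open>The length of \<open>w ^ n\<close> grows like \<open>n * len w\<close>, and conjugation by \<open>g\<close> changes it by at most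
  \<open>2 * len g\<close>.\<close>

lemma cyc_len_le_conj:
  assumes w: "cyc w" and g [simp]: "g \<in> carrier G" shows "len w \<le> len (inv g \<otimes> w \<otimes> g)"
proof (rule ccontr)
  define c where "c = inv g \<otimes> w \<otimes> g"
  assume "\<not> ?thesis"
  then have lt: "len c + 1 \<le> len w" by (simp add: c_def)
  have [simp]: "w \<in> carrier G" using w by simp
  then have [simp]: "c \<in> carrier G" by (simp add: c_def)
  \<comment> \<open>A power large enough to beat the bounded error \<open>2 * len g\<close>.\<close>
  define n where "n = 2 * len g + 1"
  have lenc: "len (c [^] m) \<le> m * len c" for m
  proof (induction m)
    case (Suc m)
    then show ?case using len_mult_le[of "c [^] m" c] by simp
  qed simp
  have "w [^] n = g \<otimes> c [^] n \<otimes> inv g"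
    unfolding c_def conj_nat_pow[OF g \<open>w \<in> carrier G\<close>]
    by (simp add: m_assoc) (simp add: m_assoc[symmetric])
  then have "n * len w \<le> len g + n * len c + len g"
    using len_mult_le[of "g \<otimes> c [^] n" "inv g"] len_mult_le[of g "c [^] n"] lenc[of n] len_inv[of g]
      len_cyc_pow[OF w, of n] by simp
  moreover have "n * (len c + 1) \<le> n * len w" using lt by (rule mult_le_mono2)
  ultimately show False by (simp add: n_def)
qed

lemma cyclically_minimal_iff: "cyclically_minimal \<Gamma> w \<longleftrightarrow> cyc w"
proof
  assume m: "cyclically_minimal \<Gamma> w"
  then have w: "w \<in> carrier G" by (simp add: cyclically_minimal_def G_eq)
  show "cyc w"
  proof (rule ccontr)
    assume "\<not> cyc w"
    then obtain g where "g \<in> par (supp w)" "len (inv g \<otimes> w \<otimes> g) < len w"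
      using not_cyc_shorten[OF w] by blast
    then show False using m par_carrier unfolding cyclically_minimal_def G_eq by fastforce
  qed
next
  assume "cyc w"
  then show "cyclically_minimal \<Gamma> w"
    using cyc_len_le_conj unfolding cyclically_minimal_def G_eq[symmetric] by simp
qed

section \<open>Centralisers of single elements\<close>

text \<open>The difference between \<open>N * len w\<close> and the length of \<open>c w^N\<close> is a bounded
  nondecreasing sequence of integers, hence eventually constant.\<close>

lemma len_mult_cyc_pow_stable:
  assumes w: "cyc w" and [simp]: "c \<in> carrier G"
  shows "\<exists>N::nat. len (c \<otimes> w [^] Suc N) = len (c \<otimes> w [^] N) + len w"
proof (rule ccontr)
  assume n: "\<not> ?thesis"
  have [simp]: "w \<in> carrier G" using w by simp
  have lt: "len (c \<otimes> w [^] Suc N) < len (c \<otimes> w [^] N) + len w" for N :: nat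
  proof -
    have "len (c \<otimes> w [^] N \<otimes> w) \<le> len (c \<otimes> w [^] N) + len w" by (intro len_mult_le) auto
    moreover have "c \<otimes> w [^] N \<otimes> w = c \<otimes> w [^] Suc N" by (simp add: m_assoc)
    ultimately show ?thesis using n by (metis le_neq_implies_less)
  qed
  have up: "len (c \<otimes> w [^] N) + N \<le> len c + N * len w" for N :: nat
  proof (induction N)
    case (Suc N)
    then show ?case using lt[of N] by (simp del: nat_pow_Suc)
  qed simp
  have "N * len w \<le> len c + len (c \<otimes> w [^] N)" for N :: nat
  proof -
    have "w [^] N = inv c \<otimes> (c \<otimes> w [^] N)" by (simp add: m_assoc[symmetric])
    then have "len (w [^] N) \<le> len (inv c) + len (c \<otimes> w [^] N)"
      using len_mult_le[of "inv c" "c \<otimes> w [^] N"] by simp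
    then show ?thesis using len_cyc_pow[OF w] len_inv by simp
  qed
  from this[of "2 * len c + 1"] up[of "2 * len c + 1"] show False by simp
qed

text \<open>Multiplying an element that commutes with \<open>w\<close> by a high power of \<open>w\<close>
  removes all cancellation, so that commutation can be read in the trace monoid.\<close>

lemma commuting_trace_ex:
  assumes u: "u \<in> words X" "reduced u" and w: "cyc (ev u)"
    and c: "c \<in> carrier G" "c \<otimes> ev u = ev u \<otimes> c"
  obtains N :: nat and c' where "c' \<in> words X" "reduced c'" "ev c' = c \<otimes> ev u [^] N" "c' @ u \<sim> u @ c'"
proof -
  obtain N :: nat where N: "len (c \<otimes> ev u [^] Suc N) = len (c \<otimes> ev u [^] N) + len (ev u)"
    using len_mult_cyc_pow_stable[OF w c(1)] by blast
  have [simp]: "ev u \<in> carrier G" "c \<in> carrier G" using u c by auto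
  have "c \<otimes> ev u [^] N \<in> carrier G" by simp
  then obtain c' where c': "c' \<in> words X" "reduced c'" "c \<otimes> ev u [^] N = ev c'" using nf_ex by blast
  have 1: "ev (c' @ u) = c \<otimes> ev u [^] Suc N"
    using c' u by (simp add: ev_mult[symmetric] c'(3)[symmetric] m_assoc)
  have "ev (u @ c') = ev u \<otimes> c \<otimes> ev u [^] N"
    using c' u by (simp add: ev_mult[symmetric] c'(3)[symmetric] m_assoc)
  also have "\<dots> = c \<otimes> (ev u \<otimes> ev u [^] N)" by (simp add: c(2)[symmetric] m_assoc)
  also have "\<dots> = c \<otimes> ev u [^] Suc N" using nat_pow_comm[of "ev u" 1 N] by simp
  finally have 2: "ev (u @ c') = c \<otimes> ev u [^] Suc N" .
  have l: "len (c \<otimes> ev u [^] Suc N) = length c' + length u"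
    using N c' u len_ev by simp
  have "reduced (c' @ u)" "reduced (u @ c')"
    using c'(1) u(1) 1 2 l reduced_iff_len by auto
  then have "c' @ u \<sim> u @ c'" using c'(1) u(1) 1 2 by (intro reduced_unique) auto
  then show ?thesis by (rule that[OF c'(1,2) c'(3)[symmetric]])
qed

lemma par_nat_pow: "g \<in> par Z \<Longrightarrow> g [^] (n::nat) \<in> par Z"
  by (induction n) (auto intro: par_one par_mult)

text \<open>The generators adjacent to all of \<open>I\<close>. No element of \<open>I\<close> belongs to this set.\<close>

definition lk :: "'a set \<Rightarrow> 'a set" where
  "lk I = {x \<in> X. \<forall>y\<in>I. adj x y}"

lemma perp_lk: "perp I (lk I)"
  using adj_sym by (auto simp: perp_def lk_def)

lemma centraliser_supp:
  assumes w: "cyc w" and c: "c \<in> carrier G" "c \<otimes> w = w \<otimes> c"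
  shows "c \<in> par (supp w \<union> lk (supp w))"
proof -
  have wc: "w \<in> carrier G" using w by simp
  then obtain u where u: "u \<in> words X" "reduced u" "w = ev u" using nf_ex by blast
  obtain N :: nat and c' where c': "c' \<in> words X" "ev c' = c \<otimes> w [^] N" "c' @ u \<sim> u @ c'"
    using commuting_trace_ex[of u c] u w c by metis
  have s: "supp w = fst ` set u" using supp_ev u by simp
  have "fst ` set c' \<subseteq> supp w \<union> lk (supp w)"
  proof clarify
    fix a assume a: "a \<in> set c'" "fst a \<notin> lk (supp w)"
    then have "fst a \<in> X" using c'(1) by (auto simp: words_iff)
    then show "fst a \<in> supp w" using a commuting_trace_letters[OF c'(3) a(1)] s by (auto simp: lk_def)
  qed
  then have "c \<otimes> w [^] N \<in> par (supp w \<union> lk (supp w))" using par_ev[OF c'(1)] c'(2) by metis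
  moreover have "w [^] N \<in> par (supp w \<union> lk (supp w))"
    using supp_par[OF wc] by (intro par_nat_pow) (auto simp: par_def)
  ultimately have "(c \<otimes> w [^] N) \<otimes> inv (w [^] N) \<in> par (supp w \<union> lk (supp w))"
    by (rule par_mult[OF _ par_inv])
  then show ?thesis using c wc by (simp add: m_assoc)
qed

text \<open>Inside the parabolic subgroup of its connected support, a nontrivial cyclically minimal
  element has a cyclic centraliser, generated by a root element \<open>v\<close>.\<close>

theorem centraliser_connected:
  assumes w: "cyc w" "w \<noteq> \<one>" "conn (supp w)"
  obtains v and k :: nat where "v \<in> par (supp w)" "cyc v" "0 < k" "w = v [^] k" "root_element G v"
    "\<And>c. c \<in> par (supp w) \<Longrightarrow> c \<otimes> w = w \<otimes> c \<Longrightarrow> \<exists>j::int. c = v [^] j"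
proof -
  define I where "I = supp w"
  have wc [simp]: "w \<in> carrier G" using w by simp
  then obtain u where u: "u \<in> words X" "reduced u" "w = ev u" using nf_ex by blast
  have sI: "fst ` set u = I" using supp_ev u by (simp add: I_def)
  have "u \<noteq> []" using u w(2) ev_Nil by auto
  then obtain t k where t: "u \<sim> wpow t k"
    and com: "\<And>c. fst ` set c \<subseteq> I \<Longrightarrow> c @ u \<sim> u @ c \<Longrightarrow> \<exists>j. c \<sim> wpow t j"
    using trace_root[of u I] sI w(3) I_def by metis
  have k: "0 < k" using t \<open>u \<noteq> []\<close> by (cases k) auto
  have st: "set t = set u" using teq_set[OF t] k by (simp add: set_wpow)
  then have tw: "t \<in> words X" using u(1) by (simp add: words_iff)
  define v where "v = ev t"
  have wv: "w = v [^] k" using ev_teq[OF t u(1)] u(3) ev_wpow[OF tw] by (simp add: v_def)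
  have vI: "v \<in> par I" using tw st sI unfolding v_def by (intro par_ev) auto
  have vc [simp]: "v \<in> carrier G" using vI par_carrier by blast
  have "reduced (u @ u)" using w(1) u cyc_ev by simp
  moreover have "u @ u \<sim> wpow t k @ wpow t k" using t by (intro teq_append)
  ultimately have "reduced (wpow t (k + k))" using reduced_teq wpow_add by metis
  moreover have "k + k = 2 + (k + k - 2)" using k by simp
  ultimately have "reduced (wpow t 2 @ wpow t (k + k - 2))" using wpow_add by metis
  then have "reduced (wpow t 2)" by (rule reduced_append_left)
  then have tt: "reduced (t @ t)" by (simp add: numeral_2_eq_2)
  then have cv: "cyc v" using cyc_ev[OF tw] reduced_append_left unfolding v_def by blast
  have cent: "\<exists>j::int. c = v [^] j" if c: "c \<in> par I" "c \<otimes> w = w \<otimes> c" for c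
  proof -
    have cc [simp]: "c \<in> carrier G" using c par_carrier by blast
    have cu: "c \<otimes> ev u = ev u \<otimes> c" "cyc (ev u)" using c(2) w(1) u(3) by auto
    obtain N :: nat and c' where c': "c' \<in> words X" "reduced c'" "ev c' = c \<otimes> ev u [^] N" "c' @ u \<sim> u @ c'"
      by (rule commuting_trace_ex[OF u(1,2) cu(2) cc cu(1)])
    have c'w: "ev c' = c \<otimes> w [^] N" using c'(3) u(3) by simp
    have "c \<otimes> w [^] N \<in> par I"
      using c(1) supp_par[OF wc] I_def by (intro par_mult par_nat_pow) auto
    then have "fst ` set c' \<subseteq> I" using supp_ev[OF c'(1,2)] c'w by (simp add: par_def)
    then obtain j where "c' \<sim> wpow t j" using com c'(4) by blast
    then have "c \<otimes> w [^] N = v [^] j" using ev_teq[OF _ c'(1)] c'w ev_wpow[OF tw] v_def by simp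
    then have "c \<otimes> v [^] (k * N) = v [^] j" using wv by (simp add: nat_pow_pow)
    then have "v [^] j \<otimes> inv (v [^] (k * N)) = c \<otimes> v [^] (k * N) \<otimes> inv (v [^] (k * N))" by simp
    then have "c = v [^] j \<otimes> inv (v [^] (k * N))" by (simp add: m_assoc)
    also have "\<dots> = v [^] (int j - int (k * N))" by (simp add: int_pow_diff int_pow_int del: of_nat_mult)
    finally show ?thesis by blast
  qed
  have v1: "v \<noteq> \<one>" using w(2) wv by auto
  have "root_element G v"
    unfolding root_element_def
  proof (intro conjI notI)
    assume "\<exists>h\<in>carrier G. \<exists>n::nat. 2 \<le> n \<and> v = h [^] n"
    then obtain h and n :: nat where h: "h \<in> carrier G" "2 \<le> n" "v = h [^] n" by blast
    define r where "r = ret I h"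
    have r: "r \<in> par I" "r \<in> carrier G" using h ret_par' by (auto simp: r_def)
    \<comment> \<open>A root of \<open>v\<close> in the whole group retracts to a root inside \<open>par I\<close>.\<close>
    have "v = ret I v" using vI ret_id by simp
    then have rv: "v = r [^] n" using h ret_nat_pow by (simp add: r_def)
    then have "w = r [^] (n * k)" using wv r by (simp add: nat_pow_pow)
    then have "r \<otimes> w = w \<otimes> r" using nat_pow_comm[of r 1 "n * k"] r by simp
    then obtain j :: int where "r = v [^] j" using cent r by blast
    then have "v = v [^] (j * int n)" using rv by (metis int_pow_int int_pow_pow vc)
    then have "v [^] (j * int n - 1) = \<one>" using int_pow_diff[of v "j * int n" 1] by simp
    then have "j * int n = 1" using cyc_int_pow_eq_one[OF cv v1] by force
    then show False using h(2) by (metis dvd_triv_right int_dvd_int_iff nat_dvd_1_iff_1 numeral_le_one_iff of_nat_1 semiring_norm(69))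
  qed simp
  then show ?thesis using that vI cv k wv cent I_def by blast
qed

lemma centraliser_root:
  assumes w: "cyc w" "w \<noteq> \<one>" "conn (supp w)" "root_element G w"
    and c: "c \<in> par (supp w)" "c \<otimes> w = w \<otimes> c"
  shows "\<exists>j::int. c = w [^] j"
proof -
  obtain v and k :: nat where v: "v \<in> par (supp w)" "0 < k" "w = v [^] k"
    "\<And>c. c \<in> par (supp w) \<Longrightarrow> c \<otimes> w = w \<otimes> c \<Longrightarrow> \<exists>j::int. c = v [^] j"
    using centraliser_connected[OF w(1-3)] by metis
  have vc: "v \<in> carrier G" using v(1) par_carrier by blast
  then have "\<not> 2 \<le> k" using w(4) v(3) unfolding root_element_def by blast
  then have "w = v" using v(2,3) vc by (cases "k = 1") auto
  then show ?thesis using v(4) c by blast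
qed

text \<open>Within the parabolic subgroup of its connected support, a root element has the same
  centraliser as any of its powers with nonzero exponent.\<close>

lemma centraliser_root_pow:
  assumes w: "cyc w" "w \<noteq> \<one>" "conn (supp w)" "root_element G w"
    and m: "(m::int) \<noteq> 0" and c: "c \<in> par (supp w)" "c \<otimes> w [^] m = w [^] m \<otimes> c"
  shows "\<exists>j::int. c = w [^] j"
proof -
  have wc [simp]: "w \<in> carrier G" and cc: "c \<in> carrier G" using w c par_carrier by auto
  define n where "n = nat \<bar>m\<bar>"
  have n: "0 < n" using m by (simp add: n_def)
  have "w [^] n = w [^] m \<or> w [^] n = inv (w [^] m)"
    by (cases "m \<ge> 0") (auto simp: n_def int_pow_neg[symmetric] int_pow_int[symmetric])
  then have cn: "c \<otimes> w [^] n = w [^] n \<otimes> c"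
    using c(2) commute_inv[of "w [^] m" c] cc by auto
  have wn: "cyc (w [^] n)" "supp (w [^] n) = supp w"
    using cyc_nat_pow[OF w(1)] supp_cyc_pow[OF w(1) n] by auto
  then have "w [^] n \<noteq> \<one>" using w(2) supp_empty_iff[OF wc] supp_one by metis
  then obtain v and k :: nat where v: "v \<in> par (supp w)" "cyc v"
    "\<And>c. c \<in> par (supp w) \<Longrightarrow> c \<otimes> w [^] n = w [^] n \<otimes> c \<Longrightarrow> \<exists>j::int. c = v [^] j"
    using centraliser_connected[OF wn(1)] wn(2) w(3) by metis
  have vc [simp]: "v \<in> carrier G" using v(1) par_carrier by blast
  have "w \<otimes> w [^] n = w [^] n \<otimes> w" using nat_pow_comm[of w 1 n] by simp
  then obtain i :: int where i: "w = v [^] i" using v(3)[of w] supp_par by auto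
  then have "c = v [^] j \<Longrightarrow> c \<otimes> w = w \<otimes> c" for j :: int
    using i int_pow_mult[of v j i] int_pow_mult[of v i j] by (simp add: add.commute)
  then have "c \<otimes> w = w \<otimes> c" using v(3)[OF c(1) cn] by blast
  then show ?thesis using centraliser_root[OF w c(1)] by blast
qed


section \<open>Blocks\<close>

text \<open>A connected subset of \<open>S\<close> that meets a union \<open>I\<close> of components of \<open>S\<close> is contained in \<open>I\<close>.\<close>

lemma conn_subset_closed:
  assumes "conn J" "J \<subseteq> S" "perp I (S - I)" "x \<in> I" "x \<in> J"
  shows "J \<subseteq> I"
proof
  fix y assume "y \<in> J"
  then have "(x, y) \<in> {(a, b). a \<in> J \<and> b \<in> J \<and> \<not> adj a b}\<^sup>*"
    using assms by (auto simp: conn_def)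
  then show "y \<in> I"
  proof (induction rule: rtrancl_induct)
    case (step y z)
    then show ?case using assms(2,3) by (auto simp: perp_def)
  qed (use assms in simp)
qed

lemma gen_cyc: assumes "x \<in> X" shows "cyc (gen \<Gamma> x)"
  using assms cyc_ev[of "[(x, True)]"] adj_irrefl by (simp add: gen_ev reduced_Cons_iff flip_def)

lemma commute_gen_iff:
  assumes "x \<in> X" "g \<in> carrier G"
  shows "g \<otimes> gen \<Gamma> x = gen \<Gamma> x \<otimes> g \<longleftrightarrow> (\<forall>y\<in>supp g. y = x \<or> adj y x)"
proof
  assume "g \<otimes> gen \<Gamma> x = gen \<Gamma> x \<otimes> g"
  then have "g \<in> par ({x} \<union> lk {x})"
    using centraliser_supp[OF gen_cyc[OF assms(1)] assms(2)] gen_supp[OF assms(1)] by simp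
  then show "\<forall>y\<in>supp g. y = x \<or> adj y x" by (auto simp: par_def lk_def)
next
  assume s: "\<forall>y\<in>supp g. y = x \<or> adj y x"
  have "g \<in> par (supp g)" using assms(2) by (rule supp_par)
  moreover have "par (supp g) \<subseteq> {h \<in> carrier G. h \<otimes> gen \<Gamma> x = gen \<Gamma> x \<otimes> h}" (is "_ \<subseteq> ?K")
  proof (rule par_subset_subgroup)
    have [simp]: "gen \<Gamma> x \<in> carrier G" using assms(1) by (rule gen_carrier)
    show "subgroup ?K G"
    proof (rule subgroupI)
      show "?K \<noteq> {}" by (auto intro!: exI[of _ \<one>])
      show "inv h \<in> ?K" if "h \<in> ?K" for h using that commute_inv[of h "gen \<Gamma> x"] by auto
      show "h \<otimes> h' \<in> ?K" if "h \<in> ?K" "h' \<in> ?K" for h h'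
      proof -
        have "h \<otimes> h' \<otimes> gen \<Gamma> x = h \<otimes> (gen \<Gamma> x \<otimes> h')" using that by (simp add: m_assoc)
        also have "\<dots> = gen \<Gamma> x \<otimes> h \<otimes> h'" using that by (simp add: m_assoc[symmetric])
        finally show ?thesis using that by (simp add: m_assoc)
      qed
    qed auto
    fix y assume y: "y \<in> supp g" "y \<in> X"
    then consider "y = x" | "adj y x" using s by blast
    then show "gen \<Gamma> y \<in> ?K"
    proof cases
      case 2
      then have "perp {y} {x}" by (simp add: perp_def)
      then show ?thesis using perp_commute gen_par y assms(1) gen_carrier by blast
    qed (use assms gen_carrier in simp)
  qed
  ultimately show "g \<otimes> gen \<Gamma> x = gen \<Gamma> x \<otimes> g" by blast
qed

lemma commutator_one_iff:
  assumes "g \<in> carrier G" "h \<in> carrier G" shows "commutator G g h = \<one> \<longleftrightarrow> g \<otimes> h = h \<otimes> g"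
proof -
  have "commutator G g h = inv (h \<otimes> g) \<otimes> (g \<otimes> h)"
    using assms by (simp add: commutator_def inv_mult_group m_assoc)
  also have "\<dots> = \<one> \<longleftrightarrow> g \<otimes> h = h \<otimes> g"
    using assms inv_solve_left[of \<one> "h \<otimes> g" "g \<otimes> h"] by auto
  finally show ?thesis .
qed

lemma noncomm_arcs:
  "parcs (noncomm_graph \<Gamma>) = {(x, y). x \<in> X \<and> y \<in> X \<and> x \<noteq> y \<and> \<not> adj x y}"
proof -
  have "commutator G (gen \<Gamma> x) (gen \<Gamma> y) = \<one> \<longleftrightarrow> x = y \<or> adj x y" if "x \<in> X" "y \<in> X" for x y
    using that commute_gen_iff[of y "gen \<Gamma> x"] by (simp add: commutator_one_iff gen_carrier gen_supp)
  then show ?thesis by (auto simp: noncomm_graph_def G_eq[symmetric])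
qed

lemma reachable_noncomm_iff:
  assumes S: "S \<subseteq> X"
  shows "u \<rightarrow>\<^sup>*\<^bsub>with_proj (noncomm_graph \<Gamma>) \<restriction> S\<^esub> v
    \<longleftrightarrow> u \<in> S \<and> (u, v) \<in> {(a, b). a \<in> S \<and> b \<in> S \<and> \<not> adj a b}\<^sup>*" (is "_ \<longleftrightarrow> _ \<and> _ \<in> ?R\<^sup>*")
proof -
  define E where "E = arcs_ends (with_proj (noncomm_graph \<Gamma>) \<restriction> S)"
  have E: "E = {(x, y). x \<in> S \<and> y \<in> S \<and> x \<noteq> y \<and> \<not> adj x y}"
    using S by (auto simp: E_def arcs_ends_conv noncomm_arcs image_iff)
  have "(u, v) \<in> rtrancl_on S E \<longleftrightarrow> u \<in> S \<and> (u, v) \<in> ?R\<^sup>*"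
  proof
    assume r: "(u, v) \<in> rtrancl_on S E"
    have "E \<subseteq> ?R" using E by auto
    then have "(u, v) \<in> ?R\<^sup>*" using rtrancl_on_rtranclI[OF r] rtrancl_mono by blast
    then show "u \<in> S \<and> (u, v) \<in> ?R\<^sup>*" using in_rtrancl_on_in_F(1)[OF r] by simp
  next
    assume r: "u \<in> S \<and> (u, v) \<in> ?R\<^sup>*"
    then have "(u, v) \<in> ?R\<^sup>*" by simp
    then show "(u, v) \<in> rtrancl_on S E"
    proof (induction rule: rtrancl_induct)
      case (step y z)
      then show ?case
        by (cases "y = z") (auto simp: E intro: rtrancl_on_into_rtrancl_on)
    qed (use r in simp)
  qed
  then show ?thesis by (simp add: reachable_def E_def)
qed

text \<open>The components of the non-commutation graph on \<open>S\<close> are the connected sets that commute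
  with the rest of \<open>S\<close>.\<close>

lemma sccs_noncomm_iff:
  assumes S: "S \<subseteq> X"
  shows "I \<in> pre_digraph.sccs_verts (with_proj (noncomm_graph \<Gamma>) \<restriction> S)
    \<longleftrightarrow> I \<noteq> {} \<and> I \<subseteq> S \<and> conn I \<and> perp I (S - I)"
proof -
  define R where "R T = {(a, b). a \<in> T \<and> b \<in> T \<and> \<not> adj a b}" for T
  have symR: "(b, a) \<in> (R S)\<^sup>*" if "(a, b) \<in> (R S)\<^sup>*" for a b
  proof -
    have "sym (R S)" using adj_sym by (auto simp: sym_def R_def)
    then show ?thesis using symD[OF sym_rtrancl that] by simp
  qed
  have conn_iff: "conn I \<longleftrightarrow> (\<forall>x\<in>I. \<forall>y\<in>I. (x, y) \<in> (R I)\<^sup>*)"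
    by (simp add: conn_def R_def)
  have scc: "I \<in> pre_digraph.sccs_verts (with_proj (noncomm_graph \<Gamma>) \<restriction> S)
    \<longleftrightarrow> I \<noteq> {} \<and> (\<forall>u\<in>I. \<forall>v\<in>I. u \<in> S \<and> (u, v) \<in> (R S)\<^sup>*)
      \<and> (\<forall>u\<in>I. \<forall>v. v \<notin> I \<longrightarrow> \<not> (u \<in> S \<and> (u, v) \<in> (R S)\<^sup>*) \<or> \<not> (v \<in> S \<and> (v, u) \<in> (R S)\<^sup>*))"
    by (simp only: pre_digraph.sccs_verts_def reachable_noncomm_iff[OF S] R_def mem_Collect_eq)
  show ?thesis
  proof
    assume "I \<in> pre_digraph.sccs_verts (with_proj (noncomm_graph \<Gamma>) \<restriction> S)"
    then have I: "I \<noteq> {}" "\<forall>u\<in>I. \<forall>v\<in>I. u \<in> S \<and> (u, v) \<in> (R S)\<^sup>*"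
      and out: "\<forall>u\<in>I. \<forall>v. v \<notin> I \<longrightarrow> \<not> (u \<in> S \<and> (u, v) \<in> (R S)\<^sup>*) \<or> \<not> (v \<in> S \<and> (v, u) \<in> (R S)\<^sup>*)"
      unfolding scc by simp_all
    have IS: "I \<subseteq> S" using I(2) by blast
    have cl: "z \<in> I" if "x \<in> I" "z \<in> S" "(x, z) \<in> (R S)\<^sup>*" for x z
      using out that IS symR[OF that(3)] by blast
    have "(x, y) \<in> (R I)\<^sup>*" if x: "x \<in> I" and y: "y \<in> I" for x y
    proof -
      have "(x, y) \<in> (R S)\<^sup>*" using I(2) x y by blast
      then have "y \<in> I \<and> (x, y) \<in> (R I)\<^sup>*"
      proof (induction rule: rtrancl_induct)
        case (step y z)
        have "(x, z) \<in> (R S)\<^sup>*" using step(1,2) by (rule rtrancl_into_rtrancl)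
        moreover have "z \<in> S" using step(2) by (simp add: R_def)
        ultimately have z: "z \<in> I" using cl x by blast
        then have "(y, z) \<in> R I" using step by (simp add: R_def)
        then show ?case using z rtrancl_into_rtrancl[of x y "R I" z] step(3) by simp
      qed (use x in simp)
      then show ?thesis by simp
    qed
    moreover have "perp I (S - I)" unfolding perp_def
    proof (intro ballI)
      fix x y assume x: "x \<in> I" and y: "y \<in> S - I"
      show "adj x y"
      proof (rule ccontr)
        assume "\<not> adj x y"
        then have "(x, y) \<in> R S" using x y IS by (auto simp: R_def)
        then have "y \<in> I" using cl[OF x] y by blast
        then show False using y by simp
      qed
    qed
    ultimately show "I \<noteq> {} \<and> I \<subseteq> S \<and> conn I \<and> perp I (S - I)" using I(1) IS conn_iff by simp
  next
    assume I: "I \<noteq> {} \<and> I \<subseteq> S \<and> conn I \<and> perp I (S - I)"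
    have "R I \<subseteq> R S" using I by (auto simp: R_def)
    then have sub: "(R I)\<^sup>* \<subseteq> (R S)\<^sup>*" by (rule rtrancl_mono)
    have stay: "v \<in> I" if "u \<in> I" "(u, v) \<in> (R S)\<^sup>*" for u v
      using that(2)
    proof (induction rule: rtrancl_induct)
      case (step y z)
      then show ?case using I by (auto simp: perp_def R_def)
    qed (use that in simp)
    have reach: "(u, v) \<in> (R S)\<^sup>*" if "u \<in> I" "v \<in> I" for u v
    proof -
      have "(u, v) \<in> (R I)\<^sup>*" using that I conn_iff by simp
      then show ?thesis using sub by (rule rev_subsetD)
    qed
    then show "I \<in> pre_digraph.sccs_verts (with_proj (noncomm_graph \<Gamma>) \<restriction> S)"
      unfolding scc
    proof (intro conjI ballI allI impI)
      show "I \<noteq> {}" using I by simp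
      show "u \<in> S" if "u \<in> I" for u using that I by blast
      show "(u, v) \<in> (R S)\<^sup>*" if "u \<in> I" "v \<in> I" for u v using that by (rule reach)
      show "\<not> (u \<in> S \<and> (u, v) \<in> (R S)\<^sup>*) \<or> \<not> (v \<in> S \<and> (v, u) \<in> (R S)\<^sup>*)"
        if "u \<in> I" "v \<notin> I" for u v using stay[OF that(1)] that(2) by auto
    qed
  qed
qed

text \<open>The product of a list of elements.\<close>

abbreviation prodl :: "'a word set list \<Rightarrow> 'a word set" where
  "prodl ws \<equiv> foldr (\<otimes>) ws \<one>"

text \<open>Elements whose supports commute pairwise; in particular the supports are pairwise
  disjoint.\<close>

definition perp_list :: "'a word set list \<Rightarrow> bool" where
  "perp_list ws \<longleftrightarrow> set ws \<subseteq> carrier G \<and> sorted_wrt (\<lambda>g h. perp (supp g) (supp h)) ws"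

lemma perp_list_Nil [simp]: "perp_list []"
  by (simp add: perp_list_def)

lemma perp_list_Cons: "perp_list (v # ws) \<longleftrightarrow>
    v \<in> carrier G \<and> perp (supp v) (\<Union>(supp ` set ws)) \<and> perp_list ws"
  by (auto simp: perp_list_def perp_def)

lemma perp_list_filter: "perp_list ws \<Longrightarrow> perp_list (filter P ws)"
  by (auto simp: perp_list_def sorted_wrt_filter)

lemma perp_list_pairwise:
  "perp_list ws \<Longrightarrow> g \<in> set ws \<Longrightarrow> h \<in> set ws \<Longrightarrow> g \<noteq> h \<Longrightarrow> perp (supp g) (supp h)"
proof (induction ws)
  case (Cons v ws)
  have "perp (supp v) (supp k)" if "k \<in> set ws" for k
    using Cons.prems(1) that by (auto simp: perp_list_Cons perp_def)
  then show ?case using Cons perp_sym by (auto simp: perp_list_Cons)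
qed simp

lemma perp_list_prodl:
  "perp_list ws \<Longrightarrow> prodl ws \<in> carrier G \<and> supp (prodl ws) = \<Union>(supp ` set ws)"
proof (induction ws)
  case (Cons v ws)
  then have c: "v \<in> carrier G" "prodl ws \<in> carrier G" "perp (supp v) (supp (prodl ws))"
    "supp (prodl ws) = \<Union>(supp ` set ws)" by (auto simp: perp_list_Cons)
  then show ?case using perp_len_supp(2)[OF c(3) supp_par supp_par] by simp
qed simp

lemma perp_list_ret:
  assumes "perp_list ws" "v \<in> set ws" "v \<noteq> \<one>"
  shows "ret (supp v) (prodl ws) = v"
  using assms(1,2)
proof (induction ws)
  case (Cons u ws)
  then have c: "u \<in> carrier G" "prodl ws \<in> carrier G" "supp (prodl ws) = \<Union>(supp ` set ws)"
    "perp (supp u) (\<Union>(supp ` set ws))"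
    using perp_list_prodl by (auto simp: perp_list_Cons)
  have vc: "v \<in> carrier G" using Cons.prems by (auto simp: perp_list_def)
  show ?case
  proof (cases "v = u")
    case True
    have "ret (supp u) (prodl ws) = \<one>"
      using perp_disjoint[OF c(4)] c by (intro ret_trivial[OF supp_par]) auto
    then show ?thesis using True c by (simp add: ret_mult ret_id supp_par)
  next
    case False
    then have v: "v \<in> set ws" using Cons.prems by simp
    then have "ret (supp v) u = \<one>"
      using perp_disjoint[OF c(4)] c by (intro ret_trivial[OF supp_par]) auto
    then show ?thesis using Cons v c vc by (simp add: ret_mult perp_list_Cons)
  qed
qed simp

lemma perp_mult_swap:
  assumes "perp P Q" "a \<in> par P" "b \<in> par Q"
  shows "(a \<otimes> b) \<otimes> (a \<otimes> b) = (a \<otimes> a) \<otimes> (b \<otimes> b)"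
proof -
  have [simp]: "a \<in> carrier G" "b \<in> carrier G" using assms par_carrier by auto
  have "(a \<otimes> b) \<otimes> (a \<otimes> b) = a \<otimes> (b \<otimes> a) \<otimes> b" by (simp add: m_assoc)
  also have "\<dots> = a \<otimes> (a \<otimes> b) \<otimes> b" using perp_commute[OF assms] by simp
  finally show ?thesis by (simp add: m_assoc)
qed

lemma cyc_perp_mult:
  assumes "perp P Q" "a \<in> par P" "b \<in> par Q" "cyc a" "cyc b" shows "cyc (a \<otimes> b)"
  using perp_mult_swap[OF assms(1-3)] perp_len_supp(1)[OF assms(1-3)]
    perp_len_supp(1)[OF assms(1) par_mult[OF assms(2,2)] par_mult[OF assms(3,3)]] assms(4,5)
  by (simp add: cyc_def)

text \<open>The part of a cyclically minimal element on a union of components of its support is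
  cyclically minimal.\<close>

lemma cyc_ret:
  assumes w: "cyc w" and p: "perp I (supp w - I)" shows "cyc (ret I w)"
proof -
  define a b where "a = ret I w" and "b = ret (supp w - I) w"
  have wc [simp]: "w \<in> carrier G" using w by simp
  have ab: "a \<in> par I" "b \<in> par (supp w - I)" using ret_par' by (auto simp: a_def b_def)
  have [simp]: "a \<in> carrier G" "b \<in> carrier G" by (auto simp: a_def b_def)
  have "w \<in> par (I \<union> (supp w - I))" using par_mono[OF supp_par[OF wc]] by simp
  then have w_ab: "w = a \<otimes> b" using ret_split[OF p] by (simp add: a_def b_def)
  have "len (w \<otimes> w) = len (a \<otimes> a) + len (b \<otimes> b)"
    unfolding w_ab perp_mult_swap[OF p ab]
    by (rule perp_len_supp(1)[OF p par_mult[OF ab(1) ab(1)] par_mult[OF ab(2) ab(2)]])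
  moreover have "len w = len a + len b" unfolding w_ab by (rule perp_len_supp(1)[OF p ab])
  moreover have "len (a \<otimes> a) \<le> len a + len a" "len (b \<otimes> b) \<le> len b + len b"
    by (intro len_mult_le; simp)+
  ultimately have "len (a \<otimes> a) = 2 * len a" using w by (simp add: cyc_def)
  then show ?thesis unfolding a_def[symmetric] by (simp add: cyc_def)
qed

text \<open>A list of blocks: nontrivial cyclically minimal elements with connected supports
  that commute letter by letter.\<close>

definition blocks :: "'a word set list \<Rightarrow> bool" where
  "blocks ws \<longleftrightarrow> perp_list ws \<and> (\<forall>v\<in>set ws. cyc v \<and> v \<noteq> \<one> \<and> conn (supp v))"

lemma blocks_prodl_cyc: "blocks ws \<Longrightarrow> cyc (prodl ws)"
proof (induction ws)
  case (Cons v ws)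
  then have c: "v \<in> carrier G" "prodl ws \<in> carrier G" "perp (supp v) (supp (prodl ws))"
    "cyc v" "blocks ws" using perp_list_prodl[of ws] by (auto simp: perp_list_Cons blocks_def)
  then show ?case using cyc_perp_mult[OF c(3) supp_par supp_par] Cons.IH by simp
qed (simp add: cyc_one)

text \<open>Block decompositions are the products of lists of blocks in the above sense.\<close>

lemma block_decomposition_iff:
  "block_decomposition \<Gamma> w ws \<longleftrightarrow> blocks ws \<and> w = prodl ws"
proof
  assume bd: "block_decomposition \<Gamma> w ws"
  then have w: "cyc w" "set ws \<subseteq> carrier G" "w = prodl ws" "distinct (map supp ws)"
    and S: "set (map supp ws) = pre_digraph.sccs_verts (with_proj (noncomm_graph \<Gamma>) \<restriction> supp w)"
    by (auto simp: block_decomposition_def G_eq[symmetric] cyclically_minimal_iff)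
  have SX: "supp w \<subseteq> X" using cyc_carrier[OF w(1)] by (rule supp_subset)
  have comp: "supp v \<noteq> {} \<and> supp v \<subseteq> supp w \<and> conn (supp v) \<and> perp (supp v) (supp w - supp v)"
    if "v \<in> set ws" for v using that S sccs_noncomm_iff[OF SX] by auto
  have pp: "perp (supp g) (supp h)" if "g \<in> set ws" "h \<in> set ws" "supp g \<noteq> supp h" for g h
  proof -
    have "supp g \<inter> supp h = {}"
    proof (rule ccontr)
      assume "\<not> ?thesis"
      then obtain x where "x \<in> supp g" "x \<in> supp h" by blast
      then have "supp g \<subseteq> supp h" "supp h \<subseteq> supp g"
        using conn_subset_closed[of _ "supp w"] comp that by blast+
      then show False using that by blast
    qed
    then have "supp h \<subseteq> supp w - supp g" using comp that by blast
    then show ?thesis using comp[OF that(1)] unfolding perp_def by blast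
  qed
  have "sorted_wrt (\<lambda>g h. perp (supp g) (supp h)) ws"
    unfolding sorted_wrt_iff_nth_less
  proof (intro allI impI)
    fix i j assume ij: "i < j" "j < length ws"
    then have "supp (ws ! i) \<noteq> supp (ws ! j)"
      using w(4) nth_eq_iff_index_eq[of "map supp ws" i j] by simp
    then show "perp (supp (ws ! i)) (supp (ws ! j))" using pp ij by simp
  qed
  then have pl: "perp_list ws" using w by (simp add: perp_list_def)
  have "cyc v \<and> v \<noteq> \<one> \<and> conn (supp v)" if v: "v \<in> set ws" for v
  proof -
    have "v \<noteq> \<one>" using comp[OF v] supp_one by metis
    then have "ret (supp v) w = v" using perp_list_ret[OF pl v] w(3) by simp
    then show ?thesis using cyc_ret[OF w(1), of "supp v"] comp[OF v] \<open>v \<noteq> \<one>\<close> by simp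
  qed
  then show "blocks ws \<and> w = prodl ws" using pl w(3) by (simp add: blocks_def)
next
  assume b: "blocks ws \<and> w = prodl ws"
  then have pl: "perp_list ws" and props: "\<And>v. v \<in> set ws \<Longrightarrow> cyc v \<and> v \<noteq> \<one> \<and> conn (supp v) \<and> supp v \<noteq> {}"
    using supp_empty_iff by (auto simp: blocks_def)
  have w: "cyc w" "supp w = \<Union>(supp ` set ws)" using b blocks_prodl_cyc perp_list_prodl[OF pl] by auto
  have SX: "supp w \<subseteq> X" using cyc_carrier[OF w(1)] by (rule supp_subset)
  have comp: "supp v \<noteq> {} \<and> supp v \<subseteq> supp w \<and> conn (supp v) \<and> perp (supp v) (supp w - supp v)"
    if v: "v \<in> set ws" for v
  proof -
    have "adj x y" if xy: "x \<in> supp v" "y \<in> supp w" "y \<notin> supp v" for x y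
    proof -
      obtain u where "u \<in> set ws" "y \<in> supp u" using xy w by blast
      then show ?thesis using perp_list_pairwise[OF pl v] xy unfolding perp_def by metis
    qed
    then show ?thesis using props[OF v] w v by (auto simp: perp_def)
  qed
  have "sorted_wrt (\<lambda>g h. perp (supp g) (supp h)) ws" using pl by (simp add: perp_list_def)
  then have "distinct (map supp ws)"
    using props unfolding distinct_conv_nth sorted_wrt_iff_nth_less
    by (metis (no_types, lifting) Int_absorb length_map linorder_neqE_nat nth_map nth_mem perp_disjoint)
  moreover have "I \<in> set (map supp ws)"
    if I: "I \<noteq> {} \<and> I \<subseteq> supp w \<and> conn I \<and> perp I (supp w - I)" for I
  proof -
    obtain x v where x: "x \<in> I" "v \<in> set ws" "x \<in> supp v" using I w(2) by blast
    then have "I \<subseteq> supp v" "supp v \<subseteq> I"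
      using conn_subset_closed[of _ "supp w"] comp[OF x(2)] I by blast+
    then show ?thesis using x by auto
  qed
  ultimately show "block_decomposition \<Gamma> w ws"
    using w(1) b pl comp sccs_noncomm_iff[OF SX]
    by (auto simp: block_decomposition_def G_eq[symmetric] cyclically_minimal_iff perp_list_def)
qed

text \<open>The criterion \<open>mem_subgroup_components\<close> for the supports of pairwise commuting elements,
  together with a set \<open>A\<close> of generators adjacent to all of them.\<close>

lemma mem_subgroup_blocks:
  assumes pl: "perp_list ws" and A: "perp (supp (prodl ws)) A"
    and c: "c \<in> par (supp (prodl ws) \<union> A)" and K: "subgroup K G"
    and comp: "\<And>v. v \<in> set ws \<Longrightarrow> ret (supp v) c \<in> K" "ret A c \<in> K"
  shows "c \<in> K"
proof (rule mem_subgroup_components[OF _ _ _ K])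
  let ?F = "insert A (supp ` set ws)"
  have s: "supp (prodl ws) = \<Union>(supp ` set ws)" using perp_list_prodl[OF pl] by simp
  show "finite ?F" by simp
  show "c \<in> par (\<Union>?F)" using c s by (simp add: Un_commute)
  show "ret I c \<in> K" if "I \<in> ?F" for I using that comp by auto
  have vA: "perp (supp v) A" if "v \<in> set ws" for v using A that s by (auto simp: perp_def)
  show "perp I J" if "I \<in> ?F" "J \<in> ?F" "I \<noteq> J" for I J
    using that vA perp_sym perp_list_pairwise[OF pl] by blast
qed

text \<open>The centraliser of a cyclically minimal element whose blocks are root elements.\<close>

theorem centraliser_blocks:
  assumes b: "blocks ws" and root: "\<And>v. v \<in> set ws \<Longrightarrow> root_element G v"
    and c: "c \<in> carrier G" "c \<otimes> prodl ws = prodl ws \<otimes> c"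
    and K: "subgroup K G" "set ws \<subseteq> K" "ret (lk (supp (prodl ws))) c \<in> K"
  shows "c \<in> K"
proof (rule mem_subgroup_blocks[OF _ perp_lk _ K(1) _ K(3)])
  show pl: "perp_list ws" using b by (simp add: blocks_def)
  have w: "cyc (prodl ws)" using b by (rule blocks_prodl_cyc)
  then show "c \<in> par (supp (prodl ws) \<union> lk (supp (prodl ws)))" using c by (intro centraliser_supp)
  fix v assume v: "v \<in> set ws"
  then have vp: "cyc v" "v \<noteq> \<one>" "conn (supp v)" using b by (auto simp: blocks_def)
  have "ret (supp v) c \<otimes> v = v \<otimes> ret (supp v) c"
    using perp_list_ret[OF pl v vp(2)] ret_mult[OF c(1) cyc_carrier[OF w], of "supp v"]
      ret_mult[OF cyc_carrier[OF w] c(1), of "supp v"] c(2) by simp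
  then obtain j :: int where "ret (supp v) c = v [^] j"
    using centraliser_root[OF vp root[OF v]] ret_par'[OF c(1)] by blast
  then show "ret (supp v) c \<in> K" using K v subgroup_int_pow_closed[OF K(1)] by auto
qed

end

section \<open>Orthogonal complements\<close>

lemma graph_dist_le_one_iff:
  assumes "wf_digraph \<Lambda>" "u \<in> verts \<Lambda>"
  shows "graph_dist \<Lambda> u v \<le> 1 \<longleftrightarrow> u = v \<or> u \<rightarrow>\<^bsub>\<Lambda>\<^esub> v"
proof -
  interpret wf_digraph \<Lambda> by (rule assms(1))
  have cost: "awalk_cost (\<lambda>_. 1) p = real (length p)" for p
    by (induction p) auto
  show ?thesis
  proof
    assume "graph_dist \<Lambda> u v \<le> 1"
    moreover have "(1::ereal) < 2" by simp
    ultimately have "graph_dist \<Lambda> u v < 2" by (rule le_less_trans)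
    then obtain p where p: "awalk u p v" "ereal (awalk_cost (\<lambda>_. 1) p) < 2"
      by (auto simp: graph_dist_def \<mu>_def INF_less_iff)
    from p(2) have l: "length p < 2" unfolding cost by simp
    show "u = v \<or> u \<rightarrow>\<^bsub>\<Lambda>\<^esub> v"
    proof (cases p)
      case Nil
      then show ?thesis using p(1) by (simp add: awalk_Nil_iff)
    next
      case (Cons e q)
      then have "p = [e]" using l by simp
      then have "e \<in> arcs \<Lambda>" "u = tail \<Lambda> e" "v = head \<Lambda> e"
        using p(1) by (auto simp: awalk_Cons_iff awalk_Nil_iff)
      then show ?thesis by (auto simp: arcs_ends_conv)
    qed
  next
    assume "u = v \<or> u \<rightarrow>\<^bsub>\<Lambda>\<^esub> v"
    then obtain p where p: "awalk u p v" "length p \<le> 1"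
    proof
      assume "u = v"
      then show ?thesis using that[of "[]"] assms(2) by (simp add: awalk_Nil_iff)
    next
      assume "u \<rightarrow>\<^bsub>\<Lambda>\<^esub> v"
      then obtain e where "e \<in> arcs \<Lambda>" "tail \<Lambda> e = u" "head \<Lambda> e = v" by blast
      then show ?thesis using that[of "[e]"] arc_implies_awalk[of e] by simp
    qed
    have "graph_dist \<Lambda> u v \<le> ereal (awalk_cost (\<lambda>_. 1) p)"
      unfolding graph_dist_def by (rule min_cost_le_walk_cost[OF p(1)])
    also have "\<dots> \<le> 1" using p(2) unfolding cost by simp
    finally show "graph_dist \<Lambda> u v \<le> 1" .
  qed
qed

context pc
begin

text \<open>The orthogonal complement in \<open>\<Gamma>\<close>, in terms of adjacency (see \<open>orth_eq_star\<close>).\<close>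

definition star :: "'a set \<Rightarrow> 'a set" where
  "star U = {v \<in> X. \<forall>u\<in>U. v = u \<or> adj v u}"

lemma wf_\<Gamma>: "wf_digraph \<Gamma>"
proof -
  interpret graph \<Gamma> by (rule graph)
  show ?thesis by (rule wf_digraph)
qed

lemma orth_eq_star: "orth \<Gamma> U = star U"
  using graph_dist_le_one_iff[OF wf_\<Gamma>] by (auto simp: orth_def star_def)

lemma orth_induced:
  assumes "A \<subseteq> X" "U \<subseteq> A" shows "orth (\<Gamma> \<restriction> A) U = A \<inter> star U"
proof -
  have wf: "wf_digraph (\<Gamma> \<restriction> A)" using wf_\<Gamma> by (rule wf_digraph.wellformed_induce_subgraph)
  have "v \<rightarrow>\<^bsub>\<Gamma> \<restriction> A\<^esub> u \<longleftrightarrow> v \<in> A \<and> u \<in> A \<and> adj v u" for u v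
    by (auto simp: arcs_ends_conv image_iff)
  then show ?thesis
    using graph_dist_le_one_iff[OF wf] assms by (auto simp: orth_def star_def)
qed

lemma orth_minus: "orth \<Gamma> U - U = lk U"
  using adj_irrefl by (auto simp: orth_eq_star star_def lk_def)

lemma lk_subset: "lk U \<subseteq> X"
  by (auto simp: lk_def)

lemma star_galois: "Y \<subseteq> X \<Longrightarrow> Y \<subseteq> star (A \<inter> star Y)"
  using adj_sym by (auto simp: star_def)

lemma commute_gens_iff:
  assumes "U \<subseteq> X" "g \<in> carrier G"
  shows "(\<forall>u\<in>U. g \<otimes> gen \<Gamma> u = gen \<Gamma> u \<otimes> g) \<longleftrightarrow> supp g \<subseteq> star U"
proof -
  have "(\<forall>u\<in>U. g \<otimes> gen \<Gamma> u = gen \<Gamma> u \<otimes> g) \<longleftrightarrow> (\<forall>u\<in>U. \<forall>y\<in>supp g. y = u \<or> adj y u)"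
    using commute_gen_iff[OF _ assms(2)] assms(1) by (intro ball_cong) blast+
  also have "\<dots> \<longleftrightarrow> supp g \<subseteq> star U" using supp_subset[OF assms(2)] unfolding star_def by blast
  finally show ?thesis .
qed

section \<open>Centralisers of sets\<close>

lemma mem_centraliser: "g \<in> centraliser G S \<longleftrightarrow> g \<in> carrier G \<and> (\<forall>s\<in>S. g \<otimes> s = s \<otimes> g)"
  by (simp add: centraliser_def)

lemma subgroup_centraliser:
  assumes S: "S \<subseteq> carrier G" shows "subgroup (centraliser G S) G"
proof (rule subgroupI)
  show "centraliser G S \<subseteq> carrier G" by (auto simp: centraliser_def)
  have "\<one> \<in> centraliser G S" using S by (auto simp: mem_centraliser)
  then show "centraliser G S \<noteq> {}" by blast
  show "inv h \<in> centraliser G S" if "h \<in> centraliser G S" for h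
    using that S commute_inv[of h] by (auto simp: mem_centraliser)
  show "h \<otimes> k \<in> centraliser G S" if hk: "h \<in> centraliser G S" "k \<in> centraliser G S" for h k
    unfolding mem_centraliser
  proof (intro conjI ballI)
    have c: "h \<in> carrier G" "k \<in> carrier G" using hk by (auto simp: mem_centraliser)
    then show "h \<otimes> k \<in> carrier G" by simp
    fix s assume s: "s \<in> S"
    then have sc: "s \<in> carrier G" using S by blast
    have "h \<otimes> k \<otimes> s = h \<otimes> (s \<otimes> k)" using hk s c sc by (simp add: m_assoc mem_centraliser)
    also have "\<dots> = h \<otimes> s \<otimes> k" using c sc by (simp add: m_assoc)
    also have "\<dots> = s \<otimes> (h \<otimes> k)" using hk s c sc by (simp add: m_assoc mem_centraliser)
    finally show "h \<otimes> k \<otimes> s = s \<otimes> (h \<otimes> k)" .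
  qed
qed

text \<open>Conjugation, on the side used for conjugate subgroups.\<close>

definition cj :: "'a word set \<Rightarrow> 'a word set \<Rightarrow> 'a word set" where
  "cj g k = inv g \<otimes> k \<otimes> g"

lemma cj_carrier [simp]: "g \<in> carrier G \<Longrightarrow> k \<in> carrier G \<Longrightarrow> cj g k \<in> carrier G"
  by (simp add: cj_def)

lemma cj_mult:
  assumes [simp]: "g \<in> carrier G" "h \<in> carrier G" "k \<in> carrier G"
  shows "cj g (h \<otimes> k) = cj g h \<otimes> cj g k"
proof -
  have "g \<otimes> (inv g \<otimes> (k \<otimes> g)) = k \<otimes> g" by (simp add: m_assoc[symmetric])
  then show ?thesis by (simp add: cj_def m_assoc)
qed

lemma cj_cj: "g \<in> carrier G \<Longrightarrow> h \<in> carrier G \<Longrightarrow> k \<in> carrier G \<Longrightarrow> cj h (cj g k) = cj (g \<otimes> h) k"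
  by (simp add: cj_def inv_mult_group m_assoc)

lemma cj_one [simp]: "k \<in> carrier G \<Longrightarrow> cj \<one> k = k"
  by (simp add: cj_def)

lemma cj_image_cj:
  "g \<in> carrier G \<Longrightarrow> h \<in> carrier G \<Longrightarrow> K \<subseteq> carrier G \<Longrightarrow> cj h ` cj g ` K = cj (g \<otimes> h) ` K"
  by (auto simp: image_image cj_cj intro!: image_cong)

lemma cj_image_one: "K \<subseteq> carrier G \<Longrightarrow> cj \<one> ` K = K"
  by (auto simp: image_iff) (metis cj_one subsetD)+

lemma cj_image_carrier: "g \<in> carrier G \<Longrightarrow> K \<subseteq> carrier G \<Longrightarrow> cj g ` K \<subseteq> carrier G"
  by auto

lemma cj_centraliser_subset:
  assumes g: "g \<in> carrier G" and S: "S \<subseteq> carrier G"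
  shows "cj g ` centraliser G S \<subseteq> centraliser G (cj g ` S)"
proof clarify
  fix k assume k: "k \<in> centraliser G S"
  then have kc: "k \<in> carrier G" by (simp add: mem_centraliser)
  have "cj g k \<otimes> cj g s = cj g s \<otimes> cj g k" if "s \<in> S" for s
    using that k S g kc cj_mult[of g k s] cj_mult[of g s k] by (auto simp: mem_centraliser)
  then show "cj g k \<in> centraliser G (cj g ` S)" using g kc by (simp add: mem_centraliser)
qed

lemma cj_centraliser:
  assumes g: "g \<in> carrier G" and S: "S \<subseteq> carrier G"
  shows "cj g ` centraliser G S = centraliser G (cj g ` S)"
proof
  show "cj g ` centraliser G S \<subseteq> centraliser G (cj g ` S)" using assms by (rule cj_centraliser_subset)
  have sub: "centraliser G T \<subseteq> carrier G" for T by (auto simp: mem_centraliser)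
  have "cj (inv g) ` centraliser G (cj g ` S) \<subseteq> centraliser G (cj (inv g) ` cj g ` S)"
    using g S by (intro cj_centraliser_subset cj_image_carrier) auto
  also have "\<dots> = centraliser G S" using g S by (simp add: cj_image_cj cj_image_one)
  finally have "cj g ` cj (inv g) ` centraliser G (cj g ` S) \<subseteq> cj g ` centraliser G S" by blast
  then show "centraliser G (cj g ` S) \<subseteq> cj g ` centraliser G S"
    using g sub by (simp add: cj_image_cj cj_image_one)
qed

lemma conjugate_subgroups_iff: "conjugate_subgroups G H K \<longleftrightarrow> (\<exists>g\<in>carrier G. H = cj g ` K)"
  by (simp add: conjugate_subgroups_def cj_def)

section \<open>Quasiparabolic subgroups\<close>

lemma qp_data_iff:
  "qp_data \<Gamma> w ws Z \<longleftrightarrow> blocks ws \<and> w = prodl ws \<and> (\<forall>v\<in>set ws. root_element G v) \<and> Z \<subseteq> star (supp w)"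
  by (auto simp: qp_data_def block_decomposition_iff G_eq[symmetric] orth_eq_star)

lemma qp_subgroup_eq: "qp_subgroup \<Gamma> ws Z = generate G (set ws \<union> gen \<Gamma> ` Z)"
  by (simp add: qp_subgroup_def G_eq)

lemma blocks_carrier: "blocks ws \<Longrightarrow> set ws \<subseteq> carrier G"
  by (auto simp: blocks_def perp_list_def)

lemma blocks_perp_list: "blocks ws \<Longrightarrow> perp_list ws"
  by (simp add: blocks_def)

lemma subgroup_qp:
  assumes "blocks ws" "Z \<subseteq> X" shows "subgroup (qp_subgroup \<Gamma> ws Z) G"
  using assms blocks_carrier gen_carrier unfolding qp_subgroup_eq
  by (intro generate_is_subgroup) blast

lemma mem_qp: "v \<in> set ws \<Longrightarrow> v \<in> qp_subgroup \<Gamma> ws Z"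
  unfolding qp_subgroup_eq by (rule generate.incl) simp

lemma par_subset_qp:
  assumes "blocks ws" "Z \<subseteq> X" shows "par Z \<subseteq> qp_subgroup \<Gamma> ws Z"
proof (rule par_subset_subgroup[OF subgroup_qp[OF assms]])
  show "gen \<Gamma> x \<in> qp_subgroup \<Gamma> ws Z" if "x \<in> Z" for x
    using that unfolding qp_subgroup_eq by (intro generate.incl) simp
qed

lemma qp_subset:
  "subgroup K G \<Longrightarrow> set ws \<subseteq> K \<Longrightarrow> (\<And>x. x \<in> Z \<Longrightarrow> gen \<Gamma> x \<in> K) \<Longrightarrow> qp_subgroup \<Gamma> ws Z \<subseteq> K"
  unfolding qp_subgroup_eq by (intro generate_subgroup_incl) auto

lemma prodl_mem: "subgroup K G \<Longrightarrow> set ws \<subseteq> K \<Longrightarrow> prodl ws \<in> K"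
  by (induction ws) (auto intro: subgroup.one_closed subgroup.m_closed)

lemma blocks_commute:
  assumes "perp_list ws" "v \<in> set ws" "u \<in> set ws" shows "v \<otimes> u = u \<otimes> v"
proof (cases "v = u")
  case False
  then have "perp (supp v) (supp u)" using perp_list_pairwise assms by blast
  moreover have "v \<in> carrier G" "u \<in> carrier G" using assms by (auto simp: perp_list_def)
  ultimately show ?thesis by (metis perp_commute supp_par)
qed simp

lemma blocks_commute_prodl:
  assumes "perp_list ws" "v \<in> set ws" shows "v \<otimes> prodl ws = prodl ws \<otimes> v"
proof -
  have c: "set ws \<subseteq> carrier G" using assms by (simp add: perp_list_def)
  then have sub: "subgroup (centraliser G {v}) G" using assms by (intro subgroup_centraliser) auto
  have "set ws \<subseteq> centraliser G {v}" using assms c blocks_commute by (auto simp: mem_centraliser)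
  then have "prodl ws \<in> centraliser G {v}" using sub by (intro prodl_mem)
  then show ?thesis by (simp add: mem_centraliser)
qed

lemma supp_block: "perp_list ws \<Longrightarrow> v \<in> set ws \<Longrightarrow> supp v \<subseteq> supp (prodl ws)"
  using perp_list_prodl by auto

lemma block_par: "perp_list ws \<Longrightarrow> v \<in> set ws \<Longrightarrow> v \<in> par (supp (prodl ws))"
  using supp_block by (auto simp: par_def perp_list_def)

text \<open>Quasiparabolic subgroups with a closed parabolic factor are centralisers.\<close>

lemma qp_eq_centraliser:
  assumes b: "blocks ws" and root: "\<And>v. v \<in> set ws \<Longrightarrow> root_element G v"
    and U: "U \<subseteq> lk (supp (prodl ws))"
  shows "qp_subgroup \<Gamma> ws (lk (supp (prodl ws)) \<inter> star U) = centraliser G (insert (prodl ws) (gen \<Gamma> ` U))"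
    (is "?Q = ?C")
proof
  let ?A = "lk (supp (prodl ws))"
  have pl: "perp_list ws" using b by (rule blocks_perp_list)
  have UX: "U \<subseteq> X" using U lk_subset by blast
  have wc: "prodl ws \<in> carrier G" using perp_list_prodl[OF pl] by simp
  have S: "insert (prodl ws) (gen \<Gamma> ` U) \<subseteq> carrier G" using wc UX gen_carrier by blast
  show "?Q \<subseteq> ?C"
  proof (rule qp_subset[OF subgroup_centraliser[OF S]])
    show "set ws \<subseteq> ?C"
    proof
      fix v assume v: "v \<in> set ws"
      have "v \<otimes> gen \<Gamma> u = gen \<Gamma> u \<otimes> v" if "u \<in> U" for u
        using that U UX by (intro perp_commute[OF perp_lk block_par[OF pl v]] gen_par) auto
      then show "v \<in> ?C" using v blocks_commute_prodl[OF pl v] blocks_carrier[OF b]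
        by (auto simp: mem_centraliser)
    qed
    fix x assume x: "x \<in> ?A \<inter> star U"
    then have xX: "x \<in> X" using lk_subset by blast
    have "gen \<Gamma> x \<otimes> prodl ws = prodl ws \<otimes> gen \<Gamma> x"
      using x perp_commute[OF perp_sym[OF perp_lk] gen_par[OF xX] supp_par[OF wc]] by simp
    moreover have "gen \<Gamma> x \<otimes> gen \<Gamma> u = gen \<Gamma> u \<otimes> gen \<Gamma> x" if "u \<in> U" for u
      using x that UX xX commute_gen_iff[of u "gen \<Gamma> x"]
      by (auto simp: star_def gen_carrier gen_supp)
    ultimately show "gen \<Gamma> x \<in> ?C" using xX gen_carrier by (simp add: mem_centraliser)
  qed
  show "?C \<subseteq> ?Q"
  proof
    fix g assume g: "g \<in> ?C"
    then have gc: "g \<in> carrier G" and gw: "g \<otimes> prodl ws = prodl ws \<otimes> g"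
      and gu: "\<And>u. u \<in> U \<Longrightarrow> g \<otimes> gen \<Gamma> u = gen \<Gamma> u \<otimes> g" by (auto simp: mem_centraliser)
    have AX: "?A \<inter> star U \<subseteq> X" using lk_subset by blast
    define r where "r = ret ?A g"
    have r: "r \<in> par ?A" "r \<in> carrier G" using gc ret_par' by (auto simp: r_def)
    have "r \<otimes> gen \<Gamma> u = gen \<Gamma> u \<otimes> r" if u: "u \<in> U" for u
    proof -
      have "gen \<Gamma> u \<in> par ?A" "gen \<Gamma> u \<in> carrier G" using u U UX gen_par gen_carrier by blast+
      then show ?thesis
        using gu[OF u] ret_mult[OF gc, of "gen \<Gamma> u" ?A] ret_mult[of "gen \<Gamma> u" g ?A] gc ret_id
        by (simp add: r_def)
    qed
    then have "supp r \<subseteq> star U" using commute_gens_iff[OF UX r(2)] by blast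
    then have "r \<in> par (?A \<inter> star U)" using r by (simp add: par_def)
    then have "r \<in> ?Q" using par_subset_qp[OF b AX] by blast
    then show "g \<in> ?Q" unfolding r_def
      using mem_qp by (intro centraliser_blocks[OF b root gc gw subgroup_qp[OF b AX]]) auto
  qed
qed

lemma standard_form_iff:
  "standard_form \<Gamma> Q w ws Y \<longleftrightarrow> blocks ws \<and> w = prodl ws \<and> (\<forall>v\<in>set ws. root_element G v)
    \<and> Y \<subseteq> star (supp w) \<and> Q = qp_subgroup \<Gamma> ws Y \<and> (\<forall>v\<in>set ws. 2 \<le> card (supp v))"
  by (auto simp: standard_form_def qp_data_iff)

lemma block_nonempty: "blocks ws \<Longrightarrow> v \<in> set ws \<Longrightarrow> supp v \<noteq> {}"
  using supp_empty_iff by (auto simp: blocks_def)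

text \<open>Blocks with one-letter support are generated by a generator, which moves to \<open>Z\<close>.\<close>

lemma standard_form_ex:
  assumes "canonical_quasiparabolic \<Gamma> Q" shows "\<exists>w ws Y. standard_form \<Gamma> Q w ws Y"
proof -
  obtain ws Z where b: "blocks ws" and root: "\<And>v. v \<in> set ws \<Longrightarrow> root_element G v"
    and Z: "Z \<subseteq> star (supp (prodl ws))" and Q: "Q = qp_subgroup \<Gamma> ws Z"
    using assms by (auto simp: canonical_quasiparabolic_def qp_data_iff)
  have pl: "perp_list ws" using b by (rule blocks_perp_list)
  define ws' where "ws' = filter (\<lambda>v. 2 \<le> card (supp v)) ws"
  define Y where "Y = Z \<union> {x. \<exists>v\<in>set ws. supp v = {x}}"
  have sub: "set ws' \<subseteq> set ws" by (auto simp: ws'_def)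
  have b': "blocks ws'" using b perp_list_filter by (auto simp: blocks_def ws'_def)
  have s: "supp (prodl ws) = \<Union>(supp ` set ws)" "supp (prodl ws') = \<Union>(supp ` set ws')"
    using perp_list_prodl pl blocks_perp_list[OF b'] by auto
  have ZX: "Z \<subseteq> X" using Z by (auto simp: star_def)
  have "x \<in> X" if "v \<in> set ws" "supp v = {x}" for v x
    using supp_subset[of v] that blocks_carrier[OF b] by auto
  then have YX: "Y \<subseteq> X" using ZX by (auto simp: Y_def)
  have "Y \<subseteq> star (supp (prodl ws'))"
  proof
    fix x assume x: "x \<in> Y"
    have "x = u \<or> adj x u" if u: "u \<in> supp (prodl ws')" for u
    proof (cases "x \<in> Z")
      case True
      moreover have "u \<in> supp (prodl ws)" using u s sub by auto
      ultimately show ?thesis using Z unfolding star_def by blast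
    next
      case False
      then obtain v where v: "v \<in> set ws" "supp v = {x}" using x by (auto simp: Y_def)
      obtain v' where v': "v' \<in> set ws'" "u \<in> supp v'" using u s by blast
      have "v \<noteq> v'" using v v' by (auto simp: ws'_def)
      then have "perp (supp v) (supp v')" using perp_list_pairwise[OF pl v(1)] v' sub by blast
      then show ?thesis using v v' by (simp add: perp_def)
    qed
    then show "x \<in> star (supp (prodl ws'))" using x YX by (auto simp: star_def)
  qed
  moreover have "Q = qp_subgroup \<Gamma> ws' Y"
  proof
    show "Q \<subseteq> qp_subgroup \<Gamma> ws' Y" unfolding Q
    proof (rule qp_subset[OF subgroup_qp[OF b' YX]])
      show "set ws \<subseteq> qp_subgroup \<Gamma> ws' Y"
      proof
        fix v assume v: "v \<in> set ws"
        have vc: "v \<in> carrier G" using v blocks_carrier[OF b] by blast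
        show "v \<in> qp_subgroup \<Gamma> ws' Y"
        proof (cases "2 \<le> card (supp v)")
          case True
          then show ?thesis using v by (intro mem_qp) (simp add: ws'_def)
        next
          case False
          have "0 < card (supp v)" using block_nonempty[OF b v] finite_supp[OF vc] by (simp add: card_gt_0_iff)
          then have "card (supp v) = 1" using False by simp
          then obtain x where "supp v = {x}" by (rule card_1_singletonE)
          then have "v \<in> par Y" using v vc by (auto simp: par_def Y_def)
          then show ?thesis using par_subset_qp[OF b' YX] by blast
        qed
      qed
      show "gen \<Gamma> x \<in> qp_subgroup \<Gamma> ws' Y" if "x \<in> Z" for x
        using that par_subset_qp[OF b' YX] gen_par[of x Y] ZX by (auto simp: Y_def)
    qed
    show "qp_subgroup \<Gamma> ws' Y \<subseteq> Q" unfolding Q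
    proof (rule qp_subset[OF subgroup_qp[OF b ZX]])
      show "set ws' \<subseteq> qp_subgroup \<Gamma> ws Z" using sub mem_qp by blast
      fix x assume x: "x \<in> Y"
      then have xX: "x \<in> X" using YX by blast
      show "gen \<Gamma> x \<in> qp_subgroup \<Gamma> ws Z"
      proof (cases "x \<in> Z")
        case True
        then show ?thesis using par_subset_qp[OF b ZX] gen_par[OF xX] by blast
      next
        case False
        then obtain v where v: "v \<in> set ws" "supp v = {x}" using x by (auto simp: Y_def)
        have vp: "cyc v" "v \<noteq> \<one>" "conn (supp v)" using b v(1) by (auto simp: blocks_def)
        have "v \<otimes> gen \<Gamma> x = gen \<Gamma> x \<otimes> v" using commute_gen_iff[OF xX cyc_carrier[OF vp(1)]] v(2) by simp
        then obtain j :: int where "gen \<Gamma> x = v [^] j"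
          using centraliser_root[OF vp root[OF v(1)], of "gen \<Gamma> x"] gen_par[OF xX] v(2) by auto
        then show ?thesis using subgroup_int_pow_closed[OF subgroup_qp[OF b ZX] mem_qp[OF v(1)]] by simp
      qed
    qed
  qed
  ultimately have "standard_form \<Gamma> Q (prodl ws') ws' Y"
    using b' root sub by (auto simp: standard_form_iff ws'_def)
  then show ?thesis by blast
qed

text \<open>In standard form no letter of \<open>w\<close> commutes with all of \<open>w\<close>: it has a neighbour in its
  block, which is connected and has another element.\<close>

lemma star_minus_blocks:
  assumes b: "blocks ws" and card: "\<And>v. v \<in> set ws \<Longrightarrow> 2 \<le> card (supp v)"
  shows "star (supp (prodl ws)) = lk (supp (prodl ws))"
proof -
  have "x \<notin> supp (prodl ws)" if x: "x \<in> star (supp (prodl ws))" for x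
  proof
    assume "x \<in> supp (prodl ws)"
    then obtain v where v: "v \<in> set ws" "x \<in> supp v"
      using perp_list_prodl[OF blocks_perp_list[OF b]] by blast
    have "y = x" if "y \<in> supp v" for y
    proof -
      have "(x, y) \<in> {(a, b). a \<in> supp v \<and> b \<in> supp v \<and> \<not> adj a b}\<^sup>*"
        using b v that by (auto simp: blocks_def conn_def)
      then show "y = x"
      proof (induction rule: rtrancl_induct)
        case (step y z)
        then have "z \<in> supp (prodl ws)" using supp_block[OF blocks_perp_list[OF b] v(1)] by auto
        then show ?case using step x by (auto simp: star_def)
      qed simp
    qed
    then have "supp v \<subseteq> {x}" by blast
    then have "card (supp v) \<le> 1" using card_mono[of "{x}" "supp v"] by simp
    then show False using card[OF v(1)] by simp
  qed
  then show ?thesis using orth_minus[of "supp (prodl ws)"] by (auto simp: orth_eq_star)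
qed

text \<open>The factor \<open>Y\<close> equals its double complement in \<open>\<Gamma>\<^sub>w\<close>.\<close>

lemma closed_of_centraliser:
  assumes S: "S \<subseteq> carrier G" and Q: "Q = centraliser G S" and sf: "standard_form \<Gamma> Q w ws Y"
  shows "Y \<in> closed_sets \<Gamma> \<and> Y \<in> closed_sets (\<Gamma> \<restriction> (orth \<Gamma> (supp w) - supp w))"
proof -
  define A where "A = lk (supp w)"
  have b: "blocks ws" and w: "w = prodl ws" and root: "\<And>v. v \<in> set ws \<Longrightarrow> root_element G v"
    and YA: "Y \<subseteq> A" and QY: "Q = qp_subgroup \<Gamma> ws Y" and sA: "star (supp w) = A"
    using sf star_minus_blocks[of ws] by (auto simp: standard_form_iff A_def)
  have pl: "perp_list ws" using b by (rule blocks_perp_list)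
  have wc: "w \<in> carrier G" using perp_list_prodl[OF pl] w by simp
  have AX: "A \<subseteq> X" by (simp add: A_def lk_subset)
  have YX: "Y \<subseteq> X" using YA AX by blast
  define U where "U = A \<inter> star Y"
  have "Y = A \<inter> star U"
  proof
    show "Y \<subseteq> A \<inter> star U" using YA star_galois[OF YX] by (simp add: U_def)
    show "A \<inter> star U \<subseteq> Y"
    proof
      fix y assume y: "y \<in> A \<inter> star U"
      then have yX: "y \<in> X" using AX by blast
      then have yc: "gen \<Gamma> y \<in> carrier G" by (rule gen_carrier)
      have yA: "gen \<Gamma> y \<in> par A" using y yX gen_par by blast
      have "s \<otimes> gen \<Gamma> y = gen \<Gamma> y \<otimes> s" if s: "s \<in> S" for s
      proof -
        have sc: "s \<in> carrier G" using s S by blast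
        have sQ: "s \<otimes> q = q \<otimes> s" if "q \<in> Q" for q
          using that s Q by (simp add: mem_centraliser)
        have "w \<in> Q" unfolding w QY using mem_qp by (intro prodl_mem subgroup_qp[OF b YX]) blast
        then have sw: "s \<otimes> prodl ws = prodl ws \<otimes> s" using sQ w by simp
        define r where "r = ret A s"
        have r: "r \<in> par A" "r \<in> carrier G" using sc ret_par' by (auto simp: r_def)
        have "r \<otimes> gen \<Gamma> z = gen \<Gamma> z \<otimes> r" if z: "z \<in> Y" for z
        proof -
          have zc: "gen \<Gamma> z \<in> par A" "gen \<Gamma> z \<in> carrier G"
            using z YA AX gen_par gen_carrier by blast+
          have "gen \<Gamma> z \<in> Q" using par_subset_qp[OF b YX] gen_par[of z Y] z YX QY by blast
          then show ?thesis
            using sQ ret_mult[OF sc zc(2), of A] ret_mult[OF zc(2) sc, of A] zc ret_id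
            by (simp add: r_def)
        qed
        then have "supp r \<subseteq> star Y" using commute_gens_iff[OF YX r(2)] by blast
        then have "supp r \<subseteq> U" using r by (auto simp: U_def par_def)
        have "u = y \<or> adj u y" if "u \<in> supp r" for u
        proof -
          have "u \<in> U" using that \<open>supp r \<subseteq> U\<close> by blast
          then have "y = u \<or> adj y u" using y by (simp add: star_def)
          then show ?thesis using adj_sym[of y u] by metis
        qed
        then have ry: "r \<otimes> gen \<Gamma> y = gen \<Gamma> y \<otimes> r" using commute_gen_iff[OF yX r(2)] by blast
        \<comment> \<open>The blocks commute with \<open>y\<close>, and the component \<open>r\<close> of \<open>s\<close> in \<open>par A\<close> commutes with \<open>Y\<close>
          and therefore lives on \<open>U\<close>, so it commutes with \<open>y\<close> as well.\<close>
        have "s \<in> centraliser G {gen \<Gamma> y}"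
        proof (rule centraliser_blocks[OF b root sc sw])
          show "subgroup (centraliser G {gen \<Gamma> y}) G" using yc by (intro subgroup_centraliser) simp
          show "set ws \<subseteq> centraliser G {gen \<Gamma> y}"
            using block_par[OF pl] perp_commute[OF perp_lk _ yA[unfolded A_def w]] blocks_carrier[OF b]
            by (auto simp: mem_centraliser)
          show "ret (lk (supp (prodl ws))) s \<in> centraliser G {gen \<Gamma> y}"
            using ry r by (simp add: mem_centraliser r_def A_def w)
        qed
        then show ?thesis by (simp add: mem_centraliser)
      qed
      then have yQ: "gen \<Gamma> y \<in> Q" using yc Q by (simp add: mem_centraliser)
      let ?K = "{g \<in> carrier G. ret A g \<in> par Y}"
      have "subgroup ?K G"
      proof (rule subgroupI)
        show "?K \<noteq> {}" using par_one by (auto intro!: exI[of _ \<one>])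
        interpret h: group_hom G G "ret A" using ret_hom by unfold_locales
        show "inv h \<in> ?K" if "h \<in> ?K" for h using that par_inv by auto
        show "h \<otimes> k \<in> ?K" if "h \<in> ?K" "k \<in> ?K" for h k using that par_mult by auto
      qed auto
      moreover have "set ws \<subseteq> ?K"
      proof
        fix v assume v: "v \<in> set ws"
        have "ret A v = \<one>"
          using block_par[OF pl v] perp_disjoint[OF perp_lk] unfolding A_def w
          by (intro ret_trivial) auto
        then show "v \<in> ?K" using v blocks_carrier[OF b] par_one by auto
      qed
      moreover have "gen \<Gamma> z \<in> ?K" if "z \<in> Y" for z
      proof -
        have z: "z \<in> X" "z \<in> A" using that YA YX by auto
        then show ?thesis
          using ret_id[OF gen_par[OF z]] gen_par[OF z(1) that] gen_carrier by simp
      qed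
      ultimately have "Q \<subseteq> ?K" unfolding QY by (intro qp_subset)
      then have "gen \<Gamma> y \<in> par Y" using yQ ret_id[OF yA] by auto
      then show "y \<in> Y" using gen_supp[OF yX] by (simp add: par_def)
    qed
  qed
  moreover have UA: "U \<subseteq> A" by (simp add: U_def)
  ultimately have 1: "Y = orth (\<Gamma> \<restriction> A) U" using orth_induced[OF AX UA] by simp
  have "Y = star (supp w \<union> U)" using \<open>Y = A \<inter> star U\<close> unfolding sA[symmetric] by (auto simp: star_def)
  then have 2: "Y = orth \<Gamma> (supp w \<union> U)" by (simp add: orth_eq_star)
  have "supp w \<union> U \<subseteq> X" using supp_subset[OF wc] UA AX by blast
  then have "Y \<in> closed_sets \<Gamma>" using 2 unfolding closed_sets_def by blast
  moreover have "Y \<in> closed_sets (\<Gamma> \<restriction> A)" using 1 UA unfolding closed_sets_def by auto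
  ultimately show ?thesis by (simp add: orth_minus A_def)
qed

lemma centraliser_of_closed:
  assumes sf: "standard_form \<Gamma> Q w ws Y"
    and cl: "Y \<in> closed_sets (\<Gamma> \<restriction> (orth \<Gamma> (supp w) - supp w))"
  shows "\<exists>S\<subseteq>carrier G. Q = centraliser G S"
proof -
  have b: "blocks ws" and w: "w = prodl ws" and root: "\<And>v. v \<in> set ws \<Longrightarrow> root_element G v"
    and QY: "Q = qp_subgroup \<Gamma> ws Y" using sf by (auto simp: standard_form_iff)
  let ?A = "lk (supp (prodl ws))"
  obtain U where U: "U \<subseteq> ?A" "Y = orth (\<Gamma> \<restriction> ?A) U"
    using cl by (auto simp: closed_sets_def orth_minus w)
  then have "Y = ?A \<inter> star U" using orth_induced[OF lk_subset] by simp
  then have "Q = centraliser G (insert (prodl ws) (gen \<Gamma> ` U))"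
    using qp_eq_centraliser[OF b root U(1)] QY by simp
  moreover have "insert (prodl ws) (gen \<Gamma> ` U) \<subseteq> carrier G"
    using perp_list_prodl[OF blocks_perp_list[OF b]] U(1) lk_subset gen_carrier by blast
  ultimately show ?thesis by blast
qed


section \<open>Centralisers are conjugate to quasiparabolic subgroups\<close>

lemma wf_noncomm: "wf_digraph (with_proj (noncomm_graph \<Gamma>))"
  by unfold_locales (auto simp: noncomm_arcs, auto simp: noncomm_graph_def)

text \<open>The decomposition of a set of generators into its components in the non-commutation
  graph.\<close>

lemma components_ex:
  assumes "I \<subseteq> X"
  obtains Js where "distinct Js" "\<Union>(set Js) = I"
    "\<And>J. J \<in> set Js \<Longrightarrow> J \<noteq> {} \<and> conn J \<and> perp J (I - J)"
    "\<And>J J'. J \<in> set Js \<Longrightarrow> J' \<in> set Js \<Longrightarrow> J \<noteq> J' \<Longrightarrow> perp J J'"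
proof -
  let ?D = "with_proj (noncomm_graph \<Gamma>) \<restriction> I"
  define F where "F = pre_digraph.sccs_verts ?D"
  have F: "J \<in> F \<longleftrightarrow> J \<noteq> {} \<and> J \<subseteq> I \<and> conn J \<and> perp J (I - J)" for J
    unfolding F_def by (rule sccs_noncomm_iff[OF assms])
  interpret D: wf_digraph ?D using wf_noncomm by (rule wf_digraph.wellformed_induce_subgraph)
  have cover: "\<exists>J\<in>F. x \<in> J" if "x \<in> I" for x
    using that D.scc_of_in_sccs_verts[of x] D.in_scc_of_self[of x] unfolding F_def by auto
  have "F \<subseteq> Pow I" using F by blast
  then have "finite F" using finite_subset[OF assms finite_X] finite_subset by blast
  then obtain Js where Js: "set Js = F" "distinct Js" using finite_distinct_list by blast
  have pp: "perp J J'" if "J \<in> F" "J' \<in> F" "J \<noteq> J'" for J J'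
  proof -
    have "J \<inter> J' = {}"
    proof (rule ccontr)
      assume "\<not> ?thesis"
      then obtain x where x: "x \<in> J" "x \<in> J'" by blast
      have "J \<subseteq> J'" "J' \<subseteq> J" using conn_subset_closed[of _ I] F that x by blast+
      then show False using that by blast
    qed
    then have "J' \<subseteq> I - J" using F that by blast
    then show ?thesis using F that unfolding perp_def by blast
  qed
  have "\<Union>(set Js) = I" using Js cover F by blast
  then show ?thesis using that[of Js] Js F pp by blast
qed

lemma ev_left_cancel_letter:
  assumes "u \<in> words X" "reduced u" "ldiv a u"
  shows "len (ev [flip a] \<otimes> ev u) < len (ev u)"
proof -
  have a: "fst a \<in> X" using assms ldiv_set by (fastforce simp: words_iff)
  have r: "remove1 a u \<in> words X" using assms by (simp add: remove1_words)
  have "ev [flip a] \<otimes> ev u = ev (remove1 a u)"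
    using ev_remove1[OF assms(1,3)] ev_flip[of "flip a"] a r by (simp add: m_assoc[symmetric])
  then show ?thesis
    using len_ev_le[OF r] len_ev[OF assms(1,2)] teq_length[OF teq_remove1[OF assms(3)]] by simp
qed

lemma ev_right_cancel_letter:
  assumes "u \<in> words X" "reduced u" "ldiv a (rev u)"
  shows "len (ev u \<otimes> ev [flip a]) < len (ev u)"
proof -
  define r where "r = rev (remove1 a (rev u))"
  have u: "u \<sim> r @ [a]" using teq_rev[OF teq_remove1[OF assms(3)]] by (simp add: r_def)
  then have w: "r \<in> words X" "fst a \<in> X" using teq_words[OF u] assms(1) by auto
  have "ev u = ev r \<otimes> ev [a]" using ev_teq[OF u assms(1)] w ev_mult[of r "[a]"] by simp
  then have "ev u \<otimes> ev [flip a] = ev r" using w ev_flip[of a] by (simp add: m_assoc)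
  then show ?thesis using len_ev_le[OF w(1)] len_ev[OF assms(1,2)] teq_length[OF u] by simp
qed

text \<open>If \<open>T\<close> lies in no conjugate of a smaller parabolic subgroup than \<open>par Z\<close>, every
  element that commutes with \<open>T\<close> is a product of an element of \<open>par Z\<close> and one that
  commutes with \<open>par Z\<close>: the part of shortest length in its double coset.\<close>

lemma centraliser_minimal_parabolic:
  assumes T: "T \<subseteq> par Z" and Z: "Z \<subseteq> X"
    and min: "\<And>g Z'. g \<in> carrier G \<Longrightarrow> Z' \<subseteq> X \<Longrightarrow> cj g ` T \<subseteq> par Z' \<Longrightarrow> card Z \<le> card Z'"
    and x: "x \<in> centraliser G T"
  shows "x \<in> par (Z \<union> lk Z)"
proof -
  have xc [simp]: "x \<in> carrier G" using x by (simp add: mem_centraliser)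
  define P where "P = (\<lambda>(a, b). a \<in> par Z \<and> b \<in> par Z)"
  have "P (\<one>, \<one>)" by (simp add: P_def par_one)
  then obtain ab where "P ab" and least: "\<And>cd. P cd \<Longrightarrow> len (fst ab \<otimes> x \<otimes> snd ab) \<le> len (fst cd \<otimes> x \<otimes> snd cd)"
    using ex_has_least_nat[of P "(\<one>, \<one>)" "\<lambda>cd. len (fst cd \<otimes> x \<otimes> snd cd)"] by blast
  then obtain a b where ab: "a \<in> par Z" "b \<in> par Z"
    and least': "\<And>a' b'. a' \<in> par Z \<Longrightarrow> b' \<in> par Z \<Longrightarrow> len (a \<otimes> x \<otimes> b) \<le> len (a' \<otimes> x \<otimes> b')"
    by (cases ab) (auto simp: P_def)
  have [simp]: "a \<in> carrier G" "b \<in> carrier G" using ab par_carrier by auto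
  define d where "d = a \<otimes> x \<otimes> b"
  have dc [simp]: "d \<in> carrier G" by (simp add: d_def)
  obtain p where p: "p \<in> words X" "reduced p" "d = ev p" using nf_ex[OF dc] by blast
  have letter: "ev [e] \<in> par Z" if "fst e \<in> Z" for e
    using that Z by (intro par_ev) auto
  have left: "fst e \<notin> Z" if e: "ldiv e p" for e
  proof
    assume "fst e \<in> Z"
    then have f: "ev [flip e] \<in> par Z" "ev [flip e] \<in> carrier G" using letter[of "flip e"] par_carrier by auto
    have "len (ev [flip e] \<otimes> d) < len d" using ev_left_cancel_letter[OF p(1,2) e] p(3) by simp
    moreover have "ev [flip e] \<otimes> d = (ev [flip e] \<otimes> a) \<otimes> x \<otimes> b" using f by (simp add: d_def m_assoc)
    ultimately show False using least'[OF par_mult[OF f(1) ab(1)] ab(2)] by (simp add: d_def)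
  qed
  have right: "fst e \<notin> Z" if e: "ldiv e (rev p)" for e
  proof
    assume "fst e \<in> Z"
    then have f: "ev [flip e] \<in> par Z" "ev [flip e] \<in> carrier G" using letter[of "flip e"] par_carrier by auto
    have "len (d \<otimes> ev [flip e]) < len d" using ev_right_cancel_letter[OF p(1,2) e] p(3) by simp
    moreover have "d \<otimes> ev [flip e] = a \<otimes> x \<otimes> (b \<otimes> ev [flip e])" using f by (simp add: d_def m_assoc)
    ultimately show False using least'[OF ab(1) par_mult[OF ab(2) f(1)]] by (simp add: d_def)
  qed
  \<comment> \<open>The conjugate of \<open>T\<close> by \<open>inv a\<close> turns out to live on \<open>Z'\<close>, so minimality of \<open>Z\<close> forces \<open>Z' = Z\<close>.\<close>
  define Z' where "Z' = Z \<inter> lk (supp d)"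
  have "cj (inv a) t \<in> par Z'" if t: "t \<in> T" for t
  proof -
    have tZ: "t \<in> par Z" using t T by blast
    have tc [simp]: "t \<in> carrier G" using tZ par_carrier by blast
    have xt: "x \<otimes> t = t \<otimes> x" using x t by (simp add: mem_centraliser)
    define s1 s2 where "s1 = a \<otimes> t \<otimes> inv a" and "s2 = inv b \<otimes> t \<otimes> b"
    have s: "s1 \<in> par Z" "s2 \<in> par Z" using ab tZ par_mult par_inv by (auto simp: s1_def s2_def)
    obtain u where u: "u \<in> words X" "reduced u" "fst ` set u \<subseteq> Z" "s1 = ev u" using par_ex[OF s(1)] by blast
    obtain v where v: "v \<in> words X" "reduced v" "fst ` set v \<subseteq> Z" "s2 = ev v" using par_ex[OF s(2)] by blast
    have "inv a \<otimes> (a \<otimes> (x \<otimes> b)) = x \<otimes> b" "b \<otimes> (inv b \<otimes> (t \<otimes> b)) = t \<otimes> b"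
      by (simp_all add: m_assoc[symmetric])
    then have "s1 \<otimes> d = a \<otimes> (t \<otimes> x) \<otimes> b" "d \<otimes> s2 = a \<otimes> (x \<otimes> t) \<otimes> b"
      by (simp_all add: s1_def s2_def d_def m_assoc)
    then have "ev (u @ p) = ev (p @ v)" using xt u v p by (simp add: ev_mult[symmetric])
    moreover have "reduced (u @ p)"
      using u p left by (intro reduced_append_disjoint) blast+
    moreover have "reduced (p @ v)"
    proof (rule ccontr)
      assume "\<not> reduced (p @ v)"
      then obtain e where "ldiv e v" "ldiv (flip e) (rev p)" using not_reduced_append p(2) v(2) by blast
      then show False using right[of "flip e"] v(3) ldiv_set by fastforce
    qed
    ultimately have "u @ p \<sim> p @ v" using u p v by (intro reduced_unique) auto
    then have "\<forall>a\<in>set u. \<forall>b\<in>set p. adj (fst a) (fst b)"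
      using left u(3) by (intro levi_disjoint[THEN conjunct2]) blast+
    moreover have "fst ` set u \<subseteq> X" using u(3) Z by blast
    ultimately have "fst ` set u \<subseteq> Z'" using u(3) p(3) supp_ev[OF p(1,2)] by (auto simp: Z'_def lk_def)
    then have "s1 \<in> par Z'" using par_ev u by simp
    then show ?thesis by (simp add: cj_def s1_def)
  qed
  then have "card Z \<le> card Z'" using min[of "inv a" Z'] Z by (auto simp: Z'_def)
  moreover have "finite Z" using Z finite_X finite_subset by blast
  ultimately have "Z' = Z" by (intro card_seteq) (auto simp: Z'_def)
  then have "supp d \<subseteq> lk Z" using supp_subset[OF dc] adj_sym unfolding Z'_def lk_def by blast
  then have "d \<in> par (Z \<union> lk Z)" by (auto simp: par_def)
  moreover have "inv a \<in> par (Z \<union> lk Z)" "inv b \<in> par (Z \<union> lk Z)"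
    using par_inv[OF ab(1)] par_inv[OF ab(2)] par_mono by blast+
  moreover have "inv a \<otimes> (a \<otimes> (x \<otimes> b)) = x \<otimes> b" by (simp add: m_assoc[symmetric])
  then have "inv a \<otimes> d \<otimes> inv b = x" by (simp add: d_def m_assoc)
  ultimately show ?thesis using par_mult by metis
qed

text \<open>The structure of a centraliser, after a suitable conjugation: \<open>Z\<close> is minimal among all
  conjugates of \<open>T\<close>, and \<open>c\<close> has the largest support among the cyclically minimal elements
  of \<open>par Z\<close> that centralise a conjugate of \<open>T\<close> by an element of \<open>par Z\<close>.\<close>

lemma centraliser_canonical:
  assumes T: "T \<subseteq> par Z" and Z: "Z \<subseteq> X"
    and min: "\<And>g Z'. g \<in> carrier G \<Longrightarrow> Z' \<subseteq> X \<Longrightarrow> cj g ` T \<subseteq> par Z' \<Longrightarrow> card Z \<le> card Z'"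
    and c: "c \<in> par Z" "cyc c" "c \<in> centraliser G T"
    and max: "\<And>h c'. h \<in> par Z \<Longrightarrow> c' \<in> par Z \<Longrightarrow> cyc c' \<Longrightarrow> c' \<in> centraliser G (cj h ` T) \<Longrightarrow>
      card (supp c') \<le> card (supp c)"
  shows "canonical_quasiparabolic \<Gamma> (centraliser G T)"
proof -
  define I where "I = supp c"
  have finZ: "finite Z" using Z finite_X finite_subset by blast
  have Tc: "T \<subseteq> carrier G" using T par_carrier by blast
  have cc [simp]: "c \<in> carrier G" using c(2) by simp
  have min1: "card Z \<le> card Z'" if "T \<subseteq> par Z'" "Z' \<subseteq> X" for Z'
    using min[of \<one> Z'] that cj_image_one[OF Tc] by simp
  have IZ: "I \<subseteq> Z" using c(1) by (simp add: I_def par_def)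
  then have IX: "I \<subseteq> X" using Z by blast
  have tc: "c \<otimes> t = t \<otimes> c" if "t \<in> T" for t using c(3) that by (simp add: mem_centraliser)
  have tI: "t \<in> par (I \<union> lk I)" if t: "t \<in> T" for t
    using centraliser_supp[OF c(2), of t] t Tc tc[OF t] by (auto simp: I_def)
  have "T \<subseteq> par (Z \<inter> (I \<union> lk I))" using T tI by (auto simp: par_def)
  then have "card Z \<le> card (Z \<inter> (I \<union> lk I))" using min1 Z by blast
  then have "Z \<inter> (I \<union> lk I) = Z" using finZ by (intro card_seteq) auto
  then have ZI: "Z \<subseteq> I \<union> lk I" by blast
  \<comment> \<open>Here \<open>Z\<close> is the disjoint union of \<open>I\<close> and \<open>B\<close>, and \<open>I\<close>, \<open>B\<close>, \<open>D\<close> commute pairwise.\<close>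
  define B D where "B = Z - I" and "D = lk Z"
  have Bl: "B \<subseteq> lk I" using ZI by (auto simp: B_def)
  have ZIB: "Z = I \<union> B" using IZ by (auto simp: B_def)
  have pIB: "perp I B" using perp_lk Bl unfolding perp_def by blast
  have pZD: "perp Z D" by (simp add: D_def perp_lk)
  have pBD: "perp B D" using pZD by (auto simp: perp_def B_def)
  have pI: "perp I (B \<union> D)" using pIB pZD IZ by (auto simp: perp_def)
  have DX: "D \<subseteq> X" by (simp add: D_def lk_subset)
  obtain Js where Js: "distinct Js" "\<Union>(set Js) = I"
    "\<And>J. J \<in> set Js \<Longrightarrow> J \<noteq> {} \<and> conn J \<and> perp J (I - J)"
    "\<And>J J'. J \<in> set Js \<Longrightarrow> J' \<in> set Js \<Longrightarrow> J \<noteq> J' \<Longrightarrow> perp J J'"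
    using components_ex[OF IX] by blast
  have "\<exists>v. v \<in> par J \<and> supp v = J \<and> cyc v \<and> root_element G v \<and>
      (\<forall>g. g \<in> par J \<longrightarrow> g \<otimes> ret J c = ret J c \<otimes> g \<longrightarrow> (\<exists>j::int. g = v [^] j))" if J: "J \<in> set Js" for J
  proof -
    have pJ: "perp J (I - J)" using Js(3)[OF J] by blast
    have JI: "J \<subseteq> I" using J Js(2) by blast
    define w where "w = ret J c"
    have w: "cyc w" using cyc_ret[OF c(2)] pJ by (simp add: w_def I_def)
    have wJ: "w \<in> par J" using ret_par' by (simp add: w_def)
    have "c \<in> par (J \<union> (I - J))" using supp_par[OF cc] by (rule par_mono) (auto simp: I_def)
    then have "c = w \<otimes> ret (I - J) c" unfolding w_def by (intro ret_split[OF pJ])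
    then have "I = supp w \<union> supp (ret (I - J) c)"
      using perp_len_supp(2)[OF pJ wJ ret_par'[OF cc]] I_def by simp
    moreover have "supp (ret (I - J) c) \<subseteq> I - J" using ret_par'[OF cc, of "I - J"] by (simp add: par_def)
    ultimately have sw: "supp w = J" using wJ JI by (auto simp: par_def)
    have "w \<noteq> \<one>" using sw Js(3)[OF J] supp_one by metis
    moreover have "conn (supp w)" using sw Js(3)[OF J] by simp
    ultimately obtain v and k :: nat where v: "v \<in> par (supp w)" "cyc v" "0 < k" "w = v [^] k" "root_element G v"
      "\<And>c. c \<in> par (supp w) \<Longrightarrow> c \<otimes> w = w \<otimes> c \<Longrightarrow> \<exists>j::int. c = v [^] j"
      using centraliser_connected[OF w] by metis
    have "supp v = J" using supp_cyc_pow[OF v(2,3)] v(4) sw by simp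
    then show ?thesis using v sw w_def by (intro exI[of _ v]) auto
  qed
  then obtain r where r: "\<And>J. J \<in> set Js \<Longrightarrow> r J \<in> par J \<and> supp (r J) = J \<and> cyc (r J) \<and> root_element G (r J)"
    and rcent: "\<And>J g. J \<in> set Js \<Longrightarrow> g \<in> par J \<Longrightarrow> g \<otimes> ret J c = ret J c \<otimes> g \<Longrightarrow> \<exists>j::int. g = r J [^] j"
    by metis
  define ws where "ws = map r Js"
  have rc: "r J \<in> carrier G" if "J \<in> set Js" for J using r[OF that] by simp
  have "sorted_wrt (\<lambda>g h. perp (supp g) (supp h)) ws"
    unfolding ws_def sorted_wrt_iff_nth_less
  proof (intro allI impI)
    fix i j assume ij: "i < j" "j < length (map r Js)"
    then have "Js ! i \<noteq> Js ! j" using Js(1) by (simp add: nth_eq_iff_index_eq)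
    then show "perp (supp (map r Js ! i)) (supp (map r Js ! j))" using ij r Js(4) by simp
  qed
  then have pl: "perp_list ws" using rc by (auto simp: perp_list_def ws_def)
  have b: "blocks ws" unfolding blocks_def
  proof (intro conjI ballI pl)
    fix v assume "v \<in> set ws"
    then obtain J where J: "J \<in> set Js" "v = r J" by (auto simp: ws_def)
    then show "cyc v" "conn (supp v)" using r[OF J(1)] Js(3)[OF J(1)] by auto
    show "v \<noteq> \<one>" using r[OF J(1)] Js(3)[OF J(1)] J(2) supp_one by metis
  qed
  have sI: "supp (prodl ws) = I" using perp_list_prodl[OF pl] r Js(2) by (simp add: ws_def)
  have "D \<subseteq> star I" using IZ by (auto simp: D_def lk_def star_def)
  then have qd: "qp_data \<Gamma> (prodl ws) ws D" using b r sI by (auto simp: qp_data_iff ws_def)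
  have Q: "subgroup (qp_subgroup \<Gamma> ws D) G" using b DX by (rule subgroup_qp)
  \<comment> \<open>The component on \<open>J\<close> of an element of \<open>T\<close> is a power of the root \<open>r J\<close>.\<close>
  have retT: "\<exists>j::int. ret J t = r J [^] j" if J: "J \<in> set Js" and t: "t \<in> T" for J t
  proof (rule rcent[OF J])
    have tcr: "t \<in> carrier G" using t Tc by blast
    then show "ret J t \<in> par J" by (rule ret_par')
    show "ret J t \<otimes> ret J c = ret J c \<otimes> ret J t"
      using tc[OF t] ret_mult[OF tcr cc, of J] ret_mult[OF cc tcr, of J] by simp
  qed
  have "qp_subgroup \<Gamma> ws D \<subseteq> centraliser G T"
  proof (rule qp_subset[OF subgroup_centraliser[OF Tc]])
    show "gen \<Gamma> x \<in> centraliser G T" if x: "x \<in> D" for x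
    proof -
      have xX: "x \<in> X" using x DX by blast
      have "t \<otimes> gen \<Gamma> x = gen \<Gamma> x \<otimes> t" if "t \<in> T" for t
        using perp_commute[OF pZD] gen_par[OF xX x] that T by blast
      then show ?thesis using gen_carrier[OF xX] by (simp add: mem_centraliser)
    qed
    show "set ws \<subseteq> centraliser G T"
    proof
      fix v assume "v \<in> set ws"
      then obtain J where J: "J \<in> set Js" "v = r J" by (auto simp: ws_def)
      have vJ: "v \<in> par J" "v \<in> carrier G" using J r rc by auto
      have JI: "J \<subseteq> I" using J Js(2) by blast
      have "t \<in> centraliser G {v}" if t: "t \<in> T" for t
      proof (rule mem_subgroup_blocks[OF pl])
        have tcr: "t \<in> carrier G" using t Tc by blast
        show "subgroup (centraliser G {v}) G" using vJ by (intro subgroup_centraliser) simp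
        show "perp (supp (prodl ws)) (lk I)" using sI perp_lk by simp
        show "t \<in> par (supp (prodl ws) \<union> lk I)" using tI[OF t] sI by simp
        have "perp J (lk I)" using perp_lk JI unfolding perp_def by blast
        then have "v \<otimes> ret (lk I) t = ret (lk I) t \<otimes> v"
          using perp_commute vJ ret_par'[OF tcr] by blast
        then show "ret (lk I) t \<in> centraliser G {v}" using tcr by (simp add: mem_centraliser)
        fix v' assume "v' \<in> set ws"
        then obtain J' where J': "J' \<in> set Js" "v' = r J'" by (auto simp: ws_def)
        have "ret J' t \<otimes> v = v \<otimes> ret J' t"
        proof (cases "J' = J")
          case True
          then obtain j :: int where "ret J' t = v [^] j" using retT[OF J(1) t] J(2) by blast
          then show ?thesis using vJ int_pow_mult[of v j 1] int_pow_mult[of v 1 j] by (simp add: add.commute)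
        next
          case False
          then show ?thesis using perp_commute[OF Js(4)[OF J'(1) J(1)]] ret_par'[OF tcr] vJ by blast
        qed
        then show "ret (supp v') t \<in> centraliser G {v}" using r[OF J'(1)] J' tcr by (simp add: mem_centraliser)
      qed
      then show "v \<in> centraliser G T" using vJ by (auto simp: mem_centraliser)
    qed
  qed
  moreover have "centraliser G T \<subseteq> qp_subgroup \<Gamma> ws D"
  proof
    fix g assume g: "g \<in> centraliser G T"
    then have gc [simp]: "g \<in> carrier G" and gt: "\<And>t. t \<in> T \<Longrightarrow> g \<otimes> t = t \<otimes> g"
      by (auto simp: mem_centraliser)
    have gZ: "g \<in> par (Z \<union> D)" unfolding D_def by (rule centraliser_minimal_parabolic[OF T Z min g])
    have comm: "ret J g \<otimes> ret J t = ret J t \<otimes> ret J g" if "t \<in> T" for J t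
      using gt[OF that] ret_mult[OF gc, of t J] ret_mult[of t g J] that Tc by auto
    \<comment> \<open>The component of \<open>g\<close> outside of the support of \<open>c\<close> would enlarge that support.\<close>
    have retB: "ret B g = \<one>"
    proof -
      define q where "q = ret B g"
      have q: "q \<in> par B" "q \<in> carrier G" using ret_par' by (auto simp: q_def)
      have "q \<in> centraliser G T" unfolding mem_centraliser
      proof (intro conjI ballI)
        fix t assume t: "t \<in> T"
        have tcr: "t \<in> carrier G" using t Tc by blast
        have "t \<in> par (I \<union> B)" using t T ZIB by auto
        then have ts: "t = ret I t \<otimes> ret B t" by (rule ret_split[OF pIB])
        have [simp]: "ret I t \<in> carrier G" "ret B t \<in> carrier G" using tcr by auto
        have 1: "q \<otimes> ret I t = ret I t \<otimes> q"
          using perp_commute[OF perp_sym[OF pIB] q(1) ret_par'[OF tcr]] .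
        have 2: "q \<otimes> ret B t = ret B t \<otimes> q" using comm[OF t] by (simp add: q_def)
        have "q \<otimes> (ret I t \<otimes> ret B t) = ret I t \<otimes> (q \<otimes> ret B t)"
          using 1 q by (simp add: m_assoc[symmetric])
        also have "\<dots> = (ret I t \<otimes> ret B t) \<otimes> q" using 2 q by (simp add: m_assoc)
        finally show "q \<otimes> t = t \<otimes> q" using ts by simp
      qed (rule q)
      then have cq: "c \<otimes> q \<in> centraliser G T"
        using c(3) subgroup.m_closed[OF subgroup_centraliser[OF Tc]] by blast
      obtain h where h: "h \<in> par B" "cyc (cj h q)" using conj_cyc[OF q(1)] by (auto simp: cj_def)
      have hc [simp]: "h \<in> carrier G" using h par_carrier by blast
      define q' where "q' = cj h q"
      have q'B: "q' \<in> par B" using h(1) q(1) unfolding q'_def cj_def by (intro par_mult par_inv)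
      have cI: "c \<in> par I" by (simp add: par_def I_def)
      have "inv h \<otimes> c = c \<otimes> inv h" using perp_commute[OF pIB cI par_inv[OF h(1)]] by simp
      then have "cj h c = c" by (simp add: cj_def m_assoc)
      then have "cj h (c \<otimes> q) = c \<otimes> q'" using q by (simp add: cj_mult q'_def)
      then have "c \<otimes> q' \<in> centraliser G (cj h ` T)"
        using cj_centraliser_subset[OF hc Tc] cq by (metis image_subset_iff)
      moreover have "c \<otimes> q' \<in> par Z"
        using c(1) par_mono[OF q'B, of Z] ZIB by (intro par_mult) auto
      moreover have "cyc (c \<otimes> q')" using cyc_perp_mult[OF pIB cI q'B c(2)] h(2) q'_def by simp
      moreover have "h \<in> par Z" using par_mono[OF h(1), of Z] ZIB by auto
      ultimately have "card (supp (c \<otimes> q')) \<le> card I" using max[of h "c \<otimes> q'"] by (simp add: I_def)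
      moreover have s: "supp (c \<otimes> q') = I \<union> supp q'" using perp_len_supp(2)[OF pIB cI q'B] I_def by simp
      moreover have "finite (supp (c \<otimes> q'))" using q'B par_carrier by (intro finite_supp) auto
      ultimately have "I = I \<union> supp q'" by (intro card_seteq) auto
      moreover have "supp q' \<inter> I = {}" using q'B by (auto simp: par_def B_def)
      ultimately have "supp q' = {}" by blast
      then have "q' = \<one>" using supp_empty_iff q'B par_carrier by blast
      moreover have "q = cj (inv h) q'" using q(2) cj_cj[of h "inv h" q] by (simp add: q'_def)
      ultimately show ?thesis by (simp add: q_def cj_def)
    qed
    show "g \<in> qp_subgroup \<Gamma> ws D"
    proof (rule mem_subgroup_blocks[OF pl _ _ Q])
      show "perp (supp (prodl ws)) (B \<union> D)" using pI sI by simp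
      show "g \<in> par (supp (prodl ws) \<union> (B \<union> D))" using gZ ZIB sI by (simp add: Un_assoc)
      have "ret (B \<union> D) g = ret B (ret (B \<union> D) g) \<otimes> ret D (ret (B \<union> D) g)"
        using ret_par' by (intro ret_split[OF pBD]) simp
      also have "\<dots> = ret B g \<otimes> ret D g" by (simp add: ret_ret Int_absorb2)
      finally have "ret (B \<union> D) g = ret D g" using retB by simp
      then show "ret (B \<union> D) g \<in> qp_subgroup \<Gamma> ws D"
        using ret_par'[OF gc, of D] par_subset_qp[OF b DX] by auto
      fix v assume v: "v \<in> set ws"
      then obtain J where J: "J \<in> set Js" "v = r J" by (auto simp: ws_def)
      have vp: "cyc v" "v \<noteq> \<one>" "conn (supp v)" "supp v = J" "root_element G v"
        using b v r[OF J(1)] J(2) by (auto simp: blocks_def)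
      have JI: "J \<subseteq> I" using J Js(2) by blast
      \<comment> \<open>Otherwise \<open>T\<close> would lie in the parabolic subgroup of the smaller set \<open>Z - J\<close>.\<close>
      have "\<exists>t\<in>T. ret J t \<noteq> \<one>"
      proof (rule ccontr)
        assume n: "\<not> ?thesis"
        have pJ: "perp J (Z - J)" using Js(3)[OF J(1)] pIB JI ZIB by (auto simp: perp_def)
        have "T \<subseteq> par (Z - J)"
        proof
          fix t assume t: "t \<in> T"
          have tcr: "t \<in> carrier G" using t Tc by blast
          have "J \<union> (Z - J) = Z" using JI IZ by blast
          then have "t = ret J t \<otimes> ret (Z - J) t" using t T by (intro ret_split[OF pJ]) auto
          then have "t = ret (Z - J) t" using n t tcr by simp
          then show "t \<in> par (Z - J)" using ret_par'[OF tcr] by metis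
        qed
        then have "card Z \<le> card (Z - J)" using min1[of "Z - J"] Z by blast
        moreover have "card (Z - J) < card Z"
          using Js(3)[OF J(1)] JI IZ finZ by (intro psubset_card_mono) auto
        ultimately show False by simp
      qed
      then obtain t m where t: "t \<in> T" "ret J t = v [^] (m::int)" "ret J t \<noteq> \<one>" using retT[OF J(1)] J(2) by blast
      then have "m \<noteq> 0" by (cases "m = 0") auto
      moreover have "ret J g \<in> par (supp v)" using ret_par'[OF gc] vp(4) by simp
      moreover have "ret J g \<otimes> v [^] m = v [^] m \<otimes> ret J g" using comm[OF t(1), of J] t(2) by simp
      ultimately obtain j :: int where "ret J g = v [^] j"
        using centraliser_root_pow[OF vp(1,2,3,5)] by blast
      then show "ret (supp v) g \<in> qp_subgroup \<Gamma> ws D"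
        using vp(4) subgroup_int_pow_closed[OF Q mem_qp[OF v]] by simp
    qed
  qed
  ultimately have "centraliser G T = qp_subgroup \<Gamma> ws D" by blast
  then show ?thesis using qd by (auto simp: canonical_quasiparabolic_def)
qed

theorem centraliser_conjugate_canonical:
  assumes S: "S \<subseteq> carrier G"
  shows "\<exists>g\<in>carrier G. canonical_quasiparabolic \<Gamma> (centraliser G (cj g ` S))"
proof -
  \<comment> \<open>\<open>n\<close> is the size of a set of generators whose parabolic subgroup contains a conjugate of \<open>S\<close>.\<close>
  define P where "P n \<longleftrightarrow> (\<exists>g\<in>carrier G. \<exists>Z\<subseteq>X. card Z = n \<and> cj g ` S \<subseteq> par Z)" for n
  have "cj \<one> ` S \<subseteq> par X" using S cj_image_one[OF S] carrier_par by simp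
  then have "P (card X)" unfolding P_def using one_closed by blast
  then have PL: "P (LEAST n. P n)" by (rule LeastI)
  have least: "(LEAST n. P n) \<le> n" if "P n" for n using that by (rule Least_le)
  from PL obtain g Z where g: "g \<in> carrier G" "Z \<subseteq> X" "card Z = (LEAST n. P n)" "cj g ` S \<subseteq> par Z"
    unfolding P_def by blast
  have minS: "card Z \<le> card Z'" if "k \<in> carrier G" "Z' \<subseteq> X" "cj k ` S \<subseteq> par Z'" for k Z'
    using least[of "card Z'"] that g(3) unfolding P_def by auto
  define R where "R = (\<lambda>(h, c). h \<in> par Z \<and> c \<in> par Z \<and> cyc c \<and> c \<in> centraliser G (cj (g \<otimes> h) ` S))"
  have one: "\<one> \<in> centraliser G T" if "T \<subseteq> carrier G" for T
    using subgroup.one_closed[OF subgroup_centraliser[OF that]] .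
  have "R (\<one>, \<one>)" using one[OF cj_image_carrier[OF g(1) S]] g(1) by (simp add: R_def par_one cyc_one)
  moreover have "card (supp (snd hc)) < Suc (card X)" if "R hc" for hc
    using that supp_subset par_carrier card_mono[OF finite_X]
    by (cases hc) (auto simp: R_def less_Suc_eq_le)
  ultimately obtain hc where hc: "R hc" "\<And>y. R y \<Longrightarrow> card (supp (snd y)) \<le> card (supp (snd hc))"
    using ex_has_greatest_nat[of R _ "\<lambda>y. card (supp (snd y))"] by blast
  obtain h c where "hc = (h, c)" by force
  then have h: "h \<in> par Z" and c: "c \<in> par Z" "cyc c" "c \<in> centraliser G (cj (g \<otimes> h) ` S)"
    and max: "\<And>h' c'. R (h', c') \<Longrightarrow> card (supp c') \<le> card (supp c)"
    using hc by (auto simp: R_def)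
  have hcar [simp]: "h \<in> carrier G" using h par_carrier by blast
  have gc [simp]: "g \<in> carrier G" by (rule g)
  define T where "T = cj (g \<otimes> h) ` S"
  have Th: "T = cj h ` cj g ` S" using S by (simp add: T_def cj_image_cj)
  have "canonical_quasiparabolic \<Gamma> (centraliser G T)"
  proof (rule centraliser_canonical[OF _ g(2)])
    show "T \<subseteq> par Z" unfolding Th
    proof (rule image_subsetI)
      fix s assume "s \<in> cj g ` S"
      then have "s \<in> par Z" using g(4) by blast
      then show "cj h s \<in> par Z" using h unfolding cj_def by (intro par_mult par_inv)
    qed
    show "card Z \<le> card Z'" if "k \<in> carrier G" "Z' \<subseteq> X" "cj k ` T \<subseteq> par Z'" for k Z'
      using minS[of "g \<otimes> h \<otimes> k" Z'] that S by (simp add: T_def cj_image_cj)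
    show "c \<in> par Z" "cyc c" "c \<in> centraliser G T" using c by (auto simp: T_def)
    show "card (supp c') \<le> card (supp c)"
      if k: "k \<in> par Z" "c' \<in> par Z" "cyc c'" "c' \<in> centraliser G (cj k ` T)" for k c'
    proof (rule max[of "h \<otimes> k"])
      have "k \<in> carrier G" using k par_carrier by blast
      then have "cj k ` T = cj (g \<otimes> (h \<otimes> k)) ` S" using S by (simp add: T_def cj_image_cj m_assoc)
      then show "R (h \<otimes> k, c')" using k h par_mult by (simp add: R_def)
    qed
  qed
  then show ?thesis unfolding T_def by (intro bexI[of _ "g \<otimes> h"]) auto
qed

end

theorem theorem3p12:
  fixes \<Gamma> :: "('a, 'b) pre_digraph" and H :: "'a word set set"
  assumes "graph \<Gamma>" and "subgroup H (pc_group \<Gamma>)"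
  shows "(\<exists>S \<subseteq> carrier (pc_group \<Gamma>). H = centraliser (pc_group \<Gamma>) S) \<longleftrightarrow>
    (\<exists>Q. canonical_quasiparabolic \<Gamma> Q \<and> conjugate_subgroups (pc_group \<Gamma>) H Q \<and>
      (\<forall>w ws Y. standard_form \<Gamma> Q w ws Y \<longrightarrow>
        Y \<in> closed_sets \<Gamma> \<and>
        Y \<in> closed_sets (\<Gamma> \<restriction> (orth \<Gamma> (supp w) - supp w))))"
    (is "?centraliser \<longleftrightarrow> ?qp")
proof -
  interpret pc \<Gamma> "pc_group \<Gamma>" by (rule pc.intro[OF assms(1) HOL.refl])
  let ?G = "pc_group \<Gamma>"
  show ?thesis
  proof
    assume ?centraliser
    then obtain S where S: "S \<subseteq> carrier ?G" "H = centraliser ?G S" by blast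
    obtain g where g: "g \<in> carrier ?G" "canonical_quasiparabolic \<Gamma> (centraliser ?G (cj g ` S))"
      using centraliser_conjugate_canonical[OF S(1)] by blast
    define Q where "Q = centraliser ?G (cj g ` S)"
    have "H \<subseteq> carrier ?G" using S(2) by (auto simp: mem_centraliser)
    then have "cj (inv\<^bsub>?G\<^esub> g) ` Q = H"
      using g(1) S by (simp add: Q_def cj_centraliser[symmetric] cj_image_cj cj_image_one)
    then have "conjugate_subgroups ?G H Q"
      using g(1) unfolding conjugate_subgroups_iff by (intro bexI[of _ "inv\<^bsub>?G\<^esub> g"]) auto
    moreover have "Y \<in> closed_sets \<Gamma> \<and> Y \<in> closed_sets (\<Gamma> \<restriction> (orth \<Gamma> (supp w) - supp w))"
      if "standard_form \<Gamma> Q w ws Y" for w ws Y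
      using closed_of_centraliser[OF cj_image_carrier[OF g(1) S(1)] Q_def that] .
    ultimately show ?qp using g(2) Q_def by blast
  next
    assume ?qp
    then obtain Q where Q: "canonical_quasiparabolic \<Gamma> Q" "conjugate_subgroups ?G H Q"
      and cl: "\<And>w ws Y. standard_form \<Gamma> Q w ws Y \<Longrightarrow>
        Y \<in> closed_sets (\<Gamma> \<restriction> (orth \<Gamma> (supp w) - supp w))" by blast
    obtain w ws Y where sf: "standard_form \<Gamma> Q w ws Y" using standard_form_ex[OF Q(1)] by blast
    obtain S where S: "S \<subseteq> carrier ?G" "Q = centraliser ?G S"
      using centraliser_of_closed[OF sf cl[OF sf]] by blast
    obtain g where g: "g \<in> carrier ?G" "H = cj g ` Q" using Q(2) by (auto simp: conjugate_subgroups_iff)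
    then have "H = centraliser ?G (cj g ` S)" using cj_centraliser[OF g(1) S(1)] S(2) by simp
    then show ?centraliser using cj_image_carrier[OF g(1) S(1)] by blast
  qed
qed

end
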